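(* Let $(\beta_{k,T},y_{k,T},u_{k,T})$ be the unique global solution of problem $(\mathrm P_T)$ and let $z_{k,T}$, $p_{k,T}$ (together with some $\nu_{k,T}$) be the corresponding multipliers satisfying the KKT system of $(\mathrm P_T)$. Then there exists a neighborhood of $(\beta_{k,T},y_{k,T},u_{k,T},z_{k,T},p_{k,T})$ such that for all initial values $(\beta_0,y_0,u_0,z_0,p_0)$ from this neighborhood, the semismooth Newton method $$W'(x_i)s_i=-W(x_i),\qquad x_{i+1}=x_i+s_i,\qquad x_i=(\beta_i,y_i,u_i,z_i,p_i),$$ (which stops as soon as $W(x_i)=0$) either terminates in the $i$-th step with $(\beta_i,y_i,u_i,z_i,p_i)=(\beta_{k,T},y_{k,T},u_{k,T},z_{k,T},p_{k,T})$ or generates a sequence that converges $q$-superlinearly to $(\beta_{k,T},y_{k,T},u_{k,T},z_{k,T},p_{k,T})$ in $\mathbb R^n\times H_0^1(\Omega)\times L^2(\Omega)\times\mathbb R^{n+1}\times H_0^1(\Omega)$.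
   Context: **Data.** $\Omega\subset\mathbb R^l$ open and bounded; $H^{-1}(\Omega)=H_0^1(\Omega)^*$; $L^2(\Omega)$ is identified with its dual. $\sigma_u,\sigma_l,\sigma_\beta>0$; $y_m,y_{d,1},\dots,y_{d,n}\in L^2(\Omega)$; $0<a_i<b_i$ and $Q:=\prod_{i=1}^n[b_i^{-1},a_i^{-1}]\subset(0,\infty)^n$. $A:H_0^1(\Omega)\to H^{-1}(\Omega)$ (bijective), $B:L^2(\Omega)\to H^{-1}(\Omega)$, $C_i:H_0^1(\Omega)\to L^2(\Omega)$ are bounded linear. For some $q\in(1,2)$, $B$ extends to a bounded operator $L^q(\Omega)\to H^{-1}(\Omega)$; with $1/q+1/q'=1$, $u_m,u_a,u_b\in L^{q'}(\Omega)$. $U_{ad}=\{v\in L^2(\Omega):u_a\le v\le u_b\text{ a.e.}\}$ is nonempty. $F(\beta,y,u)=\frac12\|y-y_m\|_{L^2}^2+\frac{\sigma_u}2\|u-u_m\|_{L^2}^2+\frac{\sigma_\beta}2\sum_{i=1}^n\beta_i^{-2}$, $\ f(\beta,y,u)=\sum_{i=1}^n\frac1{2\beta_i}\|C_iy-y_{d,i}\|_{L^2}^2+\frac{\sigma_l}2\|u\|_{L^2}^2$, $\ \varphi(\beta)=\min\{f(\beta,y,u):Ay=Bu,\ u\in U_{ad}\}$. $T\subset Q$ is a non-degenerate $n$-simplex, $T=\{\beta\in\mathbb R^n:K_T\beta\le b_T\}$ with $K_T\in\mathbb R^{(n+1)\times n}$, $b_T\in\mathbb R^{n+1}$; $\xi_T$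 is the affine function interpolating $\varphi$ at the vertices of $T$ and $a_T\in\mathbb R^n$ its gradient; $\gamma_{k,T}>0$. **Problem $(\mathrm P_T)$:** minimize $F(\beta,y,u)+\gamma_{k,T}(f(\beta,y,u)-\xi_T(\beta))$ subject to $K_T\beta-b_T\le0$, $Ay-Bu=0$, $u\in U_{ad}$. **KKT system** (with $p\in H_0^1(\Omega)$, $z\in\mathbb R^{n+1}$, $\nu\in L^2(\Omega)$): $F'_\beta+\gamma_{k,T}(f'_\beta-a_T)+K_T^\top z=0$; $F'_y+\gamma_{k,T}f'_y+A^*p=0$; $F'_u+\gamma_{k,T}f'_u-B^*p+\nu=0$; $Ay=Bu$; $z\ge0$, $K_T\beta-b_T\le0$, $z^\top(K_T\beta-b_T)=0$; $u\in U_{ad}$, $\nu\in\mathcal N_{U_{ad}}(u)$ (normal cone). **The map $W$.** Let $\hat\sigma:=\sigma_u+\gamma_{k,T}\sigma_l$ and $h(\beta,y):=\frac12\|y-y_m\|_{L^2}^2+\gamma_{k,T}\big(\sum_{i=1}^n\frac1{2\beta_i}\|C_iy-y_{d,i}\|_{L^2}^2-\xi_T(\beta)\big)+\frac{\sigma_\beta}2\sum_{i=1}^n\beta_i^{-2}$ on $(0,\infty)^n\times H_0^1(\Omega)$ ($\xi_T$ extended affinely). $W:(0,\infty)^n\times H_0^1(\Omega)\times L^2(\Omega)\times\mathbb R^{n+1}\times H_0^1(\Omega)\to\mathbb R^n\times H^{-1}(\Omega)\times L^2(\Omega)\times\mathbb R^{n+1}\times H^{-1}(\Omega)$, $$W(\beta,y,u,z,p)=\begin{pmatrix}h'_\beta(\beta,y)+K_T^\top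 z\\ h'_y(\beta,y)+A^*p\\ u-\min(\max((B^*p+\sigma_uu_m)/\hat\sigma,u_a),u_b)\\ \max(K_T\beta-b_T,-z)\\ Ay-Bu\end{pmatrix}$$ (min, max pointwise/componentwise). **The Newton derivative $W'$.** With $\mathcal A_1=\{i:(K_T\beta-b_T)_i\ge-z_i\}$, $\mathcal A_2=\{i:(K_T\beta-b_T)_i<-z_i\}$, $\mathcal A_3=\{u_a\le(B^*p+\sigma_uu_m)/\hat\sigma\le u_b\}\subset\Omega$, and $\chi_{\mathcal A_1},\chi_{\mathcal A_2}$ the diagonal 0-1 matrices and $\chi_{\mathcal A_3}$ the multiplication operator by the characteristic function, $$W'(\beta,y,u,z,p)=\begin{bmatrix}h''_{\beta\beta}&h''_{\beta y}&0&K_T^\top&0\\ h''_{y\beta}&h''_{yy}&0&0&A^*\\0&0&\mathrm{Id}&0&-\hat\sigma^{-1}\chi_{\mathcal A_3}B^*\\ \chi_{\mathcal A_1}K_T&0&0&-\chi_{\mathcal A_2}&0\\0&A&-B&0&0\end{bmatrix},$$ second derivatives of $h$ taken at $(\beta,y)$. *)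

theory Defs
  imports "HOL-Analysis.Analysis"
begin

text \<open>
  Function spaces over an open set \<open>\<Omega>\<close> of \<open>R^l\<close> are closed subspaces of spaces over all of
  \<open>R^l\<close>, functions on \<open>\<Omega>\<close> being extended by zero.  In this way norms, limits and Frechet
  derivatives are those of the library, taken within subspaces.
\<close>

subsection \<open>\<open>L\<^sup>2(R^l)\<close> as a type of almost-everywhere classes\<close>

definition square_integrable :: "(real^'l \<Rightarrow> real) \<Rightarrow> bool" where
  "square_integrable f \<longleftrightarrow> f \<in> borel_measurable lebesgue \<and> integrable lebesgue (\<lambda>x. (f x)\<^sup>2)"

lemma square_integrable_mult:
  assumes "square_integrable f" "square_integrable g"
  shows "integrable lebesgue (\<lambda>x. f x * g x)"
proof (rule Bochner_Integration.integrable_bound)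
  show "integrable lebesgue (\<lambda>x. (f x)\<^sup>2 + (g x)\<^sup>2)"
    using assms by (auto simp: square_integrable_def)
  show "(\<lambda>x. f x * g x) \<in> borel_measurable lebesgue"
    using assms by (auto simp: square_integrable_def)
  have bound: "\<bar>a * b\<bar> \<le> a\<^sup>2 + b\<^sup>2" for a b :: real
  proof -
    have "2 * \<bar>a\<bar> * \<bar>b\<bar> \<le> a\<^sup>2 + b\<^sup>2"
      using sum_squares_bound[of "\<bar>a\<bar>" "\<bar>b\<bar>"] by simp
    moreover have "0 \<le> \<bar>a\<bar> * \<bar>b\<bar>" by simp
    ultimately show ?thesis unfolding abs_mult by linarith
  qed
  show "AE x in lebesgue. norm (f x * g x) \<le> norm ((f x)\<^sup>2 + (g x)\<^sup>2)"
    unfolding real_norm_def by (intro AE_I2 order_trans[OF bound] abs_ge_self)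
qed

lemma square_integrable_add:
  assumes "square_integrable f" "square_integrable g"
  shows "square_integrable (\<lambda>x. f x + g x)"
  using assms square_integrable_mult[OF assms]
  by (auto simp: square_integrable_def power2_sum mult.assoc)

lemma square_integrable_scale: "square_integrable f \<Longrightarrow> square_integrable (\<lambda>x. c * f x)"
  by (auto simp: square_integrable_def power_mult_distrib)

lemma square_integrable_zero: "square_integrable (\<lambda>x. 0)"
  by (auto simp: square_integrable_def)

definition L2_eq :: "(real^'l \<Rightarrow> real) \<Rightarrow> (real^'l \<Rightarrow> real) \<Rightarrow> bool" where
  "L2_eq f g \<longleftrightarrow> square_integrable f \<and> square_integrable g \<and> (AE x in lebesgue. f x = g x)"

lemma part_equivp_L2_eq: "part_equivp (L2_eq :: (real^'l \<Rightarrow> real) \<Rightarrow> _)"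
proof (rule part_equivpI)
  show "\<exists>x :: real^'l \<Rightarrow> real. L2_eq x x"
    by (rule exI[of _ "\<lambda>x. 0"]) (simp add: L2_eq_def square_integrable_zero)
  show "symp (L2_eq :: (real^'l \<Rightarrow> real) \<Rightarrow> _)"
    by (rule sympI) (auto simp: L2_eq_def eq_commute)
  show "transp (L2_eq :: (real^'l \<Rightarrow> real) \<Rightarrow> _)"
  proof (rule transpI)
    fix f g h :: "real^'l \<Rightarrow> real"
    assume *: "L2_eq f g" "L2_eq g h"
    then have "AE x in lebesgue. f x = g x" "AE x in lebesgue. g x = h x"
      by (simp_all add: L2_eq_def)
    then have "AE x in lebesgue. f x = h x" by eventually_elim simp
    with * show "L2_eq f h" by (simp add: L2_eq_def)
  qed
qed

lemma L2_eq_unary: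
  fixes f f' :: "real^'l \<Rightarrow> real"
  assumes "L2_eq f f'" "\<And>g :: real^'l \<Rightarrow> real. square_integrable g \<Longrightarrow> square_integrable (\<lambda>x. t (g x))"
  shows "L2_eq (\<lambda>x. t (f x)) (\<lambda>x. t (f' x))"
proof -
  have "AE x in lebesgue. f x = f' x" using assms(1) by (simp add: L2_eq_def)
  then have "AE x in lebesgue. t (f x) = t (f' x)" by eventually_elim simp
  with assms show ?thesis by (simp add: L2_eq_def)
qed

lemma L2_eq_AE_binary:
  assumes "L2_eq f f'" "L2_eq g g'"
  shows "AE x in lebesgue. t (f x) (g x) = t (f' x) (g' x)"
proof -
  have "AE x in lebesgue. f x = f' x" "AE x in lebesgue. g x = g' x"
    using assms by (simp_all add: L2_eq_def)
  then show ?thesis by eventually_elim simp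
qed

text \<open>\<open>L2_fun u\<close> is some representative of the class \<open>u\<close>; \<open>L2_of f\<close> is the class of a
  square-integrable \<open>f\<close>.\<close>

quotient_type 'l L2 = "real^'l::finite \<Rightarrow> real" / partial: L2_eq
  morphisms L2_fun L2_of
  by (rule part_equivp_L2_eq)

instantiation L2 :: (finite) real_inner
begin

lift_definition zero_L2 :: "'a L2" is "\<lambda>x. 0"
  by (simp add: L2_eq_def square_integrable_zero)

lift_definition plus_L2 :: "'a L2 \<Rightarrow> 'a L2 \<Rightarrow> 'a L2" is "\<lambda>f g x. f x + g x"
  using L2_eq_AE_binary by (simp add: L2_eq_def square_integrable_add)

lift_definition scaleR_L2 :: "real \<Rightarrow> 'a L2 \<Rightarrow> 'a L2" is "\<lambda>c f x. c * f x"
  by (rule L2_eq_unary) (auto intro: square_integrable_scale)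

lift_definition uminus_L2 :: "'a L2 \<Rightarrow> 'a L2" is "\<lambda>f x. - f x"
  by (rule L2_eq_unary) (use square_integrable_scale[of _ "-1"] in auto)

definition minus_L2 :: "'a L2 \<Rightarrow> 'a L2 \<Rightarrow> 'a L2" where
  "minus_L2 u v = u + (- v)"

lift_definition inner_L2 :: "'a L2 \<Rightarrow> 'a L2 \<Rightarrow> real" is "\<lambda>f g. LINT x|lebesgue. f x * g x"
proof -
  fix f f' g g' :: "real^'a \<Rightarrow> real"
  assume 1: "L2_eq f f'" and 2: "L2_eq g g'"
  show "(LINT x|lebesgue. f x * g x) = (LINT x|lebesgue. f' x * g' x)"
  proof (rule integral_cong_AE)
    show "AE x in lebesgue. f x * g x = f' x * g' x"
      by (rule L2_eq_AE_binary[OF 1 2])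
  qed (use 1 2 in \<open>auto simp: L2_eq_def square_integrable_def\<close>)
qed

definition norm_L2 :: "'a L2 \<Rightarrow> real" where
  "norm_L2 u = sqrt (inner u u)"

definition dist_L2 :: "'a L2 \<Rightarrow> 'a L2 \<Rightarrow> real" where
  "dist_L2 u v = norm (u - v)"

definition sgn_L2 :: "'a L2 \<Rightarrow> 'a L2" where
  "sgn_L2 u = scaleR (inverse (norm u)) u"

definition uniformity_L2 :: "('a L2 \<times> 'a L2) filter" where
  "uniformity_L2 = (INF e\<in>{0<..}. principal {(u, v). dist u v < e})"

definition open_L2 :: "'a L2 set \<Rightarrow> bool" where
  "open_L2 U \<longleftrightarrow> (\<forall>u\<in>U. \<forall>\<^sub>F (u', v) in uniformity. u' = u \<longrightarrow> v \<in> U)"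

instance
proof
  fix u v w :: "'a L2" and a b :: real and U :: "'a L2 set"
  show "u + v + w = u + (v + w)"
    by transfer (auto simp: L2_eq_def square_integrable_add add.assoc)
  show "u + v = v + u"
    by transfer (auto simp: L2_eq_def square_integrable_add add.commute)
  show "0 + u = u"
    by transfer (auto simp: L2_eq_def)
  show "- u + u = 0"
    by transfer (auto simp: L2_eq_def square_integrable_zero)
  show "u - v = u + - v"
    by (simp add: minus_L2_def)
  show "a *\<^sub>R (u + v) = a *\<^sub>R u + a *\<^sub>R v"
    by transfer (auto simp: L2_eq_def square_integrable_add square_integrable_scale distrib_left)
  show "(a + b) *\<^sub>R u = a *\<^sub>R u + b *\<^sub>R u"
    by transfer (auto simp: L2_eq_def square_integrable_add square_integrable_scale distrib_right)
  show "a *\<^sub>R b *\<^sub>R u = (a * b) *\<^sub>R u"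
    by transfer (auto simp: L2_eq_def square_integrable_scale mult.assoc)
  show "1 *\<^sub>R u = u"
    by transfer (auto simp: L2_eq_def)
  show "dist u v = norm (u - v)"
    by (simp add: dist_L2_def)
  show "sgn u = scaleR (inverse (norm u)) u"
    by (simp add: sgn_L2_def)
  show "uniformity = (INF e\<in>{0<..}. principal {(u :: 'a L2, v). dist u v < e})"
    by (simp add: uniformity_L2_def)
  show "open U \<longleftrightarrow> (\<forall>u\<in>U. \<forall>\<^sub>F (u', v) in uniformity. u' = u \<longrightarrow> v \<in> U)"
    by (simp add: open_L2_def)
  show "inner u v = inner v u"
    by transfer (simp add: mult.commute)
  show "inner (u + v) w = inner u w + inner v w"
    by transfer (auto simp: L2_eq_def distrib_right square_integrable_mult)
  show "inner (a *\<^sub>R u) v = a * inner u v"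
    by transfer (simp add: mult.assoc)
  show "0 \<le> inner u u"
    by transfer simp
  show "inner u u = 0 \<longleftrightarrow> u = 0"
  proof transfer
    fix f :: "real^'a \<Rightarrow> real"
    assume "L2_eq f f"
    then have f: "square_integrable f" by (simp add: L2_eq_def)
    have "(LINT x|lebesgue. f x * f x) = 0 \<longleftrightarrow> (AE x in lebesgue. f x * f x = 0)"
      by (rule integral_nonneg_eq_0_iff_AE) (auto intro: square_integrable_mult f)
    then show "(LINT x|lebesgue. f x * f x) = 0 \<longleftrightarrow> L2_eq f (\<lambda>x. 0)"
      using f by (simp add: L2_eq_def square_integrable_zero)
  qed
  show "norm u = sqrt (inner u u)"
    by (simp add: norm_L2_def)
qed

end

subsection \<open>Function spaces on \<open>\<Omega>\<close>\<close>

definition L2_on :: "(real^'l::finite) set \<Rightarrow> 'l L2 set" where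
  "L2_on \<Omega> = {u. AE x in lebesgue. x \<notin> \<Omega> \<longrightarrow> L2_fun u x = 0}"

text \<open>For exponents other than 2, \<open>L^p(\<Omega>)\<close> is represented by functions instead of classes.\<close>

definition Lp_fun :: "real \<Rightarrow> (real^'l::finite) set \<Rightarrow> (real^'l \<Rightarrow> real) set" where
  "Lp_fun p \<Omega> = {f. f \<in> borel_measurable (lebesgue_on \<Omega>) \<and>
                    integrable (lebesgue_on \<Omega>) (\<lambda>x. \<bar>f x\<bar> powr p)}"

definition Lp_norm :: "real \<Rightarrow> (real^'l::finite) set \<Rightarrow> (real^'l \<Rightarrow> real) \<Rightarrow> real" where
  "Lp_norm p \<Omega> f = (LINT x|lebesgue_on \<Omega>. \<bar>f x\<bar> powr p) powr (1 / p)"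

definition partial_derivative :: "'l \<Rightarrow> (real^'l::finite \<Rightarrow> real) \<Rightarrow> real^'l \<Rightarrow> real" where
  "partial_derivative i f x = frechet_derivative f (at x) (axis i 1)"

definition smooth :: "(real^'l::finite \<Rightarrow> real) \<Rightarrow> bool" where
  "smooth f \<longleftrightarrow> (\<forall>js. foldr partial_derivative js f differentiable_on UNIV)"

definition test_functions :: "(real^'l::finite) set \<Rightarrow> (real^'l \<Rightarrow> real) set" where
  "test_functions \<Omega> = {f. smooth f \<and> compact (closure {x. f x \<noteq> 0}) \<and>
                          closure {x. f x \<noteq> 0} \<subseteq> \<Omega>}"

text \<open>An element of \<open>H\<^sub>0\<^sup>1(\<Omega>)\<close> is the pair of a function and its weak gradient, so that the norm of
  the product type is the norm of \<open>H\<^sup>1\<close>; the first component determines the second.\<close>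

type_synonym 'l H1 = "'l L2 \<times> ('l L2, 'l) vec"

definition H01 :: "(real^'l::finite) set \<Rightarrow> 'l H1 set" where
  "H01 \<Omega> = closure ((\<lambda>f. (L2_of f, \<chi> i. L2_of (partial_derivative i f))) ` test_functions \<Omega>)"

text \<open>The dual of a closed subspace \<open>S\<close> of a Hilbert space: a bounded linear functional on \<open>S\<close> is
  identified, isometrically, with its extension that vanishes on the orthogonal complement
  of \<open>S\<close>.\<close>

definition dual_of :: "'a::real_inner set \<Rightarrow> ('a \<Rightarrow>\<^sub>L real) set" where
  "dual_of S = {g. \<forall>v\<in>orthogonal_comp S. blinfun_apply g v = 0}"

definition Hm1 :: "(real^'l::finite) set \<Rightarrow> ('l H1 \<Rightarrow>\<^sub>L real) set" where
  "Hm1 \<Omega> = dual_of (H01 \<Omega>)"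

definition bounded_linear_on ::
  "'a::real_normed_vector set \<Rightarrow> ('a \<Rightarrow> 'b::real_normed_vector) \<Rightarrow> bool" where
  "bounded_linear_on S f \<longleftrightarrow>
     (\<forall>x\<in>S. \<forall>y\<in>S. f (x + y) = f x + f y) \<and>
     (\<forall>c. \<forall>x\<in>S. f (c *\<^sub>R x) = c *\<^sub>R f x) \<and>
     (\<exists>K. \<forall>x\<in>S. norm (f x) \<le> K * norm x)"

text \<open>Linearity together with the bound makes the value independent of the representative.\<close>

definition bounded_linear_on_Lp ::
  "real \<Rightarrow> (real^'l::finite) set \<Rightarrow> ((real^'l \<Rightarrow> real) \<Rightarrow> 'b::real_normed_vector) \<Rightarrow> bool" where
  "bounded_linear_on_Lp p \<Omega> F \<longleftrightarrow>
     (\<forall>f\<in>Lp_fun p \<Omega>. \<forall>g\<in>Lp_fun p \<Omega>. F (\<lambda>x. f x + g x) = F f + F g) \<and>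
     (\<forall>c. \<forall>f\<in>Lp_fun p \<Omega>. F (\<lambda>x. c * f x) = c *\<^sub>R F f) \<and>
     (\<exists>K. \<forall>f\<in>Lp_fun p \<Omega>. norm (F f) \<le> K * Lp_norm p \<Omega> f)"

text \<open>Derivatives along a closed subspace \<open>S\<close>, as an element of the dual of \<open>S\<close> and, when \<open>S\<close> is
  identified with its dual, as an element of \<open>S\<close>.\<close>

definition dual_derivative :: "'a::real_inner set \<Rightarrow> ('a \<Rightarrow> real) \<Rightarrow> 'a \<Rightarrow> ('a \<Rightarrow>\<^sub>L real)" where
  "dual_derivative S f x =
     (THE g. g \<in> dual_of S \<and> (f has_derivative blinfun_apply g) (at x within S))"

definition gradient_on :: "'a::real_inner set \<Rightarrow> ('a \<Rightarrow> real) \<Rightarrow> 'a \<Rightarrow> 'a" where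
  "gradient_on S f x = (THE g. g \<in> S \<and> (f has_derivative (\<lambda>v. inner v g)) (at x within S))"

abbreviation gradient :: "('a::real_inner \<Rightarrow> real) \<Rightarrow> 'a \<Rightarrow> 'a" where
  "gradient \<equiv> gradient_on UNIV"

definition normal_cone :: "'a::real_inner set \<Rightarrow> 'a set \<Rightarrow> 'a \<Rightarrow> 'a set" where
  "normal_cone S U u = {\<nu> \<in> S. u \<in> U \<and> (\<forall>v\<in>U. inner \<nu> (v - u) \<le> 0)}"

subsection \<open>Problem data\<close>

text \<open>\<open>K_T\<close>, \<open>b_T\<close> describe the simplex and \<open>\<xi>\<^sub>T(\<beta>) = a_T \<bullet> \<beta> + c_T\<close>.  The index type \<open>'m\<close> has one
  element more than \<open>'n\<close>.  The operators are only meaningful on their domains \<open>H\<^sub>0\<^sup>1(\<Omega>)\<close> and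
  \<open>L\<^sup>2(\<Omega>)\<close>.\<close>

record ('l, 'n, 'm) prob_data =
  Dom :: "(real, 'l) vec set"
  sig_u :: real
  sig_l :: real
  sig_b :: real
  y_m :: "'l::finite L2"
  y_d :: "'n \<Rightarrow> 'l L2"
  lo :: "(real, 'n::finite) vec"
  up :: "(real, 'n) vec"
  op_A :: "'l H1 \<Rightarrow> ('l H1 \<Rightarrow>\<^sub>L real)"
  op_B :: "'l L2 \<Rightarrow> ('l H1 \<Rightarrow>\<^sub>L real)"
  op_C :: "'n \<Rightarrow> 'l H1 \<Rightarrow> 'l L2"
  u_m :: "'l L2"
  u_a :: "'l L2"
  u_b :: "'l L2"
  gam :: real
  K_T :: "((real, 'n) vec, 'm::finite) vec"
  b_T :: "(real, 'm) vec"
  a_T :: "(real, 'n) vec"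
  c_T :: real

definition param_box :: "('l::finite, 'n::finite, 'm::finite) prob_data \<Rightarrow> (real^'n) set" where
  "param_box D = {\<beta>. \<forall>i. inverse (up D $ i) \<le> \<beta> $ i \<and> \<beta> $ i \<le> inverse (lo D $ i)}"

definition U_ad :: "('l::finite, 'n::finite, 'm::finite) prob_data \<Rightarrow> 'l L2 set" where
  "U_ad D = {v \<in> L2_on (Dom D). AE x in lebesgue_on (Dom D).
               L2_fun (u_a D) x \<le> L2_fun v x \<and> L2_fun v x \<le> L2_fun (u_b D) x}"

definition obj_F ::
  "('l::finite, 'n::finite, 'm::finite) prob_data \<Rightarrow> real^'n \<Rightarrow> 'l H1 \<Rightarrow> 'l L2 \<Rightarrow> real" where
  "obj_F D \<beta> y u = 1 / 2 * (norm (fst y - y_m D))\<^sup>2 + sig_u D / 2 * (norm (u - u_m D))\<^sup>2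
                   + sig_b D / 2 * (\<Sum>i\<in>UNIV. inverse ((\<beta> $ i)\<^sup>2))"

definition obj_f ::
  "('l::finite, 'n::finite, 'm::finite) prob_data \<Rightarrow> real^'n \<Rightarrow> 'l H1 \<Rightarrow> 'l L2 \<Rightarrow> real" where
  "obj_f D \<beta> y u = (\<Sum>i\<in>UNIV. 1 / (2 * \<beta> $ i) * (norm (op_C D i y - y_d D i))\<^sup>2)
                   + sig_l D / 2 * (norm u)\<^sup>2"

definition opt_value :: "('l::finite, 'n::finite, 'm::finite) prob_data \<Rightarrow> real^'n \<Rightarrow> real" where
  "opt_value D \<beta> = (LEAST r. \<exists>y\<in>H01 (Dom D). \<exists>u\<in>U_ad D.
                       op_A D y = op_B D u \<and> r = obj_f D \<beta> y u)"

definition xi_T :: "('l::finite, 'n::finite, 'm::finite) prob_data \<Rightarrow> real^'n \<Rightarrow> real" where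
  "xi_T D \<beta> = inner (a_T D) \<beta> + c_T D"

text \<open>The adjoints \<open>A\<^sup>* : H\<^sub>0\<^sup>1 \<rightarrow> H\<^sup>-\<^sup>1\<close> and \<open>B\<^sup>* : H\<^sub>0\<^sup>1 \<rightarrow> L\<^sup>2\<close>.\<close>

definition A_adj :: "('l::finite, 'n::finite, 'm::finite) prob_data \<Rightarrow> 'l H1 \<Rightarrow> ('l H1 \<Rightarrow>\<^sub>L real)" where
  "A_adj D p = (THE g. g \<in> Hm1 (Dom D) \<and>
                  (\<forall>v\<in>H01 (Dom D). blinfun_apply g v = blinfun_apply (op_A D v) p))"

definition B_adj :: "('l::finite, 'n::finite, 'm::finite) prob_data \<Rightarrow> 'l H1 \<Rightarrow> 'l L2" where
  "B_adj D p = (THE w. w \<in> L2_on (Dom D) \<and>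
                  (\<forall>v\<in>L2_on (Dom D). inner w v = blinfun_apply (op_B D v) p))"

subsection \<open>Problem \<open>(P\<^sub>T)\<close> and its KKT system\<close>

definition feasible ::
  "('l::finite, 'n::finite, 'm::finite) prob_data \<Rightarrow> ((real^'n) \<times> 'l H1 \<times> 'l L2) set" where
  "feasible D = {(\<beta>, y, u). (\<forall>i. (K_T D *v \<beta> - b_T D) $ i \<le> 0) \<and> y \<in> H01 (Dom D) \<and>
                            op_A D y - op_B D u = 0 \<and> u \<in> U_ad D}"

definition obj_PT ::
  "('l::finite, 'n::finite, 'm::finite) prob_data \<Rightarrow> (real^'n) \<times> 'l H1 \<times> 'l L2 \<Rightarrow> real" where
  "obj_PT D = (\<lambda>(\<beta>, y, u). obj_F D \<beta> y u + gam D * (obj_f D \<beta> y u - xi_T D \<beta>))"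

definition global_solution_PT ::
  "('l::finite, 'n::finite, 'm::finite) prob_data \<Rightarrow> (real^'n) \<times> 'l H1 \<times> 'l L2 \<Rightarrow> bool" where
  "global_solution_PT D w \<longleftrightarrow> w \<in> feasible D \<and> (\<forall>w'\<in>feasible D. obj_PT D w \<le> obj_PT D w')"

definition KKT :: "('l::finite, 'n::finite, 'm::finite) prob_data \<Rightarrow>
    real^'n \<Rightarrow> 'l H1 \<Rightarrow> 'l L2 \<Rightarrow> real^'m \<Rightarrow> 'l H1 \<Rightarrow> 'l L2 \<Rightarrow> bool" where
  "KKT D \<beta> y u z p \<nu> \<longleftrightarrow>
     y \<in> H01 (Dom D) \<and> p \<in> H01 (Dom D) \<and> \<nu> \<in> L2_on (Dom D) \<and>
     gradient (\<lambda>\<beta>'. obj_F D \<beta>' y u) \<beta>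
       + gam D *\<^sub>R (gradient (\<lambda>\<beta>'. obj_f D \<beta>' y u) \<beta> - a_T D) + transpose (K_T D) *v z = 0 \<and>
     dual_derivative (H01 (Dom D)) (\<lambda>y'. obj_F D \<beta> y' u) y
       + gam D *\<^sub>R dual_derivative (H01 (Dom D)) (\<lambda>y'. obj_f D \<beta> y' u) y + A_adj D p = 0 \<and>
     gradient_on (L2_on (Dom D)) (\<lambda>u'. obj_F D \<beta> y u') u
       + gam D *\<^sub>R gradient_on (L2_on (Dom D)) (\<lambda>u'. obj_f D \<beta> y u') u - B_adj D p + \<nu> = 0 \<and>
     op_A D y = op_B D u \<and>
     (\<forall>i. 0 \<le> z $ i) \<and> (\<forall>i. (K_T D *v \<beta> - b_T D) $ i \<le> 0) \<and>
     inner z (K_T D *v \<beta> - b_T D) = 0 \<and>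
     u \<in> U_ad D \<and> \<nu> \<in> normal_cone (L2_on (Dom D)) (U_ad D) u"

subsection \<open>The Newton map\<close>

type_synonym ('l, 'n, 'm) iterate =
  "(real, 'n) vec \<times> 'l H1 \<times> 'l L2 \<times> (real, 'm) vec \<times> 'l H1"

type_synonym ('l, 'n, 'm) residual =
  "(real, 'n) vec \<times> ('l H1 \<Rightarrow>\<^sub>L real) \<times> 'l L2 \<times> (real, 'm) vec \<times> ('l H1 \<Rightarrow>\<^sub>L real)"

text \<open>The domain of \<open>W\<close> and the linear space of Newton directions.\<close>

definition W_dom ::
  "('l::finite, 'n::finite, 'm::finite) prob_data \<Rightarrow> ('l, 'n, 'm) iterate set" where
  "W_dom D = {\<beta>. \<forall>i. 0 < \<beta> $ i} \<times> H01 (Dom D) \<times> L2_on (Dom D) \<times> UNIV \<times> H01 (Dom D)"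

definition W_dirs ::
  "('l::finite, 'n::finite, 'm::finite) prob_data \<Rightarrow> ('l, 'n, 'm) iterate set" where
  "W_dirs D = UNIV \<times> H01 (Dom D) \<times> L2_on (Dom D) \<times> UNIV \<times> H01 (Dom D)"

definition sig_hat :: "('l::finite, 'n::finite, 'm::finite) prob_data \<Rightarrow> real" where
  "sig_hat D = sig_u D + gam D * sig_l D"

definition h_fun ::
  "('l::finite, 'n::finite, 'm::finite) prob_data \<Rightarrow> real^'n \<Rightarrow> 'l H1 \<Rightarrow> real" where
  "h_fun D \<beta> y = 1 / 2 * (norm (fst y - y_m D))\<^sup>2
     + gam D * ((\<Sum>i\<in>UNIV. 1 / (2 * \<beta> $ i) * (norm (op_C D i y - y_d D i))\<^sup>2) - xi_T D \<beta>)
     + sig_b D / 2 * (\<Sum>i\<in>UNIV. inverse ((\<beta> $ i)\<^sup>2))"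

definition h_b ::
  "('l::finite, 'n::finite, 'm::finite) prob_data \<Rightarrow> real^'n \<Rightarrow> 'l H1 \<Rightarrow> real^'n" where
  "h_b D \<beta> y = gradient (\<lambda>\<beta>'. h_fun D \<beta>' y) \<beta>"

definition h_y ::
  "('l::finite, 'n::finite, 'm::finite) prob_data \<Rightarrow> real^'n \<Rightarrow> 'l H1 \<Rightarrow> ('l H1 \<Rightarrow>\<^sub>L real)" where
  "h_y D \<beta> y = dual_derivative (H01 (Dom D)) (\<lambda>y'. h_fun D \<beta> y') y"

text \<open>Second derivatives.  Those in \<open>y\<close> are determined on directions in \<open>H\<^sub>0\<^sup>1(\<Omega>)\<close> only.\<close>

definition h_bb ::
  "('l::finite, 'n::finite, 'm::finite) prob_data \<Rightarrow> real^'n \<Rightarrow> 'l H1 \<Rightarrow> real^'n \<Rightarrow> real^'n" where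
  "h_bb D \<beta> y = frechet_derivative (\<lambda>\<beta>'. h_b D \<beta>' y) (at \<beta>)"

definition h_by ::
  "('l::finite, 'n::finite, 'm::finite) prob_data \<Rightarrow> real^'n \<Rightarrow> 'l H1 \<Rightarrow> 'l H1 \<Rightarrow> real^'n" where
  "h_by D \<beta> y = frechet_derivative (\<lambda>y'. h_b D \<beta> y') (at y within H01 (Dom D))"

definition h_yb :: "('l::finite, 'n::finite, 'm::finite) prob_data \<Rightarrow>
    real^'n \<Rightarrow> 'l H1 \<Rightarrow> real^'n \<Rightarrow> ('l H1 \<Rightarrow>\<^sub>L real)" where
  "h_yb D \<beta> y = frechet_derivative (\<lambda>\<beta>'. h_y D \<beta>' y) (at \<beta>)"

definition h_yy :: "('l::finite, 'n::finite, 'm::finite) prob_data \<Rightarrow>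
    real^'n \<Rightarrow> 'l H1 \<Rightarrow> 'l H1 \<Rightarrow> ('l H1 \<Rightarrow>\<^sub>L real)" where
  "h_yy D \<beta> y = frechet_derivative (\<lambda>y'. h_y D \<beta> y') (at y within H01 (Dom D))"

text \<open>The unprojected control \<open>(B\<^sup>*p + \<sigma>\<^sub>u u\<^sub>m) / \<sigma>\<close> with \<open>\<sigma> = sig_hat\<close>.\<close>

definition ctrl :: "('l::finite, 'n::finite, 'm::finite) prob_data \<Rightarrow> 'l H1 \<Rightarrow> 'l L2" where
  "ctrl D p = (B_adj D p + sig_u D *\<^sub>R u_m D) /\<^sub>R sig_hat D"

definition newton_W ::
  "('l::finite, 'n::finite, 'm::finite) prob_data \<Rightarrow> ('l, 'n, 'm) iterate \<Rightarrow> ('l, 'n, 'm) residual"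
  where
  "newton_W D = (\<lambda>(\<beta>, y, u, z, p).
     (h_b D \<beta> y + transpose (K_T D) *v z,
      h_y D \<beta> y + A_adj D p,
      u - L2_of (\<lambda>x. min (max (L2_fun (ctrl D p) x) (L2_fun (u_a D) x)) (L2_fun (u_b D) x)),
      \<chi> i. max ((K_T D *v \<beta> - b_T D) $ i) (- (z $ i)),
      op_A D y - op_B D u))"

definition diag_ind :: "'m set \<Rightarrow> real^'m^'m::finite" where
  "diag_ind S = (\<chi> i j. if i = j \<and> i \<in> S then 1 else 0)"

definition mult_ind :: "(real^'l) set \<Rightarrow> 'l::finite L2 \<Rightarrow> 'l L2" where
  "mult_ind S w = L2_of (\<lambda>x. indicator S x * L2_fun w x)"

definition act1 ::
  "('l::finite, 'n::finite, 'm::finite) prob_data \<Rightarrow> real^'n \<Rightarrow> real^'m \<Rightarrow> 'm set" where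
  "act1 D \<beta> z = {i. (K_T D *v \<beta> - b_T D) $ i \<ge> - (z $ i)}"

definition act2 ::
  "('l::finite, 'n::finite, 'm::finite) prob_data \<Rightarrow> real^'n \<Rightarrow> real^'m \<Rightarrow> 'm set" where
  "act2 D \<beta> z = {i. (K_T D *v \<beta> - b_T D) $ i < - (z $ i)}"

definition act3 ::
  "('l::finite, 'n::finite, 'm::finite) prob_data \<Rightarrow> 'l H1 \<Rightarrow> (real^'l) set" where
  "act3 D p = {x \<in> Dom D. L2_fun (u_a D) x \<le> L2_fun (ctrl D p) x \<and>
                          L2_fun (ctrl D p) x \<le> L2_fun (u_b D) x}"

definition newton_W' :: "('l::finite, 'n::finite, 'm::finite) prob_data \<Rightarrow>
    ('l, 'n, 'm) iterate \<Rightarrow> ('l, 'n, 'm) iterate \<Rightarrow> ('l, 'n, 'm) residual" where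
  "newton_W' D = (\<lambda>(\<beta>, y, u, z, p) (d\<beta>, dy, du, dz, dp).
     (h_bb D \<beta> y d\<beta> + h_by D \<beta> y dy + transpose (K_T D) *v dz,
      h_yb D \<beta> y d\<beta> + h_yy D \<beta> y dy + A_adj D dp,
      du - mult_ind (act3 D p) (B_adj D dp) /\<^sub>R sig_hat D,
      diag_ind (act1 D \<beta> z) *v (K_T D *v d\<beta>) - diag_ind (act2 D \<beta> z) *v dz,
      op_A D dy - op_B D du))"

subsection \<open>The semismooth Newton method\<close>

text \<open>The run is well defined: every iterate lies in the domain of \<open>W\<close> and, as long as the method
  has not stopped, the Newton equation has exactly one solution.  After stopping, the sequence is
  continued constantly.\<close>

definition newton_run :: "('l::finite, 'n::finite, 'm::finite) prob_data \<Rightarrow>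
    ('l, 'n, 'm) iterate \<Rightarrow> (nat \<Rightarrow> ('l, 'n, 'm) iterate) \<Rightarrow> bool" where
  "newton_run D x0 x \<longleftrightarrow> x 0 = x0 \<and>
     (\<forall>i. x i \<in> W_dom D \<and>
          (if newton_W D (x i) = 0 then x (Suc i) = x i
           else (\<exists>!s. s \<in> W_dirs D \<and> newton_W' D (x i) s = - newton_W D (x i)) \<and>
                (\<exists>s\<in>W_dirs D. newton_W' D (x i) s = - newton_W D (x i) \<and> x (Suc i) = x i + s)))"

definition q_superlinear :: "(nat \<Rightarrow> 'a::real_normed_vector) \<Rightarrow> 'a \<Rightarrow> bool" where
  "q_superlinear x l \<longleftrightarrow> x \<longlonglongrightarrow> l \<and>
     (\<forall>\<epsilon>>0. \<forall>\<^sub>F i in sequentially. norm (x (Suc i) - l) \<le> \<epsilon> * norm (x i - l))"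

end

theory Submission
  imports Defs
begin

text \<open>A Newton step solves \<open>W'(x) s = - W(x)\<close>, so it replaces the error \<open>x - x*\<close> by \<open>W'(x)\<close>-inverse
  applied to the remainder \<open>W(x) - W(x*) - W'(x)(x - x*)\<close> (up to sign).  Hence q-superlinear convergence near
  the KKT point \<open>x*\<close> follows, by \<open>local_superlinear_newton\<close>, from three facts: \<open>x*\<close> is a zero of
  \<open>W\<close>; the remainder is \<open>o(\<bar>\<bar>x - x*\<bar>\<bar>)\<close>; and \<open>W'(x)\<close> is invertible near \<open>x*\<close> with uniformly
  bounded inverse.

  \<^bold>\<open>Zero.\<close>  The KKT conditions are rewritten component by component (\<open>KKT_imp_root\<close>).  The gradient
  equation in \<open>u\<close> together with the normal cone condition says that \<open>u\<close> is the projection onto \<open>U_ad\<close> of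
  the unprojected control, and this projection acts pointwise.

  \<^bold>\<open>Remainder.\<close>  The derivatives of \<open>h\<close> are polynomials in the \<open>1/\<beta>_i\<close> and in affine functions of \<open>y\<close>, and the max is
  piecewise linear, so a sum and product calculus for derivatives taken at the moving point suffices
  (\<open>newton_diff_bilinear\<close>, \<open>newton_diff_max\<close>).  Only the pointwise projection is delicate.  Its remainder at \<open>p\<close>
  is at most \<open>|w - w*|\<close> and lives on the set \<open>E\<close> where \<open>w*\<close> differs from a bound by at most
  \<open>|w - w*|\<close> without touching it; the measure of \<open>E\<close> tends to 0.  Testing \<open>B\<close> with \<open>\<chi>_E B*p\<close> and using that \<open>B\<close>
  is bounded already on \<open>L^q\<close>, \<open>q < 2\<close>, gives
  \<open>\<bar>\<bar>\<chi>_E B*p\<bar>\<bar> \<le> \<kappa> \<bar>\<bar>p\<bar>\<bar> |E|^(1/q - 1/2)\<close> (\<open>norm_gap\<close>), which is the smallness needed in \<open>newton_diff_clip\<close>.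

  \<^bold>\<open>Uniform invertibility.\<close>  Since \<open>(b, y) \<mapsto> |y|^2 / b\<close> is jointly convex, \<open>h''\<close> is positive semidefinite,
  and the term \<open>\<beta>_i^(-2)\<close> makes it coercive in \<open>\<beta>\<close>.  Testing the first row of the Newton system with \<open>d\<beta>\<close> and
  the second with \<open>dy\<close> therefore controls \<open>d\<beta>\<close> and \<open>\<chi> B* dp\<close>, hence everything else
  (\<open>newton_op_bound\<close>); the direction \<open>dy\<close> is a bounded image of \<open>du\<close>.
  Solvability comes from minimising the same energy over the variables left free by the active sets
  (\<open>newton_op_surj\<close>).  The multiplier \<open>dz\<close> is controlled because some constraint \<open>j\<close> of the simplex is
  inactive at \<open>\<beta>*\<close>, so that \<open>j\<close> stays out of \<open>\<A>_1\<close> near \<open>x*\<close>, while the \<open>n\<close> rows of \<open>K_T\<close> other than \<open>j\<close>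
  are linearly independent (\<open>simplex_constraint_rows\<close>).

  The functional analysis behind this is completeness of \<open>L^2\<close>, the representation of functionals by coercive forms, and
  boundedness of the inverses of \<open>A\<close> and \<open>A*\<close>, for which the uniform boundedness principle in
  Hilbert space is enough (\<open>stability\<close>).\<close>

section \<open>Coercive forms and duality in Hilbert spaces\<close>

lemma bounded_linear_onD:
  assumes "bounded_linear_on S f"
  shows bounded_linear_on_add: "x \<in> S \<Longrightarrow> y \<in> S \<Longrightarrow> f (x + y) = f x + f y"
    and bounded_linear_on_scaleR: "x \<in> S \<Longrightarrow> f (c *\<^sub>R x) = c *\<^sub>R f x"
  using assms by (auto simp: bounded_linear_on_def)

lemma bounded_linear_on_bound:
  assumes "bounded_linear_on S f"
  obtains K where "0 < K" "\<And>x. x \<in> S \<Longrightarrow> norm (f x) \<le> K * norm x"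
proof -
  obtain K where K: "\<And>x. x \<in> S \<Longrightarrow> norm (f x) \<le> K * norm x"
    using assms unfolding bounded_linear_on_def by blast
  have "norm (f x) \<le> (\<bar>K\<bar> + 1) * norm x" if "x \<in> S" for x
    using K[OF that] by (rule order_trans) (simp add: mult_right_mono)
  then show ?thesis using that[of "\<bar>K\<bar> + 1"] by auto
qed

lemma bounded_linear_on_0:
  assumes "bounded_linear_on S f" "subspace S"
  shows "f 0 = 0"
  using bounded_linear_on_scaleR[OF assms(1) subspace_0[OF assms(2)], of 0] by simp

lemma bounded_linear_on_diff:
  assumes "bounded_linear_on S f" "subspace S" "x \<in> S" "y \<in> S"
  shows "f (x - y) = f x - f y"
proof -
  have "f (x + (-1) *\<^sub>R y) = f x + (-1) *\<^sub>R f y"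
    using assms by (simp only: bounded_linear_onD subspace_scale)
  then show ?thesis by simp
qed

lemma bounded_linear_imp_bounded_linear_on: "bounded_linear f \<Longrightarrow> bounded_linear_on S f"
  unfolding bounded_linear_on_def
  by (metis bounded_linear.bounded linear_simps(1,5) mult.commute)

lemma linear_term_eq_0_of_quadratic_nonneg:
  fixes d e :: real
  assumes "\<And>t. 0 \<le> t * d + t\<^sup>2 / 2 * e" "0 \<le> e"
  shows "d = 0"
proof -
  define t X where "t = - d / (e + 1)" and "X = d\<^sup>2 / (e + 1)"
  have "t\<^sup>2 / 2 * e \<le> t\<^sup>2 / 2 * (e + 1)" by (rule mult_left_mono) auto
  also have "\<dots> = X / 2"
    using assms(2) by (simp add: t_def X_def power_divide power2_eq_square)
  finally have "t\<^sup>2 / 2 * e \<le> X / 2" .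
  moreover have "t * d = - X" by (simp add: t_def X_def power2_eq_square)
  ultimately have "X \<le> 0" using assms(1)[of t] by linarith
  then have "d\<^sup>2 \<le> 0" using assms(2) by (simp add: X_def divide_le_0_iff)
  then show "d = 0" by simp
qed

text \<open>The Lax--Milgram theorem for symmetric forms: \<open>u\<close> minimises \<open>a(v, v) / 2 - l(v)\<close>.  With the inner
  product as \<open>a\<close> it gives Riesz representation and orthogonal projection, with \<open>a(p, q) = \<langle>A* p, A* q\<rangle>\<close> the
  surjectivity of an adjoint, and with the energy of a Newton system the solvability of that system.  The
  subspace \<open>S\<close> is a parameter because the unknowns range over subspaces that change with the iterate.\<close>

lemma coercive_form_represents:
  fixes a :: "'a::banach \<Rightarrow> 'a \<Rightarrow> real"
  assumes S: "subspace S" "closed S"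
    and sym: "\<And>u v. u \<in> S \<Longrightarrow> v \<in> S \<Longrightarrow> a u v = a v u"
    and lin: "\<And>u. u \<in> S \<Longrightarrow> bounded_linear_on S (a u)"
    and c: "0 < c" and coer: "\<And>u. u \<in> S \<Longrightarrow> c * (norm u)\<^sup>2 \<le> a u u"
    and l: "bounded_linear_on S l"
  shows "\<exists>u\<in>S. \<forall>v\<in>S. a u v = l v"
proof -
  define J where "J = (\<lambda>v. a v v / 2 - l v)"
  obtain K where K: "0 < K" "\<And>x. x \<in> S \<Longrightarrow> norm (l x) \<le> K * norm x"
    using bounded_linear_on_bound[OF l] by blast
  have addr: "a u (v + w) = a u v + a u w" if "u \<in> S" "v \<in> S" "w \<in> S" for u v w
    using bounded_linear_on_add[OF lin] that by blast
  have scr: "a u (t *\<^sub>R v) = t * a u v" if "u \<in> S" "v \<in> S" for u v t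
    using bounded_linear_on_scaleR[OF lin] that by fastforce
  have addl: "a (v + w) u = a v u + a w u" if "u \<in> S" "v \<in> S" "w \<in> S" for u v w
    using addr[OF that] sym that S(1) by (simp add: subspace_add)
  have scl: "a (t *\<^sub>R v) u = t * a v u" if "u \<in> S" "v \<in> S" for u v t
    using scr[OF that] sym that S(1) by (simp add: subspace_scale)
  have Jt: "J (u + t *\<^sub>R v) = J u + t * (a u v - l v) + t\<^sup>2 / 2 * a v v" if "u \<in> S" "v \<in> S" for u v t
    using that S(1) sym[of u v]
    by (simp add: J_def addl addr scl scr subspace_add subspace_scale bounded_linear_onD[OF l]
        field_simps power2_eq_square)
  have Jge: "- (K\<^sup>2 / (2 * c)) \<le> J v" if v: "v \<in> S" for v
  proof -
    have "0 \<le> (c * norm v - K)\<^sup>2 / (2 * c)" using c by simp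
    also have "\<dots> = c * (norm v)\<^sup>2 / 2 - K * norm v + K\<^sup>2 / (2 * c)"
      using c by (simp add: field_simps power2_eq_square)
    finally show ?thesis using coer[OF v] K(2)[OF v] by (simp add: J_def abs_le_iff)
  qed
  define m where "m = (INF v\<in>S. J v)"
  have ne: "S \<noteq> {}" using subspace_0[OF S(1)] by auto
  have bdd: "bdd_below (J ` S)" using Jge by (auto intro!: bdd_belowI2)
  have m_le: "m \<le> J v" if "v \<in> S" for v
    unfolding m_def by (rule cINF_lower[OF bdd that])
  have "\<exists>v\<in>S. J v < m + inverse (real (Suc n))" for n
    using cINF_less_iff[OF ne bdd, of "m + inverse (real (Suc n))"] by (simp add: m_def)
  then obtain v where v: "\<And>n. v n \<in> S" "\<And>n. J (v n) < m + inverse (real (Suc n))"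
    by metis
  \<comment> \<open>The parallelogram identity turns nearly minimal values into nearness of the points.\<close>
  have close: "c * (norm (v n - v k))\<^sup>2 \<le> 4 * (inverse (real (Suc n)) + inverse (real (Suc k)))" for n k
  proof -
    let ?w = "(1/2) *\<^sub>R (v n + v k)"
    have mem: "?w \<in> S" "v n - v k \<in> S" using v(1) S(1) by (auto intro: subspace_scale subspace_add subspace_diff)
    have "a (v n - v k) (v n - v k) = 4 * J (v n) + 4 * J (v k) - 8 * J ?w"
    proof -
      have "a (v n + (-1) *\<^sub>R v k) (v n + (-1) *\<^sub>R v k) = a (v n) (v n) + a (v k) (v k) - 2 * a (v n) (v k)"
        using v(1) S(1) sym[of "v n" "v k"] by (simp only: addl addr scl scr subspace_add subspace_scale) simp
      moreover have "J ?w = (a (v n) (v n) + a (v k) (v k) + 2 * a (v n) (v k)) / 8 - (l (v n) + l (v k)) / 2"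
        using v(1) S(1) sym[of "v n" "v k"]
        by (simp add: J_def addl addr scl scr subspace_add subspace_scale bounded_linear_onD[OF l] field_simps)
      ultimately show ?thesis by (simp add: J_def field_simps)
    qed
    with coer[OF mem(2)] m_le[OF mem(1)] v(2)[of n] v(2)[of k] show ?thesis by argo
  qed
  have "Cauchy v"
  proof (rule metric_CauchyI)
    fix e :: real assume e: "0 < e"
    then obtain N where N: "inverse (real (Suc N)) < c * e\<^sup>2 / 8"
      using c reals_Archimedean[of "c * e\<^sup>2 / 8"] by auto
    have "dist (v n) (v k) < e" if "N \<le> n" "N \<le> k" for n k
    proof -
      have "inverse (real (Suc n)) \<le> inverse (real (Suc N))" "inverse (real (Suc k)) \<le> inverse (real (Suc N))"
        using that by (auto simp: field_simps)
      with close[of n k] N have "c * (norm (v n - v k))\<^sup>2 < c * e\<^sup>2" by argo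
      then have "norm (v n - v k) < e" using c e by (simp add: power2_less_imp_less)
      then show ?thesis by (simp add: dist_norm)
    qed
    then show "\<exists>M. \<forall>m\<ge>M. \<forall>n\<ge>M. dist (v m) (v n) < e" by blast
  qed
  then obtain u where u: "v \<longlonglongrightarrow> u" by (auto simp: Cauchy_convergent_iff convergent_def)
  have uS: "u \<in> S" using closed_sequentially[OF S(2)] v(1) u by blast
  have "a u w = l w" if w: "w \<in> S" for w
  proof -
    obtain Kw where Kw: "0 < Kw" "\<And>x. x \<in> S \<Longrightarrow> norm (a w x) \<le> Kw * norm x"
      using bounded_linear_on_bound[OF lin[OF w]] by blast
    have lim: "(\<lambda>n. a (v n) w) \<longlonglongrightarrow> a u w"
    proof -
      have "a (v n) w - a u w = a w (v n - u)" for n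
        using bounded_linear_on_diff[OF lin[OF w] S(1) v(1)[of n] uS] sym v(1) uS w by simp
      then have le: "\<forall>n. norm (a (v n) w - a u w) \<le> Kw * norm (v n - u)"
        using Kw(2) v(1) uS S(1) by (metis subspace_diff)
      have lim0: "(\<lambda>n. Kw * norm (v n - u)) \<longlonglongrightarrow> 0"
        using u by (simp add: tendsto_mult_right_zero LIM_zero tendsto_norm_zero)
      have "(\<lambda>n. a (v n) w - a u w) \<longlonglongrightarrow> 0"
        using le lim0 by (metis (no_types, lifting) Lim_null_comparison always_eventually)
      then show ?thesis by (rule LIM_zero_cancel)
    qed
    have "0 \<le> t * (a u w - l w) + t\<^sup>2 / 2 * a w w" for t
    proof (rule LIMSEQ_le_const)
      show "(\<lambda>n. t * (a (v n) w - l w) + t\<^sup>2 / 2 * a w w + inverse (real (Suc n)))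
          \<longlonglongrightarrow> t * (a u w - l w) + t\<^sup>2 / 2 * a w w"
        by (rule tendsto_eq_intros lim LIMSEQ_inverse_real_of_nat refl | simp)+
      have "0 \<le> t * (a (v n) w - l w) + t\<^sup>2 / 2 * a w w + inverse (real (Suc n))" for n
      proof -
        have "v n + t *\<^sub>R w \<in> S" using v(1) w S(1) by (simp add: subspace_add subspace_scale)
        from m_le[OF this] v(2)[of n] show ?thesis by (simp add: Jt[OF v(1) w])
      qed
      then show "\<exists>N. \<forall>n\<ge>N. 0 \<le> t * (a (v n) w - l w) + t\<^sup>2 / 2 * a w w + inverse (real (Suc n))"
        by blast
    qed
    moreover have "0 \<le> a w w" using coer[OF w] c by (smt (verit) mult_nonneg_nonneg zero_le_power2)
    ultimately have "a u w - l w = 0" by (rule linear_term_eq_0_of_quadratic_nonneg)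
    then show ?thesis by simp
  qed
  with uS show ?thesis by blast
qed

lemma riesz_representation:
  fixes l :: "'a::{real_inner,banach} \<Rightarrow> real"
  assumes "subspace S" "closed S" "bounded_linear_on S l"
  shows "\<exists>u\<in>S. \<forall>v\<in>S. inner u v = l v"
  by (rule coercive_form_represents[of S inner 1])
    (use assms in \<open>auto simp: inner_commute power2_norm_eq_inner
       intro!: bounded_linear_imp_bounded_linear_on bounded_linear_inner_right\<close>)

lemma inner_eq_imp_eq_on:
  fixes u u' :: "'a::real_inner"
  assumes "subspace S" "u \<in> S" "u' \<in> S" "\<And>v. v \<in> S \<Longrightarrow> inner u v = inner u' v"
  shows "u = u'"
proof -
  have "inner (u - u') (u - u') = 0"
    using assms(4)[of "u - u'"] assms by (simp add: subspace_diff inner_diff_left)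
  then show ?thesis by simp
qed

definition proj :: "'a::{real_inner,banach} set \<Rightarrow> 'a \<Rightarrow> 'a" where
  "proj S x = (SOME p. p \<in> S \<and> (\<forall>v\<in>S. inner p v = inner x v))"

context
  fixes S :: "'a::{real_inner,banach} set"
  assumes S: "subspace S" "closed S"
begin

lemma proj_props: "proj S x \<in> S \<and> (\<forall>v\<in>S. inner (proj S x) v = inner x v)"
  unfolding proj_def
  by (rule someI_ex)
    (use riesz_representation[OF S, of "inner x"]
      in \<open>auto intro: bounded_linear_imp_bounded_linear_on bounded_linear_inner_right\<close>)

lemma proj_in: "proj S x \<in> S" and inner_proj: "v \<in> S \<Longrightarrow> inner (proj S x) v = inner x v"
  using proj_props by auto

lemma proj_ident: "x \<in> S \<Longrightarrow> proj S x = x"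
  by (rule inner_eq_imp_eq_on[OF S(1)]) (auto simp: proj_in inner_proj)

lemma norm_proj_le: "norm (proj S x) \<le> norm x"
proof -
  have "norm (proj S x) * norm (proj S x) = inner x (proj S x)"
    by (metis inner_proj power2_eq_square power2_norm_eq_inner proj_in)
  also have "\<dots> \<le> norm x * norm (proj S x)" by (rule norm_cauchy_schwarz)
  finally show ?thesis by (cases "norm (proj S x) = 0") auto
qed

lemma bounded_linear_proj: "bounded_linear (proj S)"
proof (rule bounded_linear_intro)
  show "proj S (x + y) = proj S x + proj S y" for x y
    by (rule inner_eq_imp_eq_on[OF S(1)])
      (auto simp: proj_in inner_proj inner_add_left intro: subspace_add[OF S(1)])
  show "proj S (r *\<^sub>R x) = r *\<^sub>R proj S x" for r x
    by (rule inner_eq_imp_eq_on[OF S(1)])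
      (auto simp: proj_in inner_proj intro: subspace_scale[OF S(1)])
  show "norm (proj S x) \<le> norm x * 1" for x using norm_proj_le[of x] by simp
qed

lemma bounded_linear_on_comp_proj:
  assumes "bounded_linear_on S f"
  shows "bounded_linear (\<lambda>x. f (proj S x))"
proof -
  obtain K where K: "0 < K" "\<And>x. x \<in> S \<Longrightarrow> norm (f x) \<le> K * norm x"
    using bounded_linear_on_bound[OF assms] by blast
  show ?thesis
  proof (rule bounded_linear_intro)
    show "f (proj S (x + y)) = f (proj S x) + f (proj S y)" for x y
      by (simp add: linear_simps(1)[OF bounded_linear_proj] bounded_linear_onD[OF assms] proj_in)
    show "f (proj S (r *\<^sub>R x)) = r *\<^sub>R f (proj S x)" for r x
      by (simp add: linear_simps(5)[OF bounded_linear_proj] bounded_linear_onD[OF assms] proj_in)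
    show "norm (f (proj S x)) \<le> norm x * K" for x
      using K(2)[OF proj_in, of x] norm_proj_le[of x] K(1)
      by (smt (verit) mult.commute mult_left_mono)
  qed
qed

lemma dual_of_iff: "g \<in> dual_of S \<longleftrightarrow> (\<forall>x. blinfun_apply g x = blinfun_apply g (proj S x))"
proof
  assume g: "g \<in> dual_of S"
  show "\<forall>x. blinfun_apply g x = blinfun_apply g (proj S x)"
  proof
    fix x
    have "x - proj S x \<in> orthogonal_comp S"
      by (auto simp: orthogonal_comp_def orthogonal_def inner_diff_right)
         (metis inner_commute inner_proj)
    then have "blinfun_apply g (x - proj S x) = 0" using g by (simp add: dual_of_def)
    then show "blinfun_apply g x = blinfun_apply g (proj S x)" by (simp add: blinfun.diff_right)
  qed
next
  assume *: "\<forall>x. blinfun_apply g x = blinfun_apply g (proj S x)"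
  have "blinfun_apply g v = 0" if "v \<in> orthogonal_comp S" for v
  proof -
    have "inner v w = 0" if "w \<in> S" for w
      using \<open>v \<in> orthogonal_comp S\<close> that
      by (auto simp: orthogonal_comp_def orthogonal_def inner_commute)
    then have "proj S v = 0"
      by (intro inner_eq_imp_eq_on[OF S(1)]) (auto simp: proj_in inner_proj subspace_0[OF S(1)])
    with * show ?thesis by (metis blinfun.zero_right)
  qed
  then show "g \<in> dual_of S" by (simp add: dual_of_def)
qed

lemma dual_of_eqI:
  assumes "g \<in> dual_of S" "g' \<in> dual_of S" "\<And>v. v \<in> S \<Longrightarrow> blinfun_apply g v = blinfun_apply g' v"
  shows "g = g'"
  using assms by (intro blinfun_eqI) (metis dual_of_iff proj_in)

lemma subspace_dual_of: "subspace (dual_of S)"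
  by (auto simp: subspace_def dual_of_def blinfun.add_left blinfun.scaleR_left)

lemma dual_of_norm_le:
  assumes g: "g \<in> dual_of S" and "0 \<le> k" and k: "\<And>v. v \<in> S \<Longrightarrow> \<bar>blinfun_apply g v\<bar> \<le> k * norm v"
  shows "norm g \<le> k"
proof (rule norm_blinfun_bound[OF \<open>0 \<le> k\<close>])
  fix x
  have "norm (blinfun_apply g x) = \<bar>blinfun_apply g (proj S x)\<bar>" using g dual_of_iff by auto
  also have "\<dots> \<le> k * norm (proj S x)" using k proj_in by blast
  also have "\<dots> \<le> k * norm x" using norm_proj_le \<open>0 \<le> k\<close> by (simp add: mult_left_mono)
  finally show "norm (blinfun_apply g x) \<le> k * norm x" .
qed

definition extend_functional :: "('a \<Rightarrow> real) \<Rightarrow> ('a \<Rightarrow>\<^sub>L real)" where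
  "extend_functional f = Blinfun (\<lambda>x. f (proj S x))"

lemma extend_functional:
  assumes "bounded_linear_on S f"
  shows extend_functional_in: "extend_functional f \<in> dual_of S"
    and extend_functional_apply: "v \<in> S \<Longrightarrow> blinfun_apply (extend_functional f) v = f v"
  using bounded_linear_on_comp_proj[OF assms]
  by (auto simp: dual_of_iff extend_functional_def bounded_linear_Blinfun_apply proj_ident proj_in)

end

text \<open>The uniform boundedness principle for functionals represented by vectors: the closed sets of all \<open>v\<close> at which
  the family is bounded by \<open>n\<close> cover the space, so by Baire's theorem one of them contains a ball.\<close>

lemma weakly_bounded_imp_bounded:
  fixes F :: "'a::{real_inner,banach} set"
  assumes "\<And>v. \<exists>K. \<forall>p\<in>F. \<bar>inner p v\<bar> \<le> K"
  shows "\<exists>K. \<forall>p\<in>F. norm p \<le> K"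
proof -
  define T where "T = (\<lambda>n::nat. {v. \<forall>p\<in>F. \<bar>inner p v\<bar> \<le> real n})"
  have clo: "closed (T n)" for n
  proof -
    have "T n = (\<Inter>p\<in>F. {v. \<bar>inner p v\<bar> \<le> real n})" by (auto simp: T_def)
    moreover have "closed {v. \<bar>inner p v\<bar> \<le> real n}" for p
      by (intro closed_Collect_le continuous_intros)
    ultimately show ?thesis by auto
  qed
  have un: "\<Union> (range T) = UNIV"
  proof -
    have "\<exists>n. v \<in> T n" for v
    proof -
      obtain K where K: "\<forall>p\<in>F. \<bar>inner p v\<bar> \<le> K" using assms by blast
      obtain n where "K \<le> real n" using real_arch_simple by blast
      with K show ?thesis unfolding T_def by (auto intro: order_trans)
    qed
    then show ?thesis by auto
  qed
  \<comment> \<open>Baire: countably many closed sets without interior points cannot cover the space.\<close>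
  have "\<exists>n. interior (T n) \<noteq> {}"
  proof (rule ccontr)
    assume "\<not> ?thesis"
    then have "euclidean interior_of \<Union> (range T) = {}"
      using Met_TC.metric_Baire_category_alt[where 'a='a, of "range T"] clo complete_UNIV[where 'a='a]
      by auto
    with un show False by simp
  qed
  then obtain n v0 where "v0 \<in> interior (T n)" by blast
  then obtain r where r: "0 < r" "cball v0 r \<subseteq> T n" by (auto simp: mem_interior_cball)
  have "norm p \<le> 2 * real n / r" if p: "p \<in> F" for p
  proof (cases "p = 0")
    case False
    have "v0 + (r / norm p) *\<^sub>R p \<in> T n" "v0 \<in> T n" using r False by (auto simp: dist_norm intro!: set_mp[OF r(2)])
    then have "\<bar>inner p (v0 + (r / norm p) *\<^sub>R p)\<bar> \<le> real n" "\<bar>inner p v0\<bar> \<le> real n"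
      using p by (auto simp: T_def)
    moreover have "inner p (v0 + (r / norm p) *\<^sub>R p) = inner p v0 + r * norm p"
      using False by (simp add: inner_add_right power2_norm_eq_inner[symmetric] power2_eq_square)
    ultimately have "r * norm p \<le> 2 * real n" by linarith
    then show ?thesis using r(1) by (simp add: field_simps)
  qed (use r in auto)
  then show ?thesis by blast
qed

text \<open>The Riesz representer of \<open>l\<close>, regarded as a functional on \<open>S\<close>.\<close>

definition representer :: "'a::{real_inner,banach} set \<Rightarrow> ('a \<Rightarrow> real) \<Rightarrow> 'a" where
  "representer S l = (SOME u. u \<in> S \<and> (\<forall>v\<in>S. inner u v = l v))"

lemma representer:
  assumes "subspace S" "closed S" "bounded_linear_on S l"
  shows representer_in: "representer S l \<in> S"
    and inner_representer: "v \<in> S \<Longrightarrow> inner (representer S l) v = l v"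
proof -
  have "representer S l \<in> S \<and> (\<forall>v\<in>S. inner (representer S l) v = l v)"
    unfolding representer_def by (rule someI_ex) (use riesz_representation[OF assms] in blast)
  then show "representer S l \<in> S" "v \<in> S \<Longrightarrow> inner (representer S l) v = l v" by auto
qed

lemma norm_le_of_inner_self:
  fixes x :: "'a::real_inner"
  assumes "inner x x \<le> k * norm x" "0 \<le> k"
  shows "norm x \<le> k"
proof (cases "x = 0")
  case False
  have "norm x * norm x \<le> k * norm x"
    using assms(1) by (simp add: power2_norm_eq_inner[symmetric] power2_eq_square)
  then show ?thesis using False by simp
qed (use assms in simp)

lemma bounded_linear_on_apply:
  fixes T :: "'u::real_normed_vector \<Rightarrow> 'y::real_normed_vector \<Rightarrow>\<^sub>L real"
  assumes "bounded_linear_on S T"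
  shows "bounded_linear_on S (\<lambda>v. blinfun_apply (T v) p)"
proof -
  obtain K where K: "0 < K" "\<And>x. x \<in> S \<Longrightarrow> norm (T x) \<le> K * norm x"
    using bounded_linear_on_bound[OF assms] by blast
  have "norm (blinfun_apply (T v) p) \<le> (K * norm p) * norm v" if "v \<in> S" for v
  proof -
    have "norm (blinfun_apply (T v) p) \<le> norm (T v) * norm p" by (rule norm_blinfun)
    also have "\<dots> \<le> (K * norm v) * norm p" using K(2)[OF that] by (rule mult_right_mono) simp
    finally show ?thesis by (simp add: ac_simps)
  qed
  then show ?thesis
    by (auto simp: bounded_linear_on_def bounded_linear_onD[OF assms] blinfun.add_left blinfun.scaleR_left)
qed

text \<open>An operator \<open>T\<close> with values in a dual space is a bilinear pairing; representing \<open>v \<mapsto> T v p\<close> in \<open>S\<close>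
  gives the Hilbert space adjoint, linear and bounded in \<open>p\<close>.\<close>

lemma bounded_linear_adjoint:
  fixes T :: "'u::{real_inner,banach} \<Rightarrow> 'y::real_normed_vector \<Rightarrow>\<^sub>L real"
  assumes S: "subspace S" "closed S" and T: "bounded_linear_on S T"
  shows "bounded_linear (\<lambda>p. representer S (\<lambda>v. blinfun_apply (T v) p))"
proof -
  obtain K where K: "0 < K" "\<And>x. x \<in> S \<Longrightarrow> norm (T x) \<le> K * norm x"
    using bounded_linear_on_bound[OF T] by blast
  let ?r = "\<lambda>p. representer S (\<lambda>v. blinfun_apply (T v) p)"
  note r = representer_in[OF S bounded_linear_on_apply[OF T]]
  note ir = inner_representer[OF S bounded_linear_on_apply[OF T]]
  show ?thesis
  proof (rule bounded_linear_intro)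
    show "?r (p + q) = ?r p + ?r q" for p q
    proof (rule inner_eq_imp_eq_on[OF S(1) r subspace_add[OF S(1) r r]])
      show "inner (?r (p + q)) v = inner (?r p + ?r q) v" if "v \<in> S" for v
        unfolding inner_add_left ir[OF that] by (rule blinfun.add_right)
    qed
    show "?r (c *\<^sub>R p) = c *\<^sub>R ?r p" for c p
    proof (rule inner_eq_imp_eq_on[OF S(1) r subspace_scale[OF S(1) r]])
      show "inner (?r (c *\<^sub>R p)) v = inner (c *\<^sub>R ?r p) v" if "v \<in> S" for v
        unfolding inner_scaleR_left ir[OF that] by (simp add: blinfun.scaleR_right)
    qed
    show "norm (?r p) \<le> norm p * K" for p
    proof (rule norm_le_of_inner_self)
      have "inner (?r p) (?r p) \<le> norm (T (?r p)) * norm p"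
        using norm_blinfun[of "T (?r p)" p] by (simp add: ir r)
      also have "\<dots> \<le> (K * norm (?r p)) * norm p" using K(2)[OF r] by (rule mult_right_mono) simp
      finally show "inner (?r p) (?r p) \<le> (norm p * K) * norm (?r p)" by (simp add: ac_simps)
    qed (use K in simp)
  qed
qed

lemma bounded_linear_on_compose:
  assumes g: "bounded_linear g" and gS: "g ` S \<subseteq> T" and f: "bounded_linear_on T f"
  shows "bounded_linear_on S (\<lambda>x. f (g x))"
proof -
  obtain K where K: "0 < K" "\<And>x. x \<in> T \<Longrightarrow> norm (f x) \<le> K * norm x" using bounded_linear_on_bound[OF f] by blast
  obtain L where L: "0 < L" "\<And>x. norm (g x) \<le> norm x * L" using bounded_linear.pos_bounded[OF g] by blast
  have "norm (f (g x)) \<le> (K * L) * norm x" if "x \<in> S" for x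
  proof -
    have "norm (f (g x)) \<le> K * norm (g x)" using K(2) gS that by blast
    also have "\<dots> \<le> K * (norm x * L)" using L(2)[of x] K(1) by (simp add: mult_left_mono)
    finally show ?thesis by (simp add: ac_simps)
  qed
  moreover have "f (g (x + y)) = f (g x) + f (g y)" if "x \<in> S" "y \<in> S" for x y
    using that gS by (simp add: linear_add[OF bounded_linear.linear[OF g]] bounded_linear_on_add[OF f] image_subset_iff)
  moreover have "f (g (c *\<^sub>R x)) = c *\<^sub>R f (g x)" if "x \<in> S" for c x
    using that gS by (simp add: linear_scale[OF bounded_linear.linear[OF g]] bounded_linear_on_scaleR[OF f] image_subset_iff)
  ultimately show ?thesis unfolding bounded_linear_on_def by blast
qed

section \<open>Completeness of \<open>L\<^sup>2\<close> and multiplication by indicators\<close>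

lemma square_integrable_L2_fun: "square_integrable (L2_fun u)"
  using Quotient_rep_reflp[OF Quotient_L2, of u] by (simp add: L2_eq_def)

lemma L2_of_L2_fun: "L2_of (L2_fun u) = u"
  by (rule Quotient_abs_rep[OF Quotient_L2])

lemma AE_L2_fun_L2_of: "square_integrable f \<Longrightarrow> AE x in lebesgue. L2_fun (L2_of f) x = f x"
  using Quotient_rep_abs[OF Quotient_L2, of f] by (simp add: L2_eq_def)

lemma L2_of_eqI:
  assumes "square_integrable f" "square_integrable g" "AE x in lebesgue. f x = g x"
  shows "L2_of f = L2_of g"
  using Quotient_rel_abs[OF Quotient_L2, of f g] assms by (simp add: L2_eq_def)

lemma L2_eqI: "AE x in lebesgue. L2_fun u x = L2_fun v x \<Longrightarrow> u = v"
  by (metis L2_of_L2_fun L2_of_eqI square_integrable_L2_fun)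

lemma L2_fun_measurable [measurable]: "L2_fun u \<in> borel_measurable lebesgue"
  using square_integrable_L2_fun[of u] by (simp add: square_integrable_def)

lemma L2_of_add: "square_integrable f \<Longrightarrow> square_integrable g \<Longrightarrow> L2_of f + L2_of g = L2_of (\<lambda>x. f x + g x)"
  by (rule plus_L2.abs_eq) (auto simp: L2_eq_def)

lemma L2_of_scaleR: "square_integrable f \<Longrightarrow> c *\<^sub>R L2_of f = L2_of (\<lambda>x. c * f x)"
  by (rule scaleR_L2.abs_eq) (auto simp: L2_eq_def)

lemma AE_L2_fun_0: "AE x in lebesgue. L2_fun 0 x = 0"
  unfolding zero_L2_def by (rule AE_L2_fun_L2_of) (rule square_integrable_zero)

lemma AE_L2_fun_add: "AE x in lebesgue. L2_fun (u + v) x = L2_fun u x + L2_fun v x"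
proof -
  have eq: "u + v = L2_of (\<lambda>x. L2_fun u x + L2_fun v x)"
    using L2_of_add[OF square_integrable_L2_fun[of u] square_integrable_L2_fun[of v]]
    by (simp add: L2_of_L2_fun)
  show ?thesis
    unfolding eq by (intro AE_L2_fun_L2_of square_integrable_add square_integrable_L2_fun)
qed

lemma AE_L2_fun_scaleR: "AE x in lebesgue. L2_fun (c *\<^sub>R u) x = c * L2_fun u x"
proof -
  have eq: "c *\<^sub>R u = L2_of (\<lambda>x. c * L2_fun u x)"
    using L2_of_scaleR[OF square_integrable_L2_fun[of u], of c] by (simp add: L2_of_L2_fun)
  show ?thesis
    unfolding eq by (intro AE_L2_fun_L2_of square_integrable_scale square_integrable_L2_fun)
qed

lemma AE_L2_fun_diff: "AE x in lebesgue. L2_fun (u - v) x = L2_fun u x - L2_fun v x"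
proof -
  have eq: "u - v = u + (-1) *\<^sub>R v" by simp
  show ?thesis
    unfolding eq using AE_L2_fun_add[of u "(-1) *\<^sub>R v"] AE_L2_fun_scaleR[of "-1" v] by eventually_elim auto
qed

lemma square_integrable_diff: "square_integrable f \<Longrightarrow> square_integrable g \<Longrightarrow> square_integrable (\<lambda>x. f x - g x)"
  using square_integrable_add[of f "\<lambda>x. -1 * g x"] square_integrable_scale[of g "-1"] by simp

lemma square_integrable_bound:
  assumes g: "square_integrable g" and f [measurable]: "f \<in> borel_measurable lebesgue"
    and le: "AE x in lebesgue. \<bar>f x\<bar> \<le> \<bar>g x\<bar>"
  shows "square_integrable f"
proof -
  have "integrable lebesgue (\<lambda>x. (f x)\<^sup>2)"
  proof (rule Bochner_Integration.integrable_bound)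
    show "integrable lebesgue (\<lambda>x. (g x)\<^sup>2)" using g by (simp add: square_integrable_def)
    show "AE x in lebesgue. norm ((f x)\<^sup>2) \<le> norm ((g x)\<^sup>2)"
      using le by eventually_elim (simp add: abs_le_square_iff)
  qed measurable
  then show ?thesis using f by (simp add: square_integrable_def)
qed

lemma inner_L2: "inner u v = (LINT x|lebesgue. L2_fun u x * L2_fun v x)"
  by (simp add: inner_L2.rep_eq)

lemma norm_L2_sq: "(norm u)\<^sup>2 = (LINT x|lebesgue. (L2_fun u x)\<^sup>2)"
  unfolding power2_norm_eq_inner inner_L2 by (simp add: power2_eq_square)

lemma norm_L2_mono:
  assumes "AE x in lebesgue. \<bar>L2_fun u x\<bar> \<le> \<bar>L2_fun v x\<bar>"
  shows "norm u \<le> norm v"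
proof (rule power2_le_imp_le)
  show "(norm u)\<^sup>2 \<le> (norm v)\<^sup>2" unfolding norm_L2_sq
  proof (rule integral_mono_AE)
    show "AE x in lebesgue. (L2_fun u x)\<^sup>2 \<le> (L2_fun v x)\<^sup>2"
      using assms by eventually_elim (simp add: abs_le_square_iff)
  qed (use square_integrable_L2_fun in \<open>auto simp: square_integrable_def\<close>)
qed simp

text \<open>By Fatou's lemma a bound on \<open>\<integral> (f m - f n)^2\<close> for all \<open>m \<ge> n\<close> passes to the pointwise limit in \<open>m\<close>.\<close>

lemma square_integrable_limit:
  fixes f :: "nat \<Rightarrow> real^'l::finite \<Rightarrow> real"
  assumes f: "\<And>n. square_integrable (f n)" and e: "\<And>n. 0 \<le> e n"
    and close: "\<And>n m. n \<le> m \<Longrightarrow> (LINT x|lebesgue. (f m x - f n x)\<^sup>2) \<le> e n"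
    and lim: "AE x in lebesgue. (\<lambda>n. f n x) \<longlonglongrightarrow> g x"
    and [measurable]: "g \<in> borel_measurable lebesgue"
  shows "square_integrable g" and "(LINT x|lebesgue. (g x - f n x)\<^sup>2) \<le> e n"
proof -
  have [measurable]: "f n \<in> borel_measurable lebesgue" for n using f by (simp add: square_integrable_def)
  have int: "integrable lebesgue (\<lambda>x. (f m x - f n x)\<^sup>2)" for m n
    using square_integrable_diff[OF f f, of m n] by (simp add: square_integrable_def)
  have *: "(\<integral>\<^sup>+x. ennreal ((g x - f n x)\<^sup>2) \<partial>lebesgue) \<le> ennreal (e n)" for n
  proof -
    have "(\<integral>\<^sup>+x. ennreal ((g x - f n x)\<^sup>2) \<partial>lebesgue)
        = (\<integral>\<^sup>+x. liminf (\<lambda>m. ennreal ((f m x - f n x)\<^sup>2)) \<partial>lebesgue)"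
    proof (rule nn_integral_cong_AE)
      show "AE x in lebesgue. ennreal ((g x - f n x)\<^sup>2) = liminf (\<lambda>m. ennreal ((f m x - f n x)\<^sup>2))"
        using lim
      proof eventually_elim
        case (elim x)
        have "(\<lambda>m. ennreal ((f m x - f n x)\<^sup>2)) \<longlonglongrightarrow> ennreal ((g x - f n x)\<^sup>2)"
          using elim by (intro tendsto_ennrealI tendsto_intros)
        then show ?case by (rule lim_imp_Liminf[OF trivial_limit_sequentially, symmetric])
      qed
    qed
    also have "\<dots> \<le> liminf (\<lambda>m. \<integral>\<^sup>+x. ennreal ((f m x - f n x)\<^sup>2) \<partial>lebesgue)"
      by (rule nn_integral_liminf) measurable
    also have "\<dots> \<le> limsup (\<lambda>m. \<integral>\<^sup>+x. ennreal ((f m x - f n x)\<^sup>2) \<partial>lebesgue)"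
      by (rule Liminf_le_Limsup) simp
    also have "\<dots> \<le> ennreal (e n)"
    proof (rule Limsup_bounded)
      have "(\<integral>\<^sup>+x. ennreal ((f m x - f n x)\<^sup>2) \<partial>lebesgue) \<le> ennreal (e n)" if "n \<le> m" for m
        using close[OF that] int e by (subst nn_integral_eq_integral) (auto intro: ennreal_leI)
      then show "\<forall>\<^sub>F m in sequentially. (\<integral>\<^sup>+x. ennreal ((f m x - f n x)\<^sup>2) \<partial>lebesgue) \<le> ennreal (e n)"
        unfolding eventually_sequentially by blast
    qed
    finally show ?thesis .
  qed
  have sq: "integrable lebesgue (\<lambda>x. (g x - f n x)\<^sup>2)" for n
    using order.strict_trans1[OF *[of n] ennreal_less_top] by (intro integrableI_nonneg) auto
  have "square_integrable (\<lambda>x. (g x - f 0 x) + f 0 x)"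
    by (rule square_integrable_add) (use sq f in \<open>auto simp: square_integrable_def\<close>)
  then show "square_integrable g" by simp
  have "ennreal (LINT x|lebesgue. (g x - f n x)\<^sup>2) \<le> ennreal (e n)"
    using *[of n] by (subst nn_integral_eq_integral[symmetric]) (auto simp: sq)
  then show "(LINT x|lebesgue. (g x - f n x)\<^sup>2) \<le> e n" using e by (simp add: ennreal_le_iff)
qed

text \<open>The weights \<open>2^n\<close> replace Minkowski's inequality: \<open>\<Sum>n. 2^n d_n^2\<close> has a finite integral, hence is finite
  almost everywhere, and \<open>|d_n| \<le> 2^n d_n^2 + 2^(-n)\<close> then makes the increments \<open>d_n\<close> absolutely summable.\<close>

lemma AE_convergent_of_fast_Cauchy:
  fixes f :: "nat \<Rightarrow> real^'l::finite \<Rightarrow> real"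
  assumes f: "\<And>n. square_integrable (f n)"
    and fast: "\<And>n. (LINT x|lebesgue. (f (Suc n) x - f n x)\<^sup>2) \<le> (1/8)^n"
  shows "AE x in lebesgue. convergent (\<lambda>n. f n x)"
proof -
  have [measurable]: "f n \<in> borel_measurable lebesgue" for n using f by (simp add: square_integrable_def)
  have int: "integrable lebesgue (\<lambda>x. (f m x - f n x)\<^sup>2)" for m n
    using square_integrable_diff[OF f f, of m n] by (simp add: square_integrable_def)
  have "(\<integral>\<^sup>+x. (\<Sum>n. ennreal (2^n * (f (Suc n) x - f n x)\<^sup>2)) \<partial>lebesgue)
      = (\<Sum>n. \<integral>\<^sup>+x. ennreal (2^n * (f (Suc n) x - f n x)\<^sup>2) \<partial>lebesgue)"
    by (rule nn_integral_suminf) measurable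
  also have "\<dots> \<le> (\<Sum>n. ennreal ((1/4)^n))"
  proof (intro suminf_le summableI)
    fix n
    have "(\<integral>\<^sup>+x. ennreal (2^n * (f (Suc n) x - f n x)\<^sup>2) \<partial>lebesgue)
        = ennreal (2^n * (LINT x|lebesgue. (f (Suc n) x - f n x)\<^sup>2))"
      using int by (subst nn_integral_eq_integral) auto
    also have "\<dots> \<le> ennreal (2^n * (1/8)^n)" by (intro ennreal_leI mult_left_mono fast) auto
    also have "2^n * (1/8)^n = ((1/4)^n :: real)" by (simp flip: power_mult_distrib)
    finally show "(\<integral>\<^sup>+x. ennreal (2^n * (f (Suc n) x - f n x)\<^sup>2) \<partial>lebesgue) \<le> ennreal ((1/4)^n)" .
  qed
  also have "\<dots> < \<infinity>" by (subst suminf_ennreal2) (auto intro: summable_geometric)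
  finally have "AE x in lebesgue. (\<Sum>n. ennreal (2^n * (f (Suc n) x - f n x)\<^sup>2)) \<noteq> \<infinity>"
    by (intro nn_integral_noteq_infinite) auto
  then show ?thesis
  proof eventually_elim
    case (elim x)
    let ?d = "\<lambda>n. f (Suc n) x - f n x"
    have s: "summable (\<lambda>n. 2^n * (?d n)\<^sup>2)" using elim by (intro summable_suminf_not_top) auto
    have "norm (?d n) \<le> 2^n * (?d n)\<^sup>2 + (1/2)^n" for n
    proof -
      have "0 \<le> (2^n * \<bar>?d n\<bar> - 1)\<^sup>2" by simp
      then have "2 * (2^n * \<bar>?d n\<bar>) \<le> 2^n * (2^n * (?d n)\<^sup>2) + 1"
        by (simp add: power2_eq_square algebra_simps abs_mult_self_eq)
      also have "\<dots> = 2^n * (2^n * (?d n)\<^sup>2 + (1/2)^n)" by (simp add: power_divide algebra_simps)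
      finally have "2^n * (2 * \<bar>?d n\<bar>) \<le> 2^n * (2^n * (?d n)\<^sup>2 + (1/2)^n)" by (simp add: algebra_simps)
      then have "2 * \<bar>?d n\<bar> \<le> 2^n * (?d n)\<^sup>2 + (1/2)^n" by (simp only: mult_le_cancel_left_pos zero_less_power zero_less_numeral)
      moreover have "norm (?d n) \<le> 2 * \<bar>?d n\<bar>" by simp
      ultimately show ?thesis by (rule order_trans[rotated])
    qed
    moreover have "summable (\<lambda>n. 2^n * (?d n)\<^sup>2 + (1/2)^n)"
      by (intro summable_add s summable_geometric) simp
    ultimately have "summable ?d" by (rule summable_comparison_test'[where N=0, rotated])
    then have "convergent (\<lambda>n. \<Sum>i<n. ?d i)" by (simp add: summable_iff_convergent)
    then have "convergent (\<lambda>n. f n x - f 0 x)" unfolding sum_lessThan_telescope[of "\<lambda>n. f n x"] .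
    then show ?case using convergent_add[OF _ convergent_const, of "\<lambda>n. f n x - f 0 x" "f 0 x"] by simp
  qed
qed

text \<open>Riesz--Fischer: pass to a rapidly convergent subsequence, take its pointwise limit, and return to the
  Cauchy sequence.\<close>

instance L2 :: (finite) banach
proof
  fix X :: "nat \<Rightarrow> 'a L2"
  assume X: "Cauchy X"
  have "\<exists>N. \<forall>m\<ge>N. \<forall>k\<ge>N. dist (X m) (X k) < (1/8)^n" for n
    using metric_CauchyD[OF X, of "(1/8)^n"] by auto
  then obtain N where N: "\<And>n m k. N n \<le> m \<Longrightarrow> N n \<le> k \<Longrightarrow> dist (X m) (X k) < (1/8)^n" by metis
  define M where "M n = (\<Sum>i\<le>n. N i)" for n
  have M: "N n \<le> M m" if "n \<le> m" for n m
    unfolding M_def by (rule member_le_sum) (use that in auto)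
  define f where "f n = L2_fun (X (M n))" for n
  have f: "square_integrable (f n)" for n by (simp add: f_def square_integrable_L2_fun)
  have [measurable]: "f n \<in> borel_measurable lebesgue" for n by (simp add: f_def)
  have close: "(LINT x|lebesgue. (f m x - f n x)\<^sup>2) \<le> (1/8)^n" if "n \<le> m" for n m
  proof -
    have eq: "(LINT x|lebesgue. (f m x - f n x)\<^sup>2) = (norm (X (M m) - X (M n)))\<^sup>2"
      unfolding norm_L2_sq
    proof (rule integral_cong_AE)
      show "AE x in lebesgue. (f m x - f n x)\<^sup>2 = (L2_fun (X (M m) - X (M n)) x)\<^sup>2"
        using AE_L2_fun_diff[of "X (M m)" "X (M n)"] by eventually_elim (simp add: f_def)
    qed measurable
    have "norm (X (M m) - X (M n)) \<le> (1/8)^n"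
      using N[of n "M m" "M n"] M[OF that] M[of n n] by (simp add: dist_norm)
    then have "(norm (X (M m) - X (M n)))\<^sup>2 \<le> ((1/8)^n)\<^sup>2" by (intro power_mono) auto
    also have "\<dots> \<le> (1/8)^n" by (simp add: power2_eq_square mult_left_le power_le_one)
    finally show ?thesis by (simp only: eq)
  qed
  define g where "g x = lim (\<lambda>n. f n x)" for x
  have [measurable]: "g \<in> borel_measurable lebesgue" unfolding g_def by measurable
  have lim: "AE x in lebesgue. (\<lambda>n. f n x) \<longlonglongrightarrow> g x"
    using AE_convergent_of_fast_Cauchy[of f, OF f close[OF le_SucI[OF order_refl]]]
    by eventually_elim (simp add: g_def convergent_LIMSEQ_iff)
  note g = square_integrable_limit[of f "\<lambda>n. (1/8)^n" g, OF f _ close lim, simplified]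
  have dist: "(norm (L2_of g - X (M n)))\<^sup>2 \<le> (1/8)^n" for n
  proof -
    have "(norm (L2_of g - X (M n)))\<^sup>2 = (LINT x|lebesgue. (g x - f n x)\<^sup>2)"
      unfolding norm_L2_sq
    proof (rule integral_cong_AE)
      show "AE x in lebesgue. (L2_fun (L2_of g - X (M n)) x)\<^sup>2 = (g x - f n x)\<^sup>2"
        using AE_L2_fun_diff[of "L2_of g" "X (M n)"] AE_L2_fun_L2_of[OF g(1)]
        by eventually_elim (simp add: f_def)
    qed measurable
    then show ?thesis using g(2)[of n] by simp
  qed
  have "X \<longlonglongrightarrow> L2_of g"
  proof (rule metric_LIMSEQ_I)
    fix e :: real assume e: "0 < e"
    obtain n where n: "(1/8)^n < min (e/2) ((e/2)\<^sup>2)"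
      using real_arch_pow_inv[of "min (e/2) ((e/2)\<^sup>2)" "1/8"] e by auto
    have "norm (L2_of g - X (M n)) < e / 2"
      by (rule power2_less_imp_less) (use dist[of n] n e in auto)
    moreover have "dist (X m) (X (M n)) < e / 2" if "N n \<le> m" for m
      using N[OF that M[OF order_refl]] n by simp
    ultimately have "dist (X m) (L2_of g) < e" if "N n \<le> m" for m
      using that dist_triangle_half_r[of "X (M n)" "X m" e "L2_of g"]
      by (metis dist_commute dist_norm dist_triangle_half_r)
    then show "\<exists>no. \<forall>n\<ge>no. dist (X n) (L2_of g) < e" by blast
  qed
  then show "convergent X" by (auto simp: convergent_def)
qed

lemma square_integrable_indicator_mult:
  assumes [measurable]: "S \<in> sets lebesgue" and f: "square_integrable f"
  shows "square_integrable (\<lambda>x. indicator S x * f x)"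
proof (rule square_integrable_bound[OF f])
  have [measurable]: "f \<in> borel_measurable lebesgue" using f by (simp add: square_integrable_def)
  show "(\<lambda>x. indicator S x * f x) \<in> borel_measurable lebesgue" by measurable
  show "AE x in lebesgue. \<bar>indicator S x * f x\<bar> \<le> \<bar>f x\<bar>"
    by (rule AE_I2) (simp add: indicator_def)
qed

context
  fixes S :: "(real^'l::finite) set"
  assumes S [measurable]: "S \<in> sets lebesgue"
begin

lemma AE_L2_fun_mult_ind: "AE x in lebesgue. L2_fun (mult_ind S w) x = indicator S x * L2_fun w x"
  unfolding mult_ind_def
  by (intro AE_L2_fun_L2_of square_integrable_indicator_mult S square_integrable_L2_fun)

lemma norm_mult_ind_le: "norm (mult_ind S w) \<le> norm w"
  by (rule norm_L2_mono, rule eventually_mono[OF AE_L2_fun_mult_ind[of w]])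
    (auto simp: indicator_def)

lemma mult_ind_add: "mult_ind S (v + w) = mult_ind S v + mult_ind S w"
proof (rule L2_eqI)
  show "AE x in lebesgue. L2_fun (mult_ind S (v + w)) x = L2_fun (mult_ind S v + mult_ind S w) x"
    using AE_L2_fun_mult_ind[of "v + w"] AE_L2_fun_mult_ind[of v] AE_L2_fun_mult_ind[of w]
      AE_L2_fun_add[of v w] AE_L2_fun_add[of "mult_ind S v" "mult_ind S w"]
    by eventually_elim (simp add: algebra_simps)
qed

lemma mult_ind_scaleR: "mult_ind S (c *\<^sub>R w) = c *\<^sub>R mult_ind S w"
proof (rule L2_eqI)
  show "AE x in lebesgue. L2_fun (mult_ind S (c *\<^sub>R w)) x = L2_fun (c *\<^sub>R mult_ind S w) x"
    using AE_L2_fun_mult_ind[of "c *\<^sub>R w"] AE_L2_fun_mult_ind[of w]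
      AE_L2_fun_scaleR[of c w] AE_L2_fun_scaleR[of c "mult_ind S w"]
    by eventually_elim simp
qed

lemma bounded_linear_mult_ind: "bounded_linear (mult_ind S)"
  by (rule bounded_linear_intro[where K=1]) (auto simp: mult_ind_add mult_ind_scaleR norm_mult_ind_le)

lemma mult_ind_idem: "mult_ind S (mult_ind S w) = mult_ind S w"
proof (rule L2_eqI)
  show "AE x in lebesgue. L2_fun (mult_ind S (mult_ind S w)) x = L2_fun (mult_ind S w) x"
    using AE_L2_fun_mult_ind[of "mult_ind S w"] AE_L2_fun_mult_ind[of w]
    by eventually_elim (simp add: indicator_def)
qed

lemma inner_mult_ind: "inner (mult_ind S v) w = inner v (mult_ind S w)"
  unfolding inner_L2
proof (rule integral_cong_AE)
  show "AE x in lebesgue. L2_fun (mult_ind S v) x * L2_fun w x = L2_fun v x * L2_fun (mult_ind S w) x"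
    using AE_L2_fun_mult_ind[of v] AE_L2_fun_mult_ind[of w] by eventually_elim simp
qed measurable

end

context
  fixes \<Omega> :: "(real^'l::finite) set"
  assumes \<Omega> [measurable]: "\<Omega> \<in> sets lebesgue"
begin

lemma L2_on_iff_mult_ind: "w \<in> L2_on \<Omega> \<longleftrightarrow> mult_ind \<Omega> w = w"
proof
  assume "w \<in> L2_on \<Omega>"
  then have *: "AE x in lebesgue. x \<notin> \<Omega> \<longrightarrow> L2_fun w x = 0" by (simp add: L2_on_def)
  show "mult_ind \<Omega> w = w"
  proof (rule L2_eqI)
    show "AE x in lebesgue. L2_fun (mult_ind \<Omega> w) x = L2_fun w x"
      using AE_L2_fun_mult_ind[OF \<Omega>, of w] * by eventually_elim (auto simp: indicator_def)
  qed
next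
  assume *: "mult_ind \<Omega> w = w"
  then have "AE x in lebesgue. L2_fun w x = indicator \<Omega> x * L2_fun w x"
    using AE_L2_fun_mult_ind[OF \<Omega>, of w] by simp
  then show "w \<in> L2_on \<Omega>" unfolding L2_on_def mem_Collect_eq by eventually_elim (auto simp: indicator_def)
qed

lemma subspace_L2_on: "subspace (L2_on \<Omega>)"
  using linear_0[OF bounded_linear.linear[OF bounded_linear_mult_ind[OF \<Omega>]]]
  by (simp add: subspace_def L2_on_iff_mult_ind mult_ind_add[OF \<Omega>] mult_ind_scaleR[OF \<Omega>])

lemma closed_L2_on: "closed (L2_on \<Omega>)"
proof -
  have "L2_on \<Omega> = {w. mult_ind \<Omega> w = w}" by (rule set_eqI) (simp add: L2_on_iff_mult_ind)
  also have "closed \<dots>"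
    by (intro closed_Collect_eq continuous_on_id linear_continuous_on bounded_linear_mult_ind \<Omega>)
  finally show ?thesis .
qed

end

lemma mult_ind_commute:
  assumes "S \<in> sets lebesgue" "T \<in> sets lebesgue"
  shows "mult_ind S (mult_ind T w) = mult_ind T (mult_ind S w)"
proof (rule L2_eqI)
  show "AE x in lebesgue. L2_fun (mult_ind S (mult_ind T w)) x = L2_fun (mult_ind T (mult_ind S w)) x"
    using AE_L2_fun_mult_ind[OF assms(1), of "mult_ind T w"] AE_L2_fun_mult_ind[OF assms(2), of w]
      AE_L2_fun_mult_ind[OF assms(2), of "mult_ind S w"] AE_L2_fun_mult_ind[OF assms(1), of w]
    by eventually_elim simp
qed

section \<open>\<open>H\<^sub>0\<^sup>1\<close> is a closed subspace\<close>

lemma subspace_closure: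
  fixes S :: "'a::real_normed_vector set"
  assumes S: "subspace S"
  shows "subspace (closure S)"
  unfolding subspace_def
proof (intro conjI ballI allI)
  show "0 \<in> closure S" using subspace_0[OF S] closure_subset by blast
next
  fix x y assume "x \<in> closure S" "y \<in> closure S"
  then obtain f g where fg: "\<And>n. f n \<in> S" "f \<longlonglongrightarrow> x" "\<And>n. g n \<in> S" "g \<longlonglongrightarrow> y"
    unfolding closure_sequential by metis
  then have "(\<lambda>n. f n + g n) \<longlonglongrightarrow> x + y" "\<forall>n. f n + g n \<in> S"
    using S by (auto intro: tendsto_add subspace_add)
  then show "x + y \<in> closure S" unfolding closure_sequential by (intro exI[of _ "\<lambda>n. f n + g n"]) simp
next
  fix c x assume "x \<in> closure S"
  then obtain f where f: "\<And>n. f n \<in> S" "f \<longlonglongrightarrow> x"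
    unfolding closure_sequential by metis
  then have "(\<lambda>n. c *\<^sub>R f n) \<longlonglongrightarrow> c *\<^sub>R x" "\<forall>n. c *\<^sub>R f n \<in> S"
    using S by (auto intro: tendsto_scaleR subspace_scale)
  then show "c *\<^sub>R x \<in> closure S" unfolding closure_sequential by (intro exI[of _ "\<lambda>n. c *\<^sub>R f n"]) simp
qed

lemma partial_derivative_linear_combination:
  assumes "f differentiable_on UNIV" "g differentiable_on UNIV"
  shows "partial_derivative i (\<lambda>x. a * f x + b * g x) = (\<lambda>x. a * partial_derivative i f x + b * partial_derivative i g x)"
proof
  fix x
  have "(f has_derivative frechet_derivative f (at x)) (at x)" "(g has_derivative frechet_derivative g (at x)) (at x)"
    using assms by (auto simp: differentiable_on_def frechet_derivative_works[symmetric])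
  then have "((\<lambda>x. a * f x + b * g x) has_derivative
      (\<lambda>h. a * frechet_derivative f (at x) h + b * frechet_derivative g (at x) h)) (at x)"
    by (auto intro!: derivative_eq_intros)
  then have "frechet_derivative (\<lambda>x. a * f x + b * g x) (at x)
      = (\<lambda>h. a * frechet_derivative f (at x) h + b * frechet_derivative g (at x) h)"
    by (rule frechet_derivative_at[symmetric])
  then show "partial_derivative i (\<lambda>x. a * f x + b * g x) x = a * partial_derivative i f x + b * partial_derivative i g x"
    by (simp add: partial_derivative_def)
qed

lemma iterated_partial_derivative_linear_combination:
  assumes "smooth f" "smooth g"
  shows "foldr partial_derivative js (\<lambda>x. a * f x + b * g x)
    = (\<lambda>x. a * foldr partial_derivative js f x + b * foldr partial_derivative js g x)"
proof (induction js)
  case (Cons i js)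
  then show ?case
    using assms by (simp add: smooth_def partial_derivative_linear_combination)
qed simp

lemma smooth_linear_combination:
  assumes "smooth f" "smooth g"
  shows "smooth (\<lambda>x. a * f x + b * g x)"
  unfolding smooth_def iterated_partial_derivative_linear_combination[OF assms]
proof
  fix js
  have "foldr partial_derivative js f differentiable_on UNIV" "foldr partial_derivative js g differentiable_on UNIV"
    using assms unfolding smooth_def by blast+
  then show "(\<lambda>x. a * foldr partial_derivative js f x + b * foldr partial_derivative js g x) differentiable_on UNIV"
    by (intro differentiable_on_add differentiable_on_mult differentiable_on_const)
qed

lemma smooth_0: "smooth (\<lambda>x :: real^'a::finite. 0)"
proof -
  have "foldr partial_derivative js (\<lambda>x. 0) = (\<lambda>x. 0)" for js :: "'a list"
  proof (induction js)
    case (Cons i js)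
    have "frechet_derivative (\<lambda>x. 0::real) (at x) = (\<lambda>h. 0)" for x :: "real^'a"
      by (rule frechet_derivative_at[symmetric]) (rule has_derivative_const)
    with Cons show ?case by (simp add: partial_derivative_def)
  qed simp
  then show ?thesis by (simp add: smooth_def)
qed

lemma smooth_partial_derivative: "smooth f \<Longrightarrow> smooth (partial_derivative i f)"
  unfolding smooth_def
proof
  fix js assume *: "\<forall>js. foldr partial_derivative js f differentiable_on UNIV"
  show "foldr partial_derivative js (partial_derivative i f) differentiable_on UNIV"
    using *[rule_format, of "js @ [i]"] by simp
qed

lemma compact_closure_subset: "compact K \<Longrightarrow> closure S \<subseteq> K \<Longrightarrow> compact (closure S)"
  using compact_Int_closed[of K "closure S"] by (simp add: Int_absorb1)

lemma test_functions_linear_combination: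
  assumes f: "f \<in> test_functions \<Omega>" and g: "g \<in> test_functions \<Omega>"
  shows "(\<lambda>x. a * f x + b * g x) \<in> test_functions \<Omega>"
proof -
  have "closure {x. a * f x + b * g x \<noteq> 0} \<subseteq> closure ({x. f x \<noteq> 0} \<union> {x. g x \<noteq> 0})"
    by (rule closure_mono) auto
  also have "\<dots> = closure {x. f x \<noteq> 0} \<union> closure {x. g x \<noteq> 0}" by (rule closure_Un)
  finally have sub: "closure {x. a * f x + b * g x \<noteq> 0} \<subseteq> closure {x. f x \<noteq> 0} \<union> closure {x. g x \<noteq> 0}" .
  moreover have "compact (closure {x. f x \<noteq> 0} \<union> closure {x. g x \<noteq> 0})"
    using f g by (intro compact_Un) (auto simp: test_functions_def)
  ultimately have "compact (closure {x. a * f x + b * g x \<noteq> 0})"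
    using compact_closure_subset by blast
  with sub show ?thesis using f g by (auto simp: test_functions_def intro: smooth_linear_combination)
qed

lemma test_functions_0: "(\<lambda>x. 0) \<in> test_functions \<Omega>"
  by (simp add: test_functions_def smooth_0)

text \<open>Outside the closed support of \<open>f\<close> the function vanishes on an open set, so differentiation does not enlarge
  the support.  This makes the weak gradient in \<open>H01\<close> square integrable.\<close>

lemma test_functions_partial_derivative:
  assumes f: "f \<in> test_functions \<Omega>"
  shows "partial_derivative i f \<in> test_functions \<Omega>"
proof -
  have "partial_derivative i f x = 0" if x: "x \<notin> closure {x. f x \<noteq> 0}" for x
  proof -
    have "(f has_derivative (\<lambda>h. 0)) (at x)"
    proof (rule has_derivative_transform_within_open)
      show "((\<lambda>x. 0) has_derivative (\<lambda>h. 0)) (at x)" by (rule has_derivative_const)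
      show "open (- closure {x. f x \<noteq> 0})" by (rule open_Compl[OF closed_closure])
      show "x \<in> - closure {x. f x \<noteq> 0}" using x by simp
      show "0 = f y" if "y \<in> - closure {x. f x \<noteq> 0}" for y
        using that closure_subset[of "{x. f x \<noteq> 0}"] by auto
    qed
    then have "frechet_derivative f (at x) = (\<lambda>h. 0)" by (rule frechet_derivative_at[symmetric])
    then show ?thesis by (simp add: partial_derivative_def)
  qed
  then have "{x. partial_derivative i f x \<noteq> 0} \<subseteq> closure {x. f x \<noteq> 0}" by blast
  then have sub: "closure {x. partial_derivative i f x \<noteq> 0} \<subseteq> closure {x. f x \<noteq> 0}"
    by (rule closure_minimal) simp
  moreover have "compact (closure {x. f x \<noteq> 0})" using f by (simp add: test_functions_def)
  ultimately have "compact (closure {x. partial_derivative i f x \<noteq> 0})"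
    using compact_closure_subset by blast
  with sub f show ?thesis by (auto simp: test_functions_def intro: smooth_partial_derivative)
qed

lemma square_integrable_test_function:
  assumes f: "f \<in> test_functions \<Omega>"
  shows "square_integrable f"
proof -
  define C where "C = closure {x. f x \<noteq> 0}"
  have C: "compact C" using f by (simp add: test_functions_def C_def)
  have "foldr partial_derivative [] f differentiable_on UNIV"
    using f unfolding test_functions_def smooth_def by blast
  then have cont: "continuous_on UNIV f" by (simp add: differentiable_imp_continuous_on)
  have "compact (f ` C)" using cont C by (auto intro: compact_continuous_image continuous_on_subset)
  then obtain M where M: "\<forall>x\<in>C. \<bar>f x\<bar> \<le> M"
    by (auto dest!: compact_imp_bounded simp: bounded_iff)
  have Cl: "C \<in> lmeasurable" using C by (rule lmeasurable_compact)
  have [measurable]: "C \<in> sets lebesgue" using Cl by (rule fmeasurableD)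
  show ?thesis
  proof (rule square_integrable_bound)
    have "(\<lambda>x. (M * indicator C x)\<^sup>2 :: real) = (\<lambda>x. M\<^sup>2 * indicator C x)"
      by (rule ext) (simp add: indicator_def)
    moreover have "integrable lebesgue (indicator C :: _ \<Rightarrow> real)"
      using Cl by (simp add: fmeasurable_def)
    ultimately show "square_integrable (\<lambda>x. M * indicator C x)"
      unfolding square_integrable_def by simp
    have "f \<in> borel_measurable borel" using cont by (rule borel_measurable_continuous_onI)
    then show "f \<in> borel_measurable lebesgue" by (simp add: measurable_completion)
    have "\<bar>f x\<bar> \<le> \<bar>M * indicator C x\<bar>" for x
    proof (cases "x \<in> C")
      case True
      then show ?thesis using M True by fastforce
    next
      case False
      then have "f x = 0" using closure_subset[of "{x. f x \<noteq> 0}"] by (auto simp: C_def)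
      then show ?thesis by simp
    qed
    then show "AE x in lebesgue. \<bar>f x\<bar> \<le> \<bar>M * indicator C x\<bar>" by simp
  qed
qed

text \<open>Test functions and their partial derivatives are square integrable, so passing to the classes of a function and of its
  gradient is linear on them; the closure of the image of a linear map is a subspace.\<close>

lemma subspace_H01: "subspace (H01 \<Omega>)" and closed_H01: "closed (H01 \<Omega>)"
proof -
  define \<Phi> :: "(real^'a \<Rightarrow> real) \<Rightarrow> 'a H1"
    where "\<Phi> f = (L2_of f, \<chi> i. L2_of (partial_derivative i f))" for f
  have comb: "a *\<^sub>R \<Phi> f + b *\<^sub>R \<Phi> g = \<Phi> (\<lambda>x. a * f x + b * g x)"
    if f: "f \<in> test_functions \<Omega>" and g: "g \<in> test_functions \<Omega>" for a b f g
  proof -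
    have "f differentiable_on UNIV" "g differentiable_on UNIV"
      using f g unfolding test_functions_def smooth_def by (metis (mono_tags, lifting) foldr.simps(1) id_apply mem_Collect_eq)+
    then have pd: "partial_derivative i (\<lambda>x. a * f x + b * g x) = (\<lambda>x. a * partial_derivative i f x + b * partial_derivative i g x)" for i
      by (rule partial_derivative_linear_combination)
    have L2: "a *\<^sub>R L2_of f + b *\<^sub>R L2_of g = L2_of (\<lambda>x. a * f x + b * g x)"
      if "f \<in> test_functions \<Omega>" "g \<in> test_functions \<Omega>" for f g
      using that by (simp add: L2_of_scaleR L2_of_add square_integrable_scale square_integrable_test_function)
    show ?thesis
      unfolding \<Phi>_def pd using f g
      by (simp add: L2 vec_eq_iff test_functions_partial_derivative)
  qed
  have "subspace (\<Phi> ` test_functions \<Omega>)"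
    unfolding subspace_def
  proof (intro conjI ballI allI)
    have "0 *\<^sub>R \<Phi> (\<lambda>x. 0) + 0 *\<^sub>R \<Phi> (\<lambda>x. 0) \<in> \<Phi> ` test_functions \<Omega>"
      unfolding comb[OF test_functions_0 test_functions_0]
      by (intro imageI test_functions_linear_combination test_functions_0)
    then show "0 \<in> \<Phi> ` test_functions \<Omega>" by simp
  next
    fix x y assume "x \<in> \<Phi> ` test_functions \<Omega>" "y \<in> \<Phi> ` test_functions \<Omega>"
    then obtain f g where fg: "f \<in> test_functions \<Omega>" "g \<in> test_functions \<Omega>" "x = \<Phi> f" "y = \<Phi> g" by auto
    have "1 *\<^sub>R \<Phi> f + 1 *\<^sub>R \<Phi> g \<in> \<Phi> ` test_functions \<Omega>"
      unfolding comb[OF fg(1,2)] by (intro imageI test_functions_linear_combination fg)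
    then show "x + y \<in> \<Phi> ` test_functions \<Omega>" by (simp add: fg)
  next
    fix c x assume "x \<in> \<Phi> ` test_functions \<Omega>"
    then obtain f where f: "f \<in> test_functions \<Omega>" "x = \<Phi> f" by auto
    have "c *\<^sub>R \<Phi> f + 0 *\<^sub>R \<Phi> f \<in> \<Phi> ` test_functions \<Omega>"
      unfolding comb[OF f(1) f(1)] by (intro imageI test_functions_linear_combination f)
    then show "c *\<^sub>R x \<in> \<Phi> ` test_functions \<Omega>" by (simp add: f)
  qed
  then show "subspace (H01 \<Omega>)" unfolding H01_def \<Phi>_def by (rule subspace_closure)
  show "closed (H01 \<Omega>)" by (simp add: H01_def)
qed

section \<open>The state equation and its adjoint\<close>

text \<open>States live in \<open>H\<close>, controls in \<open>U\<close>.  The operators take values in functionals on the whole space that are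
  determined by their values on \<open>H\<close> (see \<open>dual_of_eqI\<close>), and are meaningful only on \<open>H\<close> and \<open>U\<close>.\<close>

locale state_equation =
  fixes H :: "'y::{real_inner,banach} set" and U :: "'u::{real_inner,banach} set"
    and A :: "'y \<Rightarrow> ('y \<Rightarrow>\<^sub>L real)" and B :: "'u \<Rightarrow> ('y \<Rightarrow>\<^sub>L real)"
  assumes H: "subspace H" "closed H" and U: "subspace U" "closed U"
    and A: "bounded_linear_on H A" and bij_A: "bij_betw A H (dual_of H)"
    and B: "bounded_linear_on U B" and B_dual: "B ` U \<subseteq> dual_of H"
begin

definition A' :: "'y \<Rightarrow> ('y \<Rightarrow>\<^sub>L real)" where
  "A' p = extend_functional H (\<lambda>v. blinfun_apply (A v) p)"

definition B' :: "'y \<Rightarrow> 'u" where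
  "B' p = representer U (\<lambda>v. blinfun_apply (B v) p)"

lemma A_in: "y \<in> H \<Longrightarrow> A y \<in> dual_of H"
  using bij_A by (auto simp: bij_betw_def)

lemma B_in: "u \<in> U \<Longrightarrow> B u \<in> dual_of H"
  using B_dual by auto

lemma A'_in: "A' p \<in> dual_of H"
  and A'_apply: "v \<in> H \<Longrightarrow> blinfun_apply (A' p) v = blinfun_apply (A v) p"
  unfolding A'_def using extend_functional[OF H bounded_linear_on_apply[OF A]] by auto

lemma bounded_linear_A': "bounded_linear A'"
proof -
  obtain K where K: "0 < K" "\<And>x. x \<in> H \<Longrightarrow> norm (A x) \<le> K * norm x"
    using bounded_linear_on_bound[OF A] by blast
  note sub = subspace_dual_of[OF H]
  show ?thesis
  proof (rule bounded_linear_intro)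
    show "A' (p + q) = A' p + A' q" for p q
      by (rule dual_of_eqI[OF H])
        (auto simp: A'_in A'_apply blinfun.add_left blinfun.add_right intro!: subspace_add[OF sub])
    show "A' (c *\<^sub>R p) = c *\<^sub>R A' p" for c p
      by (rule dual_of_eqI[OF H])
        (auto simp: A'_in A'_apply blinfun.scaleR_left blinfun.scaleR_right intro!: subspace_scale[OF sub])
    show "norm (A' p) \<le> norm p * K" for p
    proof (rule dual_of_norm_le[OF H A'_in])
      fix v assume v: "v \<in> H"
      have "\<bar>blinfun_apply (A' p) v\<bar> \<le> norm (A v) * norm p"
        using norm_blinfun[of "A v" p] v by (simp add: A'_apply)
      also have "\<dots> \<le> (K * norm v) * norm p" using K(2)[OF v] by (rule mult_right_mono) simp
      finally show "\<bar>blinfun_apply (A' p) v\<bar> \<le> (norm p * K) * norm v" by (simp add: ac_simps)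
    qed (use K in simp)
  qed
qed

lemma B'_in: "B' p \<in> U"
  and inner_B': "v \<in> U \<Longrightarrow> inner (B' p) v = blinfun_apply (B v) p"
  unfolding B'_def using representer[OF U bounded_linear_on_apply[OF B]] by auto

lemma bounded_linear_B': "bounded_linear B'"
  unfolding B'_def by (rule bounded_linear_adjoint[OF U B])

text \<open>Every functional on \<open>H\<close> is \<open>A w\<close> for some \<open>w\<close>, and \<open>(A w) p = (A' p) w\<close> is at most \<open>norm w\<close> if
  \<open>norm (A' p) \<le> 1\<close>.  So the set of these \<open>p\<close> is weakly bounded, hence bounded.\<close>

lemma A'_bounded_below: "\<exists>c>0. \<forall>p\<in>H. norm p \<le> c * norm (A' p)"
proof -
  define F where "F = {p \<in> H. norm (A' p) \<le> 1}"
  have "\<exists>K. \<forall>p\<in>F. \<bar>inner p v\<bar> \<le> K" for v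
  proof -
    have lin: "bounded_linear_on H (inner v)"
      by (intro bounded_linear_imp_bounded_linear_on bounded_linear_inner_right)
    obtain w where w: "w \<in> H" "A w = extend_functional H (inner v)"
      using bij_A extend_functional_in[OF H lin] unfolding bij_betw_def by (metis imageE)
    have "\<bar>inner p v\<bar> \<le> norm w" if "p \<in> F" for p
    proof -
      have p: "p \<in> H" "norm (A' p) \<le> 1" using that by (auto simp: F_def)
      have "\<bar>inner p v\<bar> = \<bar>blinfun_apply (A' p) w\<bar>"
        using w p extend_functional_apply[OF H lin p(1)] by (simp add: A'_apply inner_commute)
      also have "\<dots> \<le> norm (A' p) * norm w" using norm_blinfun[of "A' p" w] by simp
      also have "\<dots> \<le> 1 * norm w" using p(2) by (rule mult_right_mono) simp
      finally show ?thesis by simp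
    qed
    then show ?thesis by blast
  qed
  then obtain K where K: "\<forall>p\<in>F. norm p \<le> K" using weakly_bounded_imp_bounded by blast
  have "norm p \<le> (\<bar>K\<bar> + 1) * norm (A' p)" if p: "p \<in> H" for p
  proof (rule field_le_epsilon)
    fix e :: real assume e: "0 < e"
    \<comment> \<open>The summand with \<open>e\<close> keeps \<open>t\<close> finite when \<open>A' p = 0\<close>.\<close>
    define t where "t = 1 / (norm (A' p) + e / (\<bar>K\<bar> + 1))"
    have pos: "0 < norm (A' p) + e / (\<bar>K\<bar> + 1)" using e by (simp add: add_nonneg_pos)
    then have t: "0 < t" by (simp add: t_def)
    have "t *\<^sub>R p \<in> F"
      using p H(1) t pos e by (auto simp: F_def subspace_scale linear_simps(5)[OF bounded_linear_A'] t_def)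
    then have "t * norm p \<le> \<bar>K\<bar> + 1" using K t by fastforce
    then have "norm p \<le> (\<bar>K\<bar> + 1) * (norm (A' p) + e / (\<bar>K\<bar> + 1))"
      using pos by (simp add: t_def field_simps)
    also have "\<dots> = (\<bar>K\<bar> + 1) * norm (A' p) + e" by (simp add: field_simps)
    finally show "norm p \<le> (\<bar>K\<bar> + 1) * norm (A' p) + e" .
  qed
  then show ?thesis by (intro exI[of _ "\<bar>K\<bar> + 1"]) auto
qed

text \<open>Let \<open>R p\<close> and \<open>r\<close> represent \<open>A' p\<close> and \<open>g\<close>.  The best approximation \<open>R p\<close> of \<open>r\<close> exists because
  \<open>R\<close> is bounded below; its error \<open>w = R p - r\<close> is orthogonal to the range of \<open>R\<close>, that is \<open>A w = 0\<close>, so it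
  vanishes by injectivity of \<open>A\<close>.\<close>

lemma A'_surj:
  assumes g: "g \<in> dual_of H"
  shows "\<exists>p\<in>H. A' p = g"
proof -
  define R where "R p = representer H (\<lambda>v. blinfun_apply (A v) p)" for p
  have R: "R p \<in> H" "\<And>v. v \<in> H \<Longrightarrow> inner (R p) v = blinfun_apply (A v) p" for p
    unfolding R_def using representer[OF H bounded_linear_on_apply[OF A]] by auto
  have blR: "bounded_linear R" unfolding R_def by (rule bounded_linear_adjoint[OF H A])
  define r where "r = representer H (blinfun_apply g)"
  have r: "r \<in> H" "\<And>v. v \<in> H \<Longrightarrow> inner r v = blinfun_apply g v"
    unfolding r_def
    using representer[OF H bounded_linear_imp_bounded_linear_on[OF blinfun.bounded_linear_right]] by auto
  obtain c where c: "0 < c" "\<And>p. p \<in> H \<Longrightarrow> norm p \<le> c * norm (A' p)" using A'_bounded_below by blast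
  have A'R: "norm (A' p) \<le> norm (R p)" for p
    by (rule dual_of_norm_le[OF H A'_in]) (auto simp: A'_apply R(2)[symmetric] Cauchy_Schwarz_ineq2)
  have "\<exists>p\<in>H. \<forall>q\<in>H. inner (R p) (R q) = inner r (R q)"
  proof (rule coercive_form_represents[OF H, where c="1 / c\<^sup>2"])
    fix p assume p: "p \<in> H"
    show "bounded_linear_on H (\<lambda>v. inner (R p) (R v))"
      by (intro bounded_linear_imp_bounded_linear_on bounded_linear_compose[OF bounded_linear_inner_right blR])
    have "norm p \<le> c * norm (R p)" using c(2)[OF p] A'R[of p] c(1) by (smt (verit) mult_left_mono)
    then have "(norm p)\<^sup>2 \<le> (c * norm (R p))\<^sup>2" by (intro power_mono) auto
    then show "1 / c\<^sup>2 * (norm p)\<^sup>2 \<le> inner (R p) (R p)"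
      using c(1) by (simp add: power_mult_distrib power2_norm_eq_inner field_simps)
  qed (use c in \<open>auto simp: inner_commute intro!: bounded_linear_imp_bounded_linear_on
         bounded_linear_compose[OF bounded_linear_inner_right blR]\<close>)
  then obtain p where p: "p \<in> H" "\<And>q. q \<in> H \<Longrightarrow> inner (R p) (R q) = inner r (R q)" by blast
  have w: "R p - r \<in> H" using R r H(1) by (simp add: subspace_diff)
  have "A (R p - r) = A 0"
  proof (rule dual_of_eqI[OF H])
    fix q assume q: "q \<in> H"
    have "blinfun_apply (A (R p - r)) q = inner (R q) (R p - r)" using R(2)[OF w] by simp
    also have "\<dots> = 0" using p(2)[OF q] by (simp add: inner_diff_right inner_commute)
    finally show "blinfun_apply (A (R p - r)) q = blinfun_apply (A 0) q"
      by (simp add: bounded_linear_on_0[OF A H(1)])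
  qed (use w in \<open>auto intro: A_in subspace_0[OF H(1)]\<close>)
  then have "R p - r = 0"
    using bij_A w subspace_0[OF H(1)] by (metis bij_betw_imp_inj_on inj_onD)
  then have "A' p = g"
    using R r g by (intro dual_of_eqI[OF H]) (auto simp: A'_in A'_apply)
  with p(1) show ?thesis by blast
qed

text \<open>The bounded inverse theorem for \<open>A\<close> follows from the one for \<open>A'\<close> by duality: with \<open>A' p\<close> representing \<open>y\<close>,
  \<open>(norm y)^2 = (A y) p \<le> norm (A y) * norm p\<close>.\<close>

lemma stability:
  obtains c where "0 < c" "\<And>y. y \<in> H \<Longrightarrow> norm y \<le> c * norm (A y)"
    "\<And>p. p \<in> H \<Longrightarrow> norm p \<le> c * norm (A' p)"
proof -
  obtain c where c: "0 < c" "\<And>p. p \<in> H \<Longrightarrow> norm p \<le> c * norm (A' p)" using A'_bounded_below by blast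
  have "norm y \<le> c * norm (A y)" if y: "y \<in> H" for y
  proof (rule norm_le_of_inner_self)
    have lin: "bounded_linear_on H (inner y)"
      by (intro bounded_linear_imp_bounded_linear_on bounded_linear_inner_right)
    obtain p where p: "p \<in> H" "A' p = extend_functional H (inner y)"
      using A'_surj[OF extend_functional_in[OF H lin]] by blast
    have "norm (A' p) \<le> norm y"
      by (rule dual_of_norm_le[OF H A'_in])
        (auto simp: p(2) extend_functional_apply[OF H lin] Cauchy_Schwarz_ineq2)
    then have np: "norm p \<le> c * norm y" using c(2)[OF p(1)] c(1) by (smt (verit) mult_left_mono)
    have "inner y y = blinfun_apply (A y) p"
      using extend_functional_apply[OF H lin y] A'_apply[OF y, of p] p(2) by simp
    also have "\<dots> \<le> norm (A y) * norm p" using norm_blinfun[of "A y" p] by simp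
    also have "\<dots> \<le> norm (A y) * (c * norm y)" using np by (rule mult_left_mono) simp
    finally show "inner y y \<le> (c * norm (A y)) * norm y" by (simp add: ac_simps)
  qed (use c in simp)
  with c that show ?thesis by blast
qed

definition solve :: "('y \<Rightarrow>\<^sub>L real) \<Rightarrow> 'y" where
  "solve = inv_into H A"

lemma solve_in: "g \<in> dual_of H \<Longrightarrow> solve g \<in> H"
  and A_solve: "g \<in> dual_of H \<Longrightarrow> A (solve g) = g"
  using bij_A by (auto simp: solve_def bij_betw_def inv_into_into f_inv_into_f)

lemma A_inj: "y \<in> H \<Longrightarrow> y' \<in> H \<Longrightarrow> A y = A y' \<Longrightarrow> y = y'"
  using bij_A by (auto simp: bij_betw_def inj_on_def)

lemma bounded_linear_on_solve: "bounded_linear_on (dual_of H) solve"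
proof -
  note sub = subspace_dual_of[OF H]
  obtain c where c: "0 < c" "\<And>y. y \<in> H \<Longrightarrow> norm y \<le> c * norm (A y)" using stability by metis
  show ?thesis
    unfolding bounded_linear_on_def
  proof (intro conjI ballI allI exI)
    fix g h k assume gh: "g \<in> dual_of H" "h \<in> dual_of H"
    show "solve (g + h) = solve g + solve h"
      by (rule A_inj) (use gh H(1) sub in \<open>auto simp: solve_in A_solve bounded_linear_on_add[OF A] subspace_add\<close>)
    show "solve (k *\<^sub>R g) = k *\<^sub>R solve g"
      by (rule A_inj) (use gh H(1) sub in \<open>auto simp: solve_in A_solve bounded_linear_on_scaleR[OF A] subspace_scale\<close>)
    show "norm (solve g) \<le> c * norm g"
      using c(2)[OF solve_in[OF gh(1)]] by (simp add: A_solve gh)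
  qed
qed

end

section \<open>Constraints of a simplex\<close>

lemma norm_Pair5_ge:
  shows "norm a \<le> norm (a, b, c, d, e)" and "norm b \<le> norm (a, b, c, d, e)"
    and "norm c \<le> norm (a, b, c, d, e)" and "norm d \<le> norm (a, b, c, d, e)"
    and "norm e \<le> norm (a, b, c, d, e)"
proof -
  note 2 = order_trans[OF norm_snd_le norm_snd_le]
  note 3 = order_trans[OF norm_snd_le 2]
  show "norm a \<le> norm (a, b, c, d, e)" by (rule norm_fst_le)
  show "norm b \<le> norm (a, b, c, d, e)" by (rule order_trans[OF norm_fst_le norm_snd_le])
  show "norm c \<le> norm (a, b, c, d, e)" by (rule order_trans[OF norm_fst_le 2])
  show "norm d \<le> norm (a, b, c, d, e)" by (rule order_trans[OF norm_fst_le 3])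
  show "norm e \<le> norm (a, b, c, d, e)" by (rule order_trans[OF norm_snd_le 3])
qed

lemma diag_ind_nth: "(diag_ind S *v v) $ i = (if i \<in> S then v $ i else 0)"
proof -
  have "(diag_ind S *v v) $ i = (\<Sum>k\<in>UNIV. (if i = k \<and> i \<in> S then 1 else 0) * v $ k)"
    by (simp only: diag_ind_def matrix_vector_mult_def vec_lambda_beta)
  also have "\<dots> = (\<Sum>k\<in>UNIV. if i = k then (if i \<in> S then v $ k else 0) else 0)"
    by (rule sum.cong) auto
  finally show ?thesis by simp
qed

lemma matrix_vector_mult_along:
  fixes K :: "real^'n^'m"
  shows "(K *v (x + t *\<^sub>R d)) $ i = (K *v x) $ i + t * (K *v d) $ i"
  by (simp add: matrix_vector_right_distrib matrix_vector_mult_scaleR)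

lemma bounded_ray_trivial:
  fixes T :: "'a::real_normed_vector set"
  assumes "bounded T" "\<And>t. 0 \<le> t \<Longrightarrow> x + t *\<^sub>R d \<in> T"
  shows "d = 0"
proof (rule ccontr)
  assume d: "d \<noteq> 0"
  obtain R where R: "\<And>v. v \<in> T \<Longrightarrow> norm v \<le> R" using assms(1) by (auto simp: bounded_iff)
  define t where "t = (\<bar>R\<bar> + norm x + 1) / norm d"
  have "norm (x + t *\<^sub>R d) \<le> R" by (rule R, rule assms(2)) (simp add: t_def)
  moreover have "norm (t *\<^sub>R d) - norm x \<le> norm (x + t *\<^sub>R d)"
    by (metis add.commute norm_diff_ineq)
  moreover have "norm (t *\<^sub>R d) = \<bar>R\<bar> + norm x + 1" using d by (simp add: t_def)
  ultimately show False by linarith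
qed

text \<open>If all rows but \<open>j\<close> annihilate a direction, then all rows are nonpositive on this direction or on its negative.  This is a
  recession direction of the bounded polyhedron, hence 0.  So the \<open>n\<close> rows other than \<open>j\<close> are linearly independent, and
  \<open>G\<close> prescribes their values.\<close>

lemma simplex_constraint_rows:
  fixes K :: "real^'n::finite^'m::finite" and b :: "real^'m"
  defines "T \<equiv> {\<beta>. \<forall>i. (K *v \<beta>) $ i \<le> b $ i}"
  assumes card: "CARD('m) = CARD('n) + 1" and T: "bounded T" "\<beta>0 \<in> T"
  obtains G where "bounded_linear G" "\<And>z i. i \<noteq> j \<Longrightarrow> (K *v G z) $ i = z $ i"
proof -
  define M where "M d = (\<chi> i. if i = j then 0 else (K *v d) $ i)" for d
  have linM: "linear M"
    by (rule linearI) (simp_all add: M_def vec_eq_iff matrix_vector_right_distrib vec.scale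
        scalar_mult_eq_scaleR[symmetric])
  have ker: "d = 0" if "M d = 0" "(K *v d) $ j \<le> 0" for d
  proof (rule bounded_ray_trivial[OF T(1)])
    fix t :: real assume t: "0 \<le> t"
    have "(K *v d) $ i \<le> 0" for i using that by (cases "i = j") (auto simp: M_def vec_eq_iff split: if_splits)
    then have "t * (K *v d) $ i \<le> 0" for i using t by (simp add: mult_nonneg_nonpos)
    then show "\<beta>0 + t *\<^sub>R d \<in> T"
      using T(2) add_mono[of "(K *v \<beta>0) $ i" "b $ i" "t * (K *v d) $ i" 0 for i]
      unfolding T_def by (simp add: matrix_vector_mult_along)
  qed
  have inj: "inj M"
  proof (rule linear_injective_0[OF linM, THEN iffD2], intro allI impI)
    fix d assume d: "M d = 0"
    have "M (- d) = 0" using d linear_neg[OF linM, of d] by simp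
    moreover have "(K *v (- d)) $ j = - (K *v d) $ j"
      using vec.neg[of K d] by simp
    ultimately show "d = 0" using ker[of d] ker[of "- d"] d
      by (cases "(K *v d) $ j \<le> 0") auto
  qed
  have "range M = {v. inner (axis j 1) v = 0}"
  proof (rule subspace_dim_equal)
    show "subspace (range M)" using linM by (simp add: linear_subspace_image)
    show "subspace {v. inner (axis j (1::real)) v = 0}" by (rule subspace_hyperplane)
    show "range M \<subseteq> {v. inner (axis j 1) v = 0}" by (auto simp: M_def inner_axis')
    have "dim {v :: real^'m. inner (axis j 1) v = 0} = CARD('m) - 1"
      by (subst dim_special_hyperplane) (auto simp: axis_in_Basis_iff)
    moreover have "dim (range M) = CARD('n)"
      using dim_image_eq[OF linM, of UNIV] inj by simp
    ultimately show "dim (range M) \<ge> dim {v :: real^'m. inner (axis j 1) v = 0}" using card by simp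
  qed
  obtain g where g: "linear g" "g \<circ> M = id" using linear_injective_left_inverse[OF linM inj] by blast
  define cut where "cut z = (\<chi> i. if i = j then 0 else z $ i)" for z :: "real^'m"
  have lincut: "linear cut" by (rule linearI) (simp_all add: cut_def vec_eq_iff)
  show ?thesis
  proof (rule that[of "g \<circ> cut"])
    show "bounded_linear (g \<circ> cut)"
      using linear_compose[OF lincut g(1)] by (simp add: linear_conv_bounded_linear)
    show "(K *v (g \<circ> cut) z) $ i = z $ i" if "i \<noteq> j" for z i
    proof -
      have "cut z \<in> range M"
        unfolding \<open>range M = _\<close> by (simp add: cut_def inner_axis')
      then obtain d where d: "cut z = M d" by blast
      have "M (g (cut z)) = cut z" using g(2) d by (metis comp_apply id_apply)
      then show ?thesis using that by (simp add: M_def cut_def vec_eq_iff) metis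
    qed
  qed
qed

text \<open>If all constraints were active at \<open>\<beta>\<close>, the polyhedron would be a cone with apex \<open>\<beta>\<close>; a bounded cone is a
  point.\<close>

lemma simplex_inactive_constraint:
  fixes K :: "real^'n::finite^'m::finite" and b :: "real^'m"
  defines "T \<equiv> {\<beta>. \<forall>i. (K *v \<beta>) $ i \<le> b $ i}"
  assumes T: "bounded T" and \<beta>: "\<beta> \<in> T" "\<beta>' \<in> T" "\<beta>' \<noteq> \<beta>"
  shows "\<exists>j. (K *v \<beta> - b) $ j < 0"
proof (rule ccontr)
  assume *: "\<not> ?thesis"
  have act: "(K *v \<beta>) $ i = b $ i" for i
    using \<beta>(1) * unfolding T_def by (auto simp: not_less intro: antisym)
  have "\<beta>' - \<beta> = 0"
  proof (rule bounded_ray_trivial[OF T])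
    fix t :: real assume t: "0 \<le> t"
    have "(K *v (\<beta>' - \<beta>)) $ i \<le> 0" for i
      using \<beta>(2) act[of i] unfolding T_def by (simp add: matrix_vector_mult_diff_distrib)
    then have "t * (K *v (\<beta>' - \<beta>)) $ i \<le> 0" for i using t by (simp add: mult_nonneg_nonpos)
    then show "\<beta> + t *\<^sub>R (\<beta>' - \<beta>) \<in> T"
      unfolding T_def mem_Collect_eq matrix_vector_mult_along act by simp
  qed
  with \<beta>(3) show False by simp
qed

lemma simplex_bounded_nontrivial:
  assumes "int CARD('n::finite) simplex (T :: (real^'n) set)" 
  shows "bounded T" and "\<exists>\<beta>'\<in>T. \<beta>' \<noteq> \<beta>"
proof -
  obtain C where C: "finite C" "int (card C) = int CARD('n) + 1" "T = convex hull C"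
    using assms by (auto simp: simplex_def intro: aff_independent_finite)
  show "bounded T" using C by (simp add: finite_imp_bounded_convex_hull)
  have "\<not> C \<subseteq> {\<beta>}"
  proof
    assume "C \<subseteq> {\<beta>}"
    then have "card C \<le> 1" using card_mono[of "{\<beta>}" C] by simp
    moreover have "0 < CARD('n)" by simp
    ultimately show False using C(2) by linarith
  qed
  then show "\<exists>\<beta>'\<in>T. \<beta>' \<noteq> \<beta>" using C(3) hull_subset[of C convex] by blast
qed

section \<open>Uniform solvability of the Newton systems\<close>

context state_equation begin

text \<open>The two rows of a symmetric second derivative in \<open>(\<beta>, y)\<close>, bounded by \<open>k\<close> and positive semidefinite on
  \<open>UNIV \<times> H\<close>, with coercivity required only in \<open>\<beta>\<close>.\<close>

definition coercive_hessian :: "real \<Rightarrow> real \<Rightarrow> ((real^'n::finite) \<times> 'y \<Rightarrow> real^'n) \<Rightarrow>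
    ((real^'n) \<times> 'y \<Rightarrow> ('y \<Rightarrow>\<^sub>L real)) \<Rightarrow> bool" where
  "coercive_hessian c k g1 g2 \<longleftrightarrow>
     bounded_linear_on (UNIV \<times> H) g1 \<and> bounded_linear_on (UNIV \<times> H) g2 \<and>
     g2 ` (UNIV \<times> H) \<subseteq> dual_of H \<and>
     (\<forall>w\<in>UNIV \<times> H. norm (g1 w) \<le> k * norm w \<and> norm (g2 w) \<le> k * norm w) \<and>
     (\<forall>w\<in>UNIV \<times> H. \<forall>w'\<in>UNIV \<times> H.
        inner (g1 w) (fst w') + blinfun_apply (g2 w) (snd w') = inner (g1 w') (fst w) + blinfun_apply (g2 w') (snd w)) \<and>
     (\<forall>w\<in>UNIV \<times> H. c * (norm (fst w))\<^sup>2 \<le> inner (g1 w) (fst w) + blinfun_apply (g2 w) (snd w))"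

text \<open>Orthogonal projections within \<open>U\<close>; multiplication by an indicator function is the case of interest.\<close>

definition cutoff :: "('u \<Rightarrow> 'u) \<Rightarrow> bool" where
  "cutoff \<pi> \<longleftrightarrow> bounded_linear \<pi> \<and> \<pi> ` U \<subseteq> U \<and> (\<forall>v\<in>U. \<pi> (\<pi> v) = \<pi> v) \<and>
     (\<forall>v\<in>U. \<forall>w\<in>U. inner (\<pi> v) w = inner v (\<pi> w))"

text \<open>The Newton derivative of \<open>W\<close> with its data made abstract: \<open>I\<close> is the active set \<open>\<A>_1\<close> of the constraints,
  \<open>\<pi>\<close> the multiplication by the indicator of \<open>\<A>_3\<close>, and \<open>g1\<close>, \<open>g2\<close> are the rows of \<open>h''\<close>.\<close>

definition newton_op where
  "newton_op K \<sigma> I \<pi> g1 g2 = (\<lambda>(b, y, u, z, p).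
     (g1 (b, y) + transpose K *v z, g2 (b, y) + A' p, u - \<pi> (B' p) /\<^sub>R \<sigma>,
      diag_ind I *v (K *v b) - diag_ind (- I) *v z, A y - B u))"

text \<open>With \<open>N\<close> the norm of the right-hand side, \<open>\<omega> = norm (\<pi> (B' p))\<close> and \<open>E = norm b + \<omega>\<close>, the rows
  bound \<open>u\<close>, \<open>y\<close>, \<open>p\<close> and \<open>z\<close>, in this order, by multiples of \<open>N + E\<close>.  Testing the first two
  rows with \<open>(b, y)\<close> gives \<open>E^2 \<le> C N (N + E)\<close>, and hence \<open>E \<le> (C + 1) N\<close>.  The constant must not depend
  on \<open>I\<close>, \<open>\<pi>\<close> and the Hessian, since all of them vary with the iterate.\<close>

lemma newton_op_bound:
  fixes K :: "real^'n::finite^'m::finite"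
  assumes \<sigma>: "0 < \<sigma>" and c: "0 < c" and k: "0 \<le> k"
    and G: "bounded_linear G" "\<And>z i. i \<noteq> j \<Longrightarrow> (K *v G z) $ i = z $ i"
  shows "\<exists>M>0. \<forall>I \<pi> g1 g2 s. j \<notin> I \<longrightarrow> cutoff \<pi> \<longrightarrow> coercive_hessian c k g1 g2 \<longrightarrow>
           s \<in> UNIV \<times> H \<times> U \<times> UNIV \<times> H \<longrightarrow> norm s \<le> M * norm (newton_op K \<sigma> I \<pi> g1 g2 s)"
proof -
  obtain ca where ca: "0 < ca" "\<And>y. y \<in> H \<Longrightarrow> norm y \<le> ca * norm (A y)"
    "\<And>p. p \<in> H \<Longrightarrow> norm p \<le> ca * norm (A' p)" using stability by metis
  obtain kB where kB: "0 < kB" "\<And>u. u \<in> U \<Longrightarrow> norm (B u) \<le> kB * norm u"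
    using bounded_linear_on_bound[OF B] by metis
  obtain kB' where kB': "0 < kB'" "\<And>p. norm (B' p) \<le> norm p * kB'"
    using bounded_linear.pos_bounded[OF bounded_linear_B'] by blast
  obtain kG where kG: "0 < kG" "\<And>z. norm (G z) \<le> norm z * kG"
    using bounded_linear.pos_bounded[OF G(1)] by blast
  obtain kK where kK: "0 < kK" "\<And>b. norm (K *v b) \<le> norm b * kK"
    using bounded_linear.pos_bounded[OF matrix_vector_mul_bounded_linear, of K] by blast
  define m where "m = real CARD('m)"
  define C1 where "C1 = ca * (1 + kB * (1 + 1 / \<sigma>))"
  define C2 where "C2 = ca * (1 + k * (1 + C1))"
  define C3 where "C3 = kG * (1 + k * (1 + C1)) + (1 + kK * kG)"
  define C4 where "C4 = 1 + C1 + C2 + C2 * kB' + m * (C3 + kK)"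
  define C5 where "C5 = 2 * (1 / c + \<sigma>) * C4"
  define C6 where "C6 = 1 + C1 + (1 + 1 / \<sigma>) + C3 + C2"
  have pos: "0 \<le> C1" "0 \<le> C2" "0 \<le> C3" "0 \<le> C4" "0 \<le> C5" "0 < C6"
    using \<sigma> c k ca kB kB' kG kK
    by (auto simp: C1_def C2_def C3_def C4_def C5_def C6_def m_def
        intro!: add_nonneg_nonneg mult_nonneg_nonneg add_pos_nonneg)
  have "norm s \<le> C6 * (C5 + 2) * norm (newton_op K \<sigma> I \<pi> g1 g2 s)"
    if I: "j \<notin> I" and chi: "cutoff \<pi>" and hess: "coercive_hessian c k g1 g2"
      and s: "s \<in> UNIV \<times> H \<times> U \<times> UNIV \<times> H" for I \<pi> g1 g2 s
  proof -
    obtain b y u z p where s_eq: "s = (b, y, u, z, p)" by (metis prod_cases5)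
    have mem: "y \<in> H" "u \<in> U" "p \<in> H" using s by (auto simp: s_eq)
    obtain r1 r2 r3 r4 r5 where r_eq: "newton_op K \<sigma> I \<pi> g1 g2 s = (r1, r2, r3, r4, r5)"
      by (metis prod_cases5)
    have eqs: "g1 (b, y) + transpose K *v z = r1" "g2 (b, y) + A' p = r2" "u - \<pi> (B' p) /\<^sub>R \<sigma> = r3"
      "diag_ind I *v (K *v b) - diag_ind (- I) *v z = r4" "A y - B u = r5"
      using r_eq by (auto simp: s_eq newton_op_def)
    define N where "N = norm (r1, r2, r3, r4, r5)"
    have N0: "0 \<le> N" by (simp add: N_def)
    have rN: "norm r1 \<le> N" "norm r2 \<le> N" "norm r3 \<le> N" "norm r4 \<le> N" "norm r5 \<le> N"
      unfolding N_def by (rule norm_Pair5_ge)+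
    define \<omega> where "\<omega> = norm (\<pi> (B' p))"
    define E where "E = norm b + \<omega>"
    define S where "S = N + E"
    have S: "N \<le> S" "norm b \<le> S" "\<omega> \<le> S" "0 \<le> S" "0 \<le> \<omega>" "0 \<le> E"
      using N0 by (auto simp: S_def E_def \<omega>_def)
    have nu: "norm u \<le> (1 + 1 / \<sigma>) * S"
    proof -
      have "u = r3 + \<pi> (B' p) /\<^sub>R \<sigma>" using eqs(3) by auto
      then have "norm u \<le> norm r3 + \<omega> / \<sigma>"
        using norm_triangle_ineq[of r3 "\<pi> (B' p) /\<^sub>R \<sigma>"] \<sigma> by (simp add: \<omega>_def field_simps)
      also have "\<dots> \<le> S + S / \<sigma>" using rN(3) S \<sigma> by (intro add_mono divide_right_mono) auto
      finally show ?thesis by (simp add: algebra_simps)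
    qed
    have ny: "norm y \<le> C1 * S"
    proof -
      have "A y = r5 + B u" using eqs(5) by auto
      then have "norm (A y) \<le> norm r5 + norm (B u)" by (simp add: norm_triangle_ineq)
      also have "\<dots> \<le> S + kB * ((1 + 1 / \<sigma>) * S)"
        using rN(5) S(1) kB(2)[OF mem(2)] mult_left_mono[OF nu, of kB] kB(1) by linarith
      finally have "ca * norm (A y) \<le> ca * (S + kB * ((1 + 1 / \<sigma>) * S))"
        using ca(1) by (simp add: mult_left_mono)
      with ca(2)[OF mem(1)] show ?thesis by (simp add: C1_def algebra_simps)
    qed
    have w: "(b, y) \<in> UNIV \<times> H" using mem by simp
    have "norm (b, y) \<le> (1 + C1) * S"
      using norm_Pair_le[of b y] S(2) ny by (simp add: algebra_simps)
    then have kw: "k * norm (b, y) \<le> k * ((1 + C1) * S)" using k by (rule mult_left_mono)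
    have ng: "norm (g1 (b, y)) \<le> k * ((1 + C1) * S)" "norm (g2 (b, y)) \<le> k * ((1 + C1) * S)"
      using hess w kw unfolding coercive_hessian_def by (blast intro: order_trans)+
    have np: "norm p \<le> C2 * S"
    proof -
      have "A' p = r2 - g2 (b, y)" using eqs(2) by (simp add: algebra_simps)
      then have "norm (A' p) \<le> S + k * ((1 + C1) * S)"
        using norm_triangle_ineq4[of r2 "g2 (b, y)"] rN(2) S(1) ng(2) by simp
      then have "ca * norm (A' p) \<le> ca * (S + k * ((1 + C1) * S))" using ca(1) by (simp add: mult_left_mono)
      with ca(3)[OF mem(3)] show ?thesis by (simp add: C2_def algebra_simps)
    qed
    \<comment> \<open>The entry \<open>j\<close> of \<open>z\<close> is given by the fourth row; the others are tested by \<open>G z\<close>.\<close>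
    have zj: "z $ j = - r4 $ j" using eqs(4) I by (auto simp: diag_ind_nth)
    have nz: "norm z \<le> C3 * S"
    proof -
      let ?e = "z $ j * (z $ j - (K *v G z) $ j)"
      have "inner z (z - K *v G z) = (\<Sum>i\<in>UNIV. if i = j then ?e else 0)"
        unfolding inner_vec_def by (rule sum.cong) (auto simp: G(2))
      then have split: "inner z z = inner z (K *v G z) + ?e" by (simp add: inner_diff_right)
      have "inner z (K *v G z) = inner (transpose K *v z) (G z)" by (simp add: dot_lmul_matrix)
      also have "\<dots> \<le> norm (transpose K *v z) * norm (G z)" by (rule norm_cauchy_schwarz)
      also have "\<dots> \<le> (S + k * ((1 + C1) * S)) * (norm z * kG)"
      proof (intro mult_mono kG(2))
        have "transpose K *v z = r1 - g1 (b, y)" using eqs(1) by (simp add: algebra_simps)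
        then show "norm (transpose K *v z) \<le> S + k * ((1 + C1) * S)"
          using norm_triangle_ineq4[of r1 "g1 (b, y)"] rN(1) S(1) ng(1) by simp
      qed (intro add_nonneg_nonneg mult_nonneg_nonneg S k pos | simp)+
      finally have 1: "inner z (K *v G z) \<le> (S + k * ((1 + C1) * S)) * (norm z * kG)" .
      have "\<bar>?e\<bar> \<le> S * (norm z + norm z * kG * kK)"
        unfolding abs_mult
      proof (rule mult_mono)
        show "\<bar>z $ j\<bar> \<le> S" using zj component_le_norm_cart[of r4 j] rN(4) S(1) by simp
        have "norm (K *v G z) \<le> norm z * kG * kK"
          using kK(2)[of "G z"] mult_right_mono[OF kG(2)[of z], of kK] kK(1) by linarith
        then show "\<bar>z $ j - (K *v G z) $ j\<bar> \<le> norm z + norm z * kG * kK"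
          using component_le_norm_cart[of z j] component_le_norm_cart[of "K *v G z" j] by linarith
      qed (intro S abs_ge_zero)+
      with split 1 have "inner z z \<le> (S + k * ((1 + C1) * S)) * (norm z * kG) + S * (norm z + norm z * kG * kK)"
        by linarith
      also have "\<dots> = (C3 * S) * norm z" by (simp add: C3_def algebra_simps)
      finally have "inner z z \<le> (C3 * S) * norm z" .
      then show ?thesis by (rule norm_le_of_inner_self) (intro mult_nonneg_nonneg pos S)
    qed
    have zK: "\<bar>inner z (K *v b)\<bar> \<le> N * (m * (C3 * S + S * kK))"
    proof -
      have zKi: "\<bar>z $ i * (K *v b) $ i\<bar> \<le> N * (C3 * S + S * kK)" for i
      proof -
        have "0 \<le> C3 * S" "0 \<le> S * kK" using pos S(4) kK(1) by simp_all
        then have bd: "\<bar>z $ i\<bar> \<le> C3 * S + S * kK" "\<bar>(K *v b) $ i\<bar> \<le> C3 * S + S * kK"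
          using component_le_norm_cart[of z i] nz component_le_norm_cart[of "K *v b" i] kK(2)[of b]
            mult_right_mono[OF S(2), of kK] kK(1) by linarith+
        have "r4 $ i = (if i \<in> I then (K *v b) $ i else - z $ i)"
          using eqs(4) by (auto simp: diag_ind_nth)
        then have "\<bar>z $ i * (K *v b) $ i\<bar> = \<bar>r4 $ i\<bar> * (if i \<in> I then \<bar>z $ i\<bar> else \<bar>(K *v b) $ i\<bar>)"
          by (auto simp: abs_mult)
        also have "\<dots> \<le> N * (C3 * S + S * kK)"
          using bd component_le_norm_cart[of r4 i] rN(4) N0 by (intro mult_mono) auto
        finally show ?thesis .
      qed
      have "\<bar>inner z (K *v b)\<bar> \<le> (\<Sum>i\<in>UNIV. \<bar>z $ i * (K *v b) $ i\<bar>)"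
        unfolding inner_vec_def inner_real_def by (rule sum_abs)
      also have "\<dots> \<le> (\<Sum>i\<in>(UNIV::'m set). N * (C3 * S + S * kK))" by (intro sum_mono zKi)
      also have "\<dots> = N * (m * (C3 * S + S * kK))" by (simp add: m_def)
      finally show ?thesis .
    qed
    \<comment> \<open>The first row is tested with \<open>b\<close> and the second with \<open>y\<close>; the pairings with \<open>z\<close> and \<open>p\<close> are evaluated by the other rows.\<close>
    have energy: "c * (norm b)\<^sup>2 + \<omega>\<^sup>2 / \<sigma> \<le> N * (C4 * S)"
    proof -
      have "c * (norm b)\<^sup>2 \<le> inner (g1 (b, y)) b + blinfun_apply (g2 (b, y)) y"
        using hess w unfolding coercive_hessian_def by fastforce
      moreover have "inner (g1 (b, y)) b = inner r1 b - inner z (K *v b)"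
        using eqs(1) by (auto simp: inner_add_left dot_lmul_matrix)
      moreover have "blinfun_apply (g2 (b, y)) y = blinfun_apply r2 y - blinfun_apply (A y) p"
        using eqs(2) A'_apply[OF mem(1), of p] by (auto simp: blinfun.add_left)
      moreover have "blinfun_apply (A y) p = blinfun_apply r5 p + inner u (B' p)"
        using eqs(5) inner_B'[OF mem(2), of p] by (auto simp: blinfun.diff_left inner_commute)
      moreover have "inner u (B' p) = inner r3 (B' p) + \<omega>\<^sup>2 / \<sigma>"
      proof -
        have "inner (\<pi> (B' p)) (B' p) = inner (\<pi> (B' p)) (\<pi> (B' p))"
          using chi B'_in[of p] unfolding cutoff_def by (metis image_subset_iff)
        moreover have "u = r3 + (1 / \<sigma>) *\<^sub>R \<pi> (B' p)" using eqs(3) by (auto simp: divide_inverse)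
        ultimately show ?thesis
          by (simp add: inner_add_left \<omega>_def power2_norm_eq_inner)
      qed
      ultimately have "c * (norm b)\<^sup>2 + \<omega>\<^sup>2 / \<sigma> \<le> inner r1 b + \<bar>inner z (K *v b)\<bar> + blinfun_apply r2 y
          + (- blinfun_apply r5 p) + (- inner r3 (B' p))" by linarith
      also have "\<dots> \<le> N * S + N * (m * (C3 * S + S * kK)) + N * (C1 * S) + N * (C2 * S) + N * (C2 * S * kB')"
      proof (intro add_mono zK)
        show "inner r1 b \<le> N * S"
          using norm_cauchy_schwarz[of r1 b] mult_mono[OF rN(1) S(2) N0] by simp
        show "blinfun_apply r2 y \<le> N * (C1 * S)"
          using norm_blinfun[of r2 y] mult_mono[OF rN(2) ny N0] by simp
        show "- blinfun_apply r5 p \<le> N * (C2 * S)"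
          using norm_blinfun[of r5 p] mult_mono[OF rN(5) np N0] by simp
        have "norm (B' p) \<le> C2 * S * kB'"
          using kB'(2)[of p] mult_right_mono[OF np, of kB'] kB'(1) by linarith
        then show "- inner r3 (B' p) \<le> N * (C2 * S * kB')"
          using Cauchy_Schwarz_ineq2[of r3 "B' p"] mult_mono[OF rN(3) _ N0, of "norm (B' p)" "C2 * S * kB'"] by simp
      qed
      also have "\<dots> = N * (C4 * S)" by (simp add: C4_def algebra_simps)
      finally show ?thesis .
    qed
    have E2: "E * E \<le> C5 * N * (N + E)"
    proof -
      have "(norm b)\<^sup>2 = 1 / c * (c * (norm b)\<^sup>2)" using c by simp
      also have "\<dots> \<le> 1 / c * (c * (norm b)\<^sup>2 + \<omega>\<^sup>2 / \<sigma>)" using c \<sigma> by (intro mult_left_mono) auto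
      finally have 1: "(norm b)\<^sup>2 \<le> 1 / c * (N * (C4 * S))"
        using mult_left_mono[OF energy, of "1 / c"] c by (meson order_trans less_imp_le zero_less_divide_1_iff)
      have "\<omega>\<^sup>2 = \<sigma> * (\<omega>\<^sup>2 / \<sigma>)" using \<sigma> by simp
      also have "\<dots> \<le> \<sigma> * (c * (norm b)\<^sup>2 + \<omega>\<^sup>2 / \<sigma>)" using c \<sigma> by (intro mult_left_mono) auto
      finally have 2: "\<omega>\<^sup>2 \<le> \<sigma> * (N * (C4 * S))"
        using mult_left_mono[OF energy, of \<sigma>] \<sigma> by linarith
      have "E * E \<le> 2 * ((norm b)\<^sup>2 + \<omega>\<^sup>2)"
        using sum_squares_bound[of "norm b" \<omega>] by (simp add: E_def power2_eq_square algebra_simps)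
      also have "\<dots> \<le> 2 * (1 / c * (N * (C4 * S)) + \<sigma> * (N * (C4 * S)))"
        by (intro mult_left_mono add_mono 1 2) simp
      also have "\<dots> = C5 * N * (N + E)" by (simp add: C5_def S_def algebra_simps add_divide_distrib)
      finally show ?thesis .
    qed
    have "E \<le> (C5 + 1) * N"
    proof (rule ccontr)
      assume "\<not> ?thesis"
      then have less: "(C5 + 1) * N < E" by simp
      have C5N: "C5 * N \<le> E" using less N0 by (simp add: algebra_simps)
      have E_pos: "0 < E" using less N0 pos by (smt (verit) mult_nonneg_nonneg)
      have "(C5 + 1) * N * E < E * E" using less E_pos by (rule mult_strict_right_mono)
      moreover have "C5 * N * (N + E) \<le> (C5 + 1) * N * E"
        using mult_right_mono[OF C5N N0] by (simp add: algebra_simps)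
      ultimately show False using E2 by linarith
    qed
    then have SN: "S \<le> (C5 + 2) * N" by (simp add: S_def algebra_simps)
    have "norm s \<le> norm b + (norm y + (norm u + (norm z + norm p)))"
      unfolding s_eq by (intro order_trans[OF norm_Pair_le] add_left_mono norm_Pair_le)
    also have "\<dots> \<le> S + (C1 * S + ((1 + 1 / \<sigma>) * S + (C3 * S + C2 * S)))"
      by (intro add_mono S ny nu nz np)
    also have "\<dots> = C6 * S" by (simp add: C6_def algebra_simps)
    also have "\<dots> \<le> C6 * ((C5 + 2) * N)" using SN pos by (simp add: mult_left_mono)
    finally show ?thesis by (simp add: r_eq N_def mult.assoc)
  qed
  then show ?thesis using pos by (intro exI[of _ "C6 * (C5 + 2)"]) auto
qed

text \<open>The active constraints and the active control bounds fix part of the unknowns; subtracting a particular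
  solution, the rest \<open>(b, w)\<close> ranges over a closed subspace \<open>Z\<close>.  There the system is the optimality
  condition of a coercive quadratic problem, the state being eliminated by \<open>Sc w\<close>.  The multipliers are
  recovered afterwards: \<open>p\<close> from the adjoint equation, and \<open>z\<close> from a residual \<open>\<rho>\<close> that is orthogonal to
  all directions along the active constraints.\<close>

lemma newton_op_surj:
  fixes K :: "real^'n::finite^'m::finite"
  assumes \<sigma>: "0 < \<sigma>" and c: "0 < c"
    and G: "bounded_linear G" "\<And>z i. i \<noteq> j \<Longrightarrow> (K *v G z) $ i = z $ i"
    and I: "j \<notin> I" and cut: "cutoff \<pi>" and hess: "coercive_hessian c k g1 g2"
    and r: "r2 \<in> dual_of H" "r3 \<in> U" "r5 \<in> dual_of H"
  shows "\<exists>s\<in>UNIV \<times> H \<times> U \<times> UNIV \<times> H. newton_op K \<sigma> I \<pi> g1 g2 s = (r1, r2, r3, r4, r5)"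
proof -
  note sub = subspace_dual_of[OF H]
  have g: "bounded_linear_on (UNIV \<times> H) g1" "bounded_linear_on (UNIV \<times> H) g2"
    and g2_in: "\<And>w. w \<in> UNIV \<times> H \<Longrightarrow> g2 w \<in> dual_of H"
    using hess by (auto simp: coercive_hessian_def)
  have \<pi>: "bounded_linear \<pi>" "\<And>v. v \<in> U \<Longrightarrow> \<pi> v \<in> U" "\<And>v. v \<in> U \<Longrightarrow> \<pi> (\<pi> v) = \<pi> v"
    "\<And>v w. v \<in> U \<Longrightarrow> w \<in> U \<Longrightarrow> inner (\<pi> v) w = inner v (\<pi> w)"
    using cut by (auto simp: cutoff_def)
  define Sc where "Sc w = solve (B w)" for w
  have Sc_in: "w \<in> U \<Longrightarrow> Sc w \<in> H" and A_Sc: "w \<in> U \<Longrightarrow> A (Sc w) = B w" for w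
    by (auto simp: Sc_def solve_in A_solve B_in)
  have Sc: "bounded_linear_on U Sc"
  proof -
    obtain k1 where k1: "0 < k1" "\<And>g. g \<in> dual_of H \<Longrightarrow> norm (solve g) \<le> k1 * norm g"
      using bounded_linear_on_bound[OF bounded_linear_on_solve] by metis
    obtain k2 where k2: "0 < k2" "\<And>u. u \<in> U \<Longrightarrow> norm (B u) \<le> k2 * norm u"
      using bounded_linear_on_bound[OF B] by metis
    have "norm (Sc w) \<le> (k1 * k2) * norm w" if "w \<in> U" for w
    proof -
      have "norm (Sc w) \<le> k1 * norm (B w)" using k1(2)[OF B_in[OF that]] by (simp add: Sc_def)
      also have "\<dots> \<le> k1 * (k2 * norm w)" using k2(2)[OF that] k1(1) by (simp add: mult_left_mono)
      finally show ?thesis by (simp add: mult.assoc)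
    qed
    then show ?thesis
      by (auto simp: bounded_linear_on_def Sc_def bounded_linear_onD[OF B] B_in
          bounded_linear_onD[OF bounded_linear_on_solve])
  qed
  define Z where "Z = {x :: (real^'n) \<times> 'u. (\<forall>i\<in>I. (K *v fst x) $ i = 0) \<and> snd x \<in> U \<and> \<pi> (snd x) = snd x}"
  have subZ: "subspace Z"
    using U(1) by (auto simp: Z_def subspace_def matrix_vector_right_distrib matrix_vector_mult_scaleR
        linear_simps(1,5)[OF \<pi>(1)] linear_0[OF bounded_linear.linear[OF \<pi>(1)]])
  have "closed Z"
  proof -
    have "Z = (\<Inter>i\<in>I. {x. (K *v fst x) $ i = 0}) \<inter> snd -` U \<inter> {x. \<pi> (snd x) = snd x}"
      by (auto simp: Z_def)
    moreover have "closed {x :: (real^'n) \<times> 'u. (K *v fst x) $ i = 0}" for i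
      by (intro closed_Collect_eq continuous_intros
          bounded_linear.continuous_on[OF matrix_vector_mul_bounded_linear])
    moreover have "closed (snd -` U :: ((real^'n) \<times> 'u) set)"
      by (rule closed_vimage_snd[OF U(2)])
    moreover have "closed {x :: (real^'n) \<times> 'u. \<pi> (snd x) = snd x}"
      by (intro closed_Collect_eq continuous_intros bounded_linear.continuous_on[OF \<pi>(1)])
    ultimately show ?thesis by (auto intro!: closed_Int closed_INT)
  qed
  define L where "L g \<phi> v = (\<lambda>x. inner g (fst x) + blinfun_apply \<phi> (Sc (snd x)) + inner v (snd x))"
    for g :: "real^'n" and \<phi> :: "'y \<Rightarrow>\<^sub>L real" and v :: 'u
  have L: "bounded_linear_on Z (L g \<phi> v)" for g \<phi> v
  proof -
    obtain kS where kS: "0 < kS" "\<And>u. u \<in> U \<Longrightarrow> norm (Sc u) \<le> kS * norm u"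
      using bounded_linear_on_bound[OF Sc] by metis
    have "norm (L g \<phi> v x) \<le> (norm g + norm \<phi> * kS + norm v) * norm x" if "x \<in> Z" for x
    proof -
      have "snd x \<in> U" using that by (simp add: Z_def)
      then have "norm \<phi> * norm (Sc (snd x)) \<le> norm \<phi> * (kS * norm (snd x))"
        using kS(2) by (intro mult_left_mono) auto
      also have "\<dots> \<le> norm \<phi> * (kS * norm x)"
        using kS(1) norm_snd_le[of "snd x" "fst x"] by (intro mult_left_mono) auto
      finally have 1: "\<bar>blinfun_apply \<phi> (Sc (snd x))\<bar> \<le> norm \<phi> * (kS * norm x)"
        using norm_blinfun[of \<phi> "Sc (snd x)"] by simp
      have 2: "\<bar>inner g (fst x)\<bar> \<le> norm g * norm x"
        using Cauchy_Schwarz_ineq2[of g "fst x"] mult_left_mono[OF norm_fst_le[of "fst x" "snd x"], of "norm g"]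
        by simp
      have 3: "\<bar>inner v (snd x)\<bar> \<le> norm v * norm x"
        using Cauchy_Schwarz_ineq2[of v "snd x"] mult_left_mono[OF norm_snd_le[of "snd x" "fst x"], of "norm v"]
        by simp
      from 1 2 3 show ?thesis by (simp add: L_def algebra_simps)
    qed
    then have "\<exists>k. \<forall>x\<in>Z. norm (L g \<phi> v x) \<le> k * norm x" by blast
    moreover have "L g \<phi> v (x + x') = L g \<phi> v x + L g \<phi> v x'" if "x \<in> Z" "x' \<in> Z" for x x'
      using that by (simp add: L_def Z_def bounded_linear_onD[OF Sc] inner_add_right blinfun.add_right)
    moreover have "L g \<phi> v (t *\<^sub>R x) = t *\<^sub>R L g \<phi> v x" if "x \<in> Z" for t x
      using that
      by (simp add: L_def Z_def bounded_linear_onD[OF Sc] blinfun.scaleR_right distrib_left)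
    ultimately show ?thesis unfolding bounded_linear_on_def by blast
  qed
  define b0 where "b0 = G (diag_ind I *v r4)"
  define z0 where "z0 = - (diag_ind (- I) *v r4)"
  define y0 where "y0 = solve (r5 + B r3)"
  have y0: "y0 \<in> H" "A y0 = r5 + B r3"
    using r(2,3) sub by (auto simp: y0_def solve_in A_solve subspace_add B_in)
  define a where "a x = L (g1 (fst x, Sc (snd x))) (g2 (fst x, Sc (snd x))) (\<sigma> *\<^sub>R snd x)" for x
  define l where "l = L (r1 - transpose K *v z0 - g1 (b0, y0)) (r2 - g2 (b0, y0)) 0"
  have Z_mem: "(fst x, Sc (snd x)) \<in> UNIV \<times> H" "snd x \<in> U" if "x \<in> Z" for x
    using that by (auto simp: Z_def Sc_in)
  have "\<exists>x\<in>Z. \<forall>x'\<in>Z. a x x' = l x'"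
  proof (rule coercive_form_represents[OF subZ \<open>closed Z\<close>, where c="min c \<sigma>"])
    fix x x' assume x: "x \<in> Z" "x' \<in> Z"
    have "\<forall>w\<in>UNIV \<times> H. \<forall>w'\<in>UNIV \<times> H.
        inner (g1 w) (fst w') + blinfun_apply (g2 w) (snd w') = inner (g1 w') (fst w) + blinfun_apply (g2 w') (snd w)"
      using hess by (simp add: coercive_hessian_def)
    from this[rule_format, OF Z_mem(1)[OF x(1)] Z_mem(1)[OF x(2)]]
    show "a x x' = a x' x" by (simp add: a_def L_def inner_commute)
  next
    fix x assume x: "x \<in> Z"
    show "bounded_linear_on Z (a x)" unfolding a_def by (rule L)
    have "\<forall>w\<in>UNIV \<times> H. c * (norm (fst w))\<^sup>2 \<le> inner (g1 w) (fst w) + blinfun_apply (g2 w) (snd w)"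
      using hess by (simp add: coercive_hessian_def)
    from this[rule_format, OF Z_mem(1)[OF x]]
    have "c * (norm (fst x))\<^sup>2 + \<sigma> * (norm (snd x))\<^sup>2 \<le> a x x"
      by (simp add: a_def L_def power2_norm_eq_inner)
    moreover have "min c \<sigma> * (norm x)\<^sup>2 \<le> c * (norm (fst x))\<^sup>2 + \<sigma> * (norm (snd x))\<^sup>2"
    proof -
      have "(norm x)\<^sup>2 = (norm (fst x))\<^sup>2 + (norm (snd x))\<^sup>2" by (simp add: norm_prod_def)
      then show ?thesis
        using mult_right_mono[of "min c \<sigma>" c "(norm (fst x))\<^sup>2"] mult_right_mono[of "min c \<sigma>" \<sigma> "(norm (snd x))\<^sup>2"]
        by (simp add: algebra_simps)
    qed
    ultimately show "min c \<sigma> * (norm x)\<^sup>2 \<le> a x x" by linarith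
  qed (use c \<sigma> L in \<open>auto simp: l_def\<close>)
  then obtain b w where bw: "(b, w) \<in> Z" and weak: "\<And>x'. x' \<in> Z \<Longrightarrow> a (b, w) x' = l x'" by auto
  have w: "w \<in> U" "\<pi> w = w" and b: "\<And>i. i \<in> I \<Longrightarrow> (K *v b) $ i = 0" using bw by (auto simp: Z_def)
  define y where "y = y0 + Sc w"
  have y: "y \<in> H" using y0 w H(1) by (simp add: y_def Sc_in subspace_add)
  have gsum: "g1 (b0 + b, y) = g1 (b0, y0) + g1 (b, Sc w)" "g2 (b0 + b, y) = g2 (b0, y0) + g2 (b, Sc w)"
    using bounded_linear_on_add[OF g(1), of "(b0, y0)" "(b, Sc w)"]
      bounded_linear_on_add[OF g(2), of "(b0, y0)" "(b, Sc w)"] y0 w by (auto simp: y_def Sc_in)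
  obtain p where p: "p \<in> H" "A' p = r2 - g2 (b0 + b, y)"
    using A'_surj[of "r2 - g2 (b0 + b, y)"] r(1) g2_in[of "(b0 + b, y)"] y sub by (auto simp: subspace_diff)
  have control: "\<sigma> *\<^sub>R w = \<pi> (B' p)"
  proof -
    define v where "v = \<sigma> *\<^sub>R w - \<pi> (B' p)"
    have v: "v \<in> U" "\<pi> v = v"
      using w \<pi> B'_in[of p] U(1) by (auto simp: v_def subspace_diff subspace_scale linear_simps(2,5)[OF \<pi>(1)])
    have "(0, v) \<in> Z" using v by (simp add: Z_def)
    from weak[OF this] have "\<sigma> * inner w v = blinfun_apply (A' p) (Sc v)"
      by (simp add: a_def l_def L_def p(2) gsum blinfun.diff_left blinfun.add_left)
    also have "\<dots> = inner (B' p) v"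
      by (simp add: A'_apply Sc_in v A_Sc inner_B')
    also have "\<dots> = inner (\<pi> (B' p)) v" using \<pi>(4)[OF B'_in v(1)] v(2) by simp
    finally have "inner v v = 0" by (subst v_def) (simp add: inner_diff_left)
    then show ?thesis by (simp add: v_def)
  qed
  define \<rho> where "\<rho> = r1 - transpose K *v z0 - g1 (b0 + b, y)"
  have \<rho>: "inner \<rho> d = 0" if "\<And>i. i \<in> I \<Longrightarrow> (K *v d) $ i = 0" for d
  proof -
    have "(d, 0) \<in> Z" using that U(1) by (auto simp: Z_def subspace_0 linear_0[OF bounded_linear.linear[OF \<pi>(1)]])
    from weak[OF this] show ?thesis
      by (simp add: a_def l_def L_def \<rho>_def gsum inner_diff_left inner_add_left bounded_linear_on_0[OF Sc U(1)])
  qed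
  have linG: "linear G" by (rule bounded_linear.linear[OF G(1)])
  \<comment> \<open>The multiplier of the active constraints: a vector orthogonal to their common kernel is a combination of their rows.\<close>
  define z1 where "z1 = diag_ind I *v adjoint G \<rho>"
  have "transpose K *v z1 = \<rho>"
  proof (rule vector_eq_rdot[THEN iffD1], intro allI)
    fix d
    have diag: "inner (diag_ind I *v x) x' = inner x (diag_ind I *v x')" for x x' :: "real^'m"
      by (simp add: inner_vec_def diag_ind_nth if_distrib if_distribR cong: if_cong)
    have "inner (transpose K *v z1) d = inner z1 (K *v d)" by (simp add: dot_lmul_matrix)
    also have "\<dots> = inner (adjoint G \<rho>) (diag_ind I *v (K *v d))" by (simp add: z1_def diag)
    also have "\<dots> = inner \<rho> (G (diag_ind I *v (K *v d)))"
      using adjoint_works[OF linG, of "diag_ind I *v (K *v d)" \<rho>] by (simp add: inner_commute)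
    finally have "inner (transpose K *v z1) d = inner \<rho> (G (diag_ind I *v (K *v d)))" .
    moreover have "inner \<rho> (d - G (diag_ind I *v (K *v d))) = 0"
    proof (rule \<rho>)
      fix i assume i: "i \<in> I"
      then have "i \<noteq> j" using I by auto
      then show "(K *v (d - G (diag_ind I *v (K *v d)))) $ i = 0"
        using i by (simp add: matrix_vector_mult_diff_distrib G(2) diag_ind_nth)
    qed
    ultimately show "inner (transpose K *v z1) d = inner \<rho> d" by (simp add: inner_diff_right)
  qed
  then have eq1: "g1 (b0 + b, y) + transpose K *v (z0 + z1) = r1"
    by (simp add: \<rho>_def matrix_vector_right_distrib)
  have eq4: "diag_ind I *v (K *v (b0 + b)) - diag_ind (- I) *v (z0 + z1) = r4"
  proof (rule vec_eq_iff[THEN iffD2], intro allI)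
    fix i
    show "(diag_ind I *v (K *v (b0 + b)) - diag_ind (- I) *v (z0 + z1)) $ i = r4 $ i"
    proof (cases "i \<in> I")
      case True
      then have "i \<noteq> j" using I by auto
      then show ?thesis using True b by (simp add: diag_ind_nth matrix_vector_right_distrib b0_def G(2))
    qed (simp add: diag_ind_nth z0_def z1_def)
  qed
  have "newton_op K \<sigma> I \<pi> g1 g2 (b0 + b, y, r3 + w, z0 + z1, p) = (r1, r2, r3, r4, r5)"
  proof -
    have "w = \<pi> (B' p) /\<^sub>R \<sigma>" using control \<sigma> by (metis divideR_right less_irrefl)
    moreover have "A y - B (r3 + w) = r5"
      using y0 w r(2) by (simp add: y_def bounded_linear_onD[OF A] bounded_linear_onD[OF B] Sc_in A_Sc)
    ultimately show ?thesis using eq1 eq4 p(2) by (simp add: newton_op_def)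
  qed
  moreover have "(b0 + b, y, r3 + w, z0 + z1, p) \<in> UNIV \<times> H \<times> U \<times> UNIV \<times> H"
    using y p w r(2) U(1) by (simp add: subspace_add)
  ultimately show ?thesis by blast
qed

lemma newton_op_diff:
  assumes g: "\<And>w w'. g1 (w - w') = g1 w - g1 w'" "\<And>w w'. g2 (w - w') = g2 w - g2 w'"
    and cut: "cutoff \<pi>"
    and st: "s \<in> UNIV \<times> H \<times> U \<times> UNIV \<times> H" "t \<in> UNIV \<times> H \<times> U \<times> UNIV \<times> H"
  shows "newton_op K \<sigma> I \<pi> g1 g2 (s - t) = newton_op K \<sigma> I \<pi> g1 g2 s - newton_op K \<sigma> I \<pi> g1 g2 t"
proof -
  obtain b y u z p where s: "s = (b, y, u, z, p)" by (metis prod_cases5)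
  obtain b' y' u' z' p' where t: "t = (b', y', u', z', p')" by (metis prod_cases5)
  have mem: "y \<in> H" "y' \<in> H" "u \<in> U" "u' \<in> U" using st by (auto simp: s t)
  have "g1 (b - b', y - y') = g1 (b, y) - g1 (b', y')" "g2 (b - b', y - y') = g2 (b, y) - g2 (b', y')"
    using g[of "(b, y)" "(b', y')"] by simp_all
  moreover have "A' (p - p') = A' p - A' p'" by (rule linear_diff[OF bounded_linear.linear[OF bounded_linear_A']])
  moreover have "\<pi> (B' (p - p')) = \<pi> (B' p) - \<pi> (B' p')"
    using cut by (simp add: cutoff_def linear_diff[OF bounded_linear.linear] bounded_linear_B')
  moreover have "A (y - y') = A y - A y'" "B (u - u') = B u - B u'"
    using mem by (simp_all add: bounded_linear_on_diff[OF A H(1)] bounded_linear_on_diff[OF B U(1)])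
  ultimately show ?thesis
    by (simp add: newton_op_def s t matrix_vector_mult_diff_distrib scaleR_diff_right del: transpose_matrix_vector)
qed

end

section \<open>Newton derivatives\<close>

text \<open>Derivatives at the moving point \<open>x\<close> instead of \<open>a\<close>, as needed for semismooth functions.  Dividing by
  \<open>norm (x - a)\<close> turns both conditions into statements on bounded functions and null functions; a product of
  one of each is a null function.  The first condition makes \<open>f\<close> Lipschitz at \<open>a\<close>, as the product rule requires.\<close>

definition newton_diff ::
  "('a::real_normed_vector \<Rightarrow> 'b::real_normed_vector) \<Rightarrow> ('a \<Rightarrow> 'a \<Rightarrow> 'b) \<Rightarrow> 'a \<Rightarrow> 'a set \<Rightarrow> bool" where
  "newton_diff f f' a X \<longleftrightarrow>
     Bfun (\<lambda>x. f' x (x - a) /\<^sub>R norm (x - a)) (at a within X) \<and>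
     Zfun (\<lambda>x. (f x - f a - f' x (x - a)) /\<^sub>R norm (x - a)) (at a within X)"

lemma norm_quotient_le_iff: "0 < n \<Longrightarrow> norm (v /\<^sub>R n) \<le> K \<longleftrightarrow> norm v \<le> K * n"
  and norm_quotient_less_iff: "0 < n \<Longrightarrow> norm (v /\<^sub>R n) < K \<longleftrightarrow> norm v < K * n"
proof -
  assume n: "0 < n"
  have "norm (v /\<^sub>R n) = norm v / n" using n by (simp add: divide_inverse mult.commute)
  then show "norm (v /\<^sub>R n) \<le> K \<longleftrightarrow> norm v \<le> K * n" "norm (v /\<^sub>R n) < K \<longleftrightarrow> norm v < K * n"
    using n by (simp_all only: pos_divide_le_eq pos_divide_less_eq)
qed

lemma Bfun_add:
  fixes f g :: "'a \<Rightarrow> 'b::real_normed_vector"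
  assumes "Bfun f F" "Bfun g F"
  shows "Bfun (\<lambda>x. f x + g x) F"
proof -
  obtain K L where "eventually (\<lambda>x. norm (f x) \<le> K) F" "eventually (\<lambda>x. norm (g x) \<le> L) F"
    using assms by (auto elim!: BfunE)
  then have "eventually (\<lambda>x. norm (f x + g x) \<le> K + L) F"
    by eventually_elim (rule norm_triangle_mono)
  then show ?thesis by (rule BfunI)
qed

lemma Zfun_imp_Bfun: "Zfun f F \<Longrightarrow> Bfun f F"
  using ZfunD[of f F 1] by (auto intro!: BfunI[of _ 1] elim: eventually_mono)

lemma newton_diff_quotient_Bfun:
  assumes "newton_diff f f' a X"
  shows "Bfun (\<lambda>x. (f x - f a) /\<^sub>R norm (x - a)) (at a within X)"
proof -
  have "Bfun (\<lambda>x. f' x (x - a) /\<^sub>R norm (x - a)) (at a within X)"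
    and "Zfun (\<lambda>x. (f x - f a - f' x (x - a)) /\<^sub>R norm (x - a)) (at a within X)"
    using assms by (auto simp: newton_diff_def)
  from Bfun_add[OF this(1) Zfun_imp_Bfun[OF this(2)]] show ?thesis by (simp flip: scaleR_add_right)
qed

lemma newton_diff_Zfun:
  assumes "newton_diff f f' a X"
  shows "Zfun (\<lambda>x. f x - f a) (at a within X)"
proof -
  have "((\<lambda>x. norm (x - a)) \<longlongrightarrow> norm (a - a)) (at a within X)" by (intro tendsto_intros)
  then have "Zfun (\<lambda>x. norm (x - a)) (at a within X)" by (simp add: tendsto_Zfun_iff)
  then have "Zfun (\<lambda>x. norm (x - a) *\<^sub>R ((f x - f a) /\<^sub>R norm (x - a))) (at a within X)"
    by (rule bounded_bilinear.Zfun_prod_Bfun[OF bounded_bilinear_scaleR _ newton_diff_quotient_Bfun[OF assms]])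
  then show ?thesis
    by (rule Zfun_imp_Zfun[where K=1]) (auto simp: eventually_at_filter)
qed

lemma newton_diff_Bfun: "newton_diff f f' a X \<Longrightarrow> Bfun f (at a within X)"
  using Bfun_add[OF Zfun_imp_Bfun[OF newton_diff_Zfun] Bfun_const, of f f' a X "f a"] by simp

lemma newton_diff_tendsto: "newton_diff f f' a X \<Longrightarrow> (f \<longlongrightarrow> f a) (at a within X)"
  using newton_diff_Zfun by (simp add: tendsto_Zfun_iff)

lemma newton_diff_const: "newton_diff (\<lambda>x. c) (\<lambda>x d. 0) a X"
  by (simp add: newton_diff_def Zfun_zero)

lemma newton_diff_bounded_linear_on:
  assumes f: "bounded_linear_on S f" and S: "subspace S" "X \<subseteq> S" "a \<in> S"
  shows "newton_diff f (\<lambda>x. f) a X"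
proof -
  obtain K where K: "0 < K" "\<And>x. x \<in> S \<Longrightarrow> norm (f x) \<le> K * norm x"
    using bounded_linear_on_bound[OF f] by blast
  have diff: "f (x - a) = f x - f a" if "x \<in> X" for x
    by (rule bounded_linear_on_diff[OF f S(1)]) (use that S in auto)
  have ev: "\<forall>\<^sub>F x in at a within X. x \<in> X \<and> x \<noteq> a" by (simp add: eventually_at_filter)
  have "Bfun (\<lambda>x. f (x - a) /\<^sub>R norm (x - a)) (at a within X)"
  proof (rule BfunI)
    show "\<forall>\<^sub>F x in at a within X. norm (f (x - a) /\<^sub>R norm (x - a)) \<le> K"
      using ev
    proof eventually_elim
      case (elim x)
      then have "norm (f (x - a)) \<le> K * norm (x - a)" using K(2) S by (auto intro: subspace_diff)
      then show ?case using elim by (subst norm_quotient_le_iff) auto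
    qed
  qed
  moreover have "Zfun (\<lambda>x. (f x - f a - f (x - a)) /\<^sub>R norm (x - a)) (at a within X)"
    by (rule Zfun_imp_Zfun[OF Zfun_zero, where K=1], rule eventually_mono[OF ev]) (simp add: diff)
  ultimately show ?thesis by (simp add: newton_diff_def)
qed

lemma newton_diff_add:
  assumes "newton_diff f f' a X" "newton_diff g g' a X"
  shows "newton_diff (\<lambda>x. f x + g x) (\<lambda>x d. f' x d + g' x d) a X"
proof -
  have "Bfun (\<lambda>x. f' x (x - a) /\<^sub>R norm (x - a) + g' x (x - a) /\<^sub>R norm (x - a)) (at a within X)"
    using assms by (intro Bfun_add) (auto simp: newton_diff_def)
  moreover have "Zfun (\<lambda>x. (f x - f a - f' x (x - a)) /\<^sub>R norm (x - a) + (g x - g a - g' x (x - a)) /\<^sub>R norm (x - a)) (at a within X)"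
    using assms by (intro Zfun_add) (auto simp: newton_diff_def)
  ultimately show ?thesis
    unfolding newton_diff_def by (simp add: algebra_simps flip: scaleR_add_right)
qed

lemma newton_diff_compose_linear:
  assumes h: "bounded_linear h" and f: "newton_diff f f' a X"
  shows "newton_diff (\<lambda>x. h (f x)) (\<lambda>x d. h (f' x d)) a X"
proof -
  have "Bfun (\<lambda>x. h (f' x (x - a) /\<^sub>R norm (x - a))) (at a within X)"
  proof -
    obtain B where "eventually (\<lambda>x. norm (f' x (x - a) /\<^sub>R norm (x - a)) \<le> B) (at a within X)"
      using f by (auto simp: newton_diff_def elim!: BfunE)
    moreover obtain K where K: "0 < K" "\<And>x. norm (h x) \<le> norm x * K"
      using bounded_linear.pos_bounded[OF h] by blast
    ultimately have "eventually (\<lambda>x. norm (h (f' x (x - a) /\<^sub>R norm (x - a))) \<le> B * K) (at a within X)"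
      by (elim eventually_mono) (rule order_trans[OF K(2) mult_right_mono[OF _ less_imp_le[OF K(1)]]])
    then show ?thesis by (rule BfunI)
  qed
  moreover have "Zfun (\<lambda>x. h ((f x - f a - f' x (x - a)) /\<^sub>R norm (x - a))) (at a within X)"
    using f by (intro bounded_linear.Zfun[OF h]) (simp add: newton_diff_def)
  ultimately show ?thesis
    unfolding newton_diff_def
    by (simp add: linear_diff[OF bounded_linear.linear[OF h]] linear_scale[OF bounded_linear.linear[OF h]])
qed

lemma newton_diff_sum:
  assumes "\<And>i. i \<in> I \<Longrightarrow> newton_diff (f i) (f' i) a X"
  shows "newton_diff (\<lambda>x. \<Sum>i\<in>I. f i x) (\<lambda>x d. \<Sum>i\<in>I. f' i x d) a X"
  using assms
  by (induction I rule: infinite_finite_induct) (auto intro: newton_diff_const newton_diff_add)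

lemma Bfun_bilinear:
  assumes "bounded_bilinear P" "Bfun u F" "Bfun v F"
  shows "Bfun (\<lambda>x. P (u x) (v x)) F"
proof -
  obtain K where K: "0 < K" "\<And>a b. norm (P a b) \<le> norm a * norm b * K"
    using bounded_bilinear.pos_bounded[OF assms(1)] by blast
  obtain U V where UV: "0 < U" "eventually (\<lambda>x. norm (u x) \<le> U) F" "eventually (\<lambda>x. norm (v x) \<le> V) F"
    using assms(2,3) by (auto elim!: BfunE)
  from UV(2,3) have "eventually (\<lambda>x. norm (P (u x) (v x)) \<le> U * V * K) F"
  proof eventually_elim
    case (elim x)
    have "norm (u x) * norm (v x) \<le> U * V" using elim UV(1) by (intro mult_mono) auto
    then have "norm (u x) * norm (v x) * K \<le> U * V * K" using K(1) by (simp add: mult_right_mono)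
    with K(2)[of "u x" "v x"] show ?case by linarith
  qed
  then show ?thesis by (rule BfunI)
qed

text \<open>The remainder of the product is \<open>P f \<rho>_g + P \<rho>_f g - P (f - f a) (g - g a)\<close>, where \<open>\<rho>\<close> denotes the
  remainders of the factors; the last term is of second order.\<close>

lemma newton_diff_bilinear:
  assumes P: "bounded_bilinear P"
    and f: "newton_diff f f' a X" and g: "newton_diff g g' a X"
  shows "newton_diff (\<lambda>x. P (f x) (g x)) (\<lambda>x d. P (f x) (g' x d) + P (f' x d) (g x)) a X"
proof -
  interpret P: bounded_bilinear P by (rule P)
  let ?n = "\<lambda>v x. v /\<^sub>R norm (x - a)"
  let ?\<rho> = "\<lambda>f f' x. f x - f a - f' x (x - a)"
  note bil = P.add_left P.add_right P.diff_left P.diff_right P.scaleR_left P.scaleR_right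
  have fB: "Bfun (\<lambda>x. ?n (f' x (x - a)) x) (at a within X)" and fZ: "Zfun (\<lambda>x. ?n (?\<rho> f f' x) x) (at a within X)"
    using f by (auto simp: newton_diff_def)
  have gB: "Bfun (\<lambda>x. ?n (g' x (x - a)) x) (at a within X)" and gZ: "Zfun (\<lambda>x. ?n (?\<rho> g g' x) x) (at a within X)"
    using g by (auto simp: newton_diff_def)
  have "Bfun (\<lambda>x. P (f x) (?n (g' x (x - a)) x) + P (?n (f' x (x - a)) x) (g x)) (at a within X)"
    by (intro Bfun_add Bfun_bilinear[OF P] fB gB newton_diff_Bfun[OF f] newton_diff_Bfun[OF g])
  moreover have "Zfun (\<lambda>x. P (f x) (?n (?\<rho> g g' x) x) + P (?n (?\<rho> f f' x) x) (g x)
      - P (?n (f x - f a) x) (g x - g a)) (at a within X)"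
    by (intro Zfun_add Zfun_diff P.Bfun_prod_Zfun[OF newton_diff_Bfun[OF f] gZ]
        P.Zfun_prod_Bfun[OF fZ newton_diff_Bfun[OF g]]
        P.Bfun_prod_Zfun[OF newton_diff_quotient_Bfun[OF f] newton_diff_Zfun[OF g]])
  moreover have "P (f x) (?n (?\<rho> g g' x) x) + P (?n (?\<rho> f f' x) x) (g x) - P (?n (f x - f a) x) (g x - g a)
      = ?n (P (f x) (g x) - P (f a) (g a) - (P (f x) (g' x (x - a)) + P (f' x (x - a)) (g x))) x" for x
    by (simp add: bil scaleR_diff_right scaleR_add_right)
  ultimately show ?thesis
    unfolding newton_diff_def by (simp add: bil scaleR_add_right)
qed

text \<open>The remainder of \<open>1 / f\<close> is that of \<open>f\<close> times \<open>- 1 / f^2\<close>, plus \<open>(1 / f - 1 / f a) * (f - f a) / f\<close>,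
  which is of second order.\<close>

lemma newton_diff_inverse:
  fixes f :: "'a::real_normed_vector \<Rightarrow> real"
  assumes f: "newton_diff f f' a X" and a: "f a \<noteq> 0"
  shows "newton_diff (\<lambda>x. inverse (f x)) (\<lambda>x d. - (inverse (f x) * inverse (f x)) * f' x d) a X"
proof -
  let ?n = "\<lambda>v x. v /\<^sub>R norm (x - a)"
  let ?\<rho> = "\<lambda>x. f x - f a - f' x (x - a)"
  have fB: "Bfun (\<lambda>x. ?n (f' x (x - a)) x) (at a within X)" and fZ: "Zfun (\<lambda>x. ?n (?\<rho> x) x) (at a within X)"
    using f by (auto simp: newton_diff_def)
  have lim: "((\<lambda>x. inverse (f x)) \<longlongrightarrow> inverse (f a)) (at a within X)"
    by (intro tendsto_intros newton_diff_tendsto[OF f] a)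
  have iZ: "Zfun (\<lambda>x. inverse (f x) - inverse (f a)) (at a within X)"
    using lim by (simp add: tendsto_Zfun_iff)
  have iB: "Bfun (\<lambda>x. inverse (f x)) (at a within X)"
    by (rule Bfun_inverse[OF newton_diff_tendsto[OF f] a])
  note bb = Bfun_bilinear[OF bounded_bilinear_mult]
  have i2B: "Bfun (\<lambda>x. - (inverse (f x) * inverse (f x))) (at a within X)"
    using bb[OF iB iB] by (simp add: Bfun_def)
  have B': "Bfun (\<lambda>x. - (inverse (f x) * inverse (f x)) * ?n (f' x (x - a)) x) (at a within X)"
    by (rule bb[OF i2B fB])
  have Z: "Zfun (\<lambda>x. - (inverse (f x) * inverse (f x)) * ?n (?\<rho> x) x
      + (inverse (f x) - inverse (f a)) * (inverse (f x) * ?n (f x - f a) x)) (at a within X)"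
    by (intro Zfun_add bounded_bilinear.Bfun_prod_Zfun[OF bounded_bilinear_mult i2B fZ]
        bounded_bilinear.Zfun_prod_Bfun[OF bounded_bilinear_mult iZ] bb iB newton_diff_quotient_Bfun[OF f])
  have ev: "\<forall>\<^sub>F x in at a within X.
      - (inverse (f x) * inverse (f x)) * ?n (?\<rho> x) x + (inverse (f x) - inverse (f a)) * (inverse (f x) * ?n (f x - f a) x)
      = ?n (inverse (f x) - inverse (f a) - - (inverse (f x) * inverse (f x)) * f' x (x - a)) x"
  proof -
    have "\<forall>\<^sub>F x in at a within X. f x \<noteq> 0" by (rule tendsto_imp_eventually_ne[OF newton_diff_tendsto[OF f] a])
    then show ?thesis
    proof eventually_elim
      case (elim x)
      have "inverse (f x) - inverse (f a) + inverse (f x) * inverse (f x) * (f x - f a)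
          = (inverse (f x) - inverse (f a)) * (inverse (f x) * (f x - f a))"
        using elim a by (simp add: field_simps)
      then have eq: "- (inverse (f x) * inverse (f x)) * ?\<rho> x + (inverse (f x) - inverse (f a)) * (inverse (f x) * (f x - f a))
          = inverse (f x) - inverse (f a) - - (inverse (f x) * inverse (f x)) * f' x (x - a)"
        by (simp add: algebra_simps)
      have "- (inverse (f x) * inverse (f x)) * ?n (?\<rho> x) x + (inverse (f x) - inverse (f a)) * (inverse (f x) * ?n (f x - f a) x)
          = ?n (- (inverse (f x) * inverse (f x)) * ?\<rho> x + (inverse (f x) - inverse (f a)) * (inverse (f x) * (f x - f a))) x"
        unfolding real_scaleR_def distrib_left by (simp only: mult_ac)
      then show ?case unfolding eq .
    qed
  qed
  have "Zfun (\<lambda>x. ?n (inverse (f x) - inverse (f a) - - (inverse (f x) * inverse (f x)) * f' x (x - a)) x)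
      (at a within X)"
    by (rule Zfun_imp_Zfun[OF Z, where K=1], rule eventually_mono[OF ev]) (simp only: mult_1_right)
  moreover have "(\<lambda>x. - (inverse (f x) * inverse (f x)) * ?n (f' x (x - a)) x)
      = (\<lambda>x. ?n (- (inverse (f x) * inverse (f x)) * f' x (x - a)) x)"
    by (rule ext) (simp add: mult_ac)
  note B'[unfolded this]
  ultimately show ?thesis unfolding newton_diff_def by (intro conjI)
qed

lemma newton_diff_Pair:
  assumes f: "newton_diff f f' a X" and g: "newton_diff g g' a X"
  shows "newton_diff (\<lambda>x. (f x, g x)) (\<lambda>x d. (f' x d, g' x d)) a X"
proof -
  have "newton_diff (\<lambda>x. (f x, 0) + (0, g x)) (\<lambda>x d. (f' x d, 0) + (0, g' x d)) a X"
    by (intro newton_diff_add newton_diff_compose_linear[OF _ f] newton_diff_compose_linear[OF _ g]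
        bounded_linear_Pair bounded_linear_ident bounded_linear_zero)
  then show ?thesis by simp
qed

lemma newton_diff_cong:
  assumes f: "newton_diff f f' a X" and a: "f a = g a"
    and "\<forall>\<^sub>F x in at a within X. f x = g x \<and> f' x (x - a) = g' x (x - a)"
  shows "newton_diff g g' a X"
proof -
  have ev: "\<forall>\<^sub>F x in at a within X. f' x (x - a) /\<^sub>R norm (x - a) = g' x (x - a) /\<^sub>R norm (x - a) \<and>
     (f x - f a - f' x (x - a)) /\<^sub>R norm (x - a) = (g x - g a - g' x (x - a)) /\<^sub>R norm (x - a)"
    using assms(3) by eventually_elim (simp add: a)
  obtain K where "eventually (\<lambda>x. norm (f' x (x - a) /\<^sub>R norm (x - a)) \<le> K) (at a within X)"
    using f by (auto simp: newton_diff_def elim!: BfunE)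
  with ev have "eventually (\<lambda>x. norm (g' x (x - a) /\<^sub>R norm (x - a)) \<le> K) (at a within X)"
    by eventually_elim (elim conjE, simp only:)
  then have "Bfun (\<lambda>x. g' x (x - a) /\<^sub>R norm (x - a)) (at a within X)" by (rule BfunI)
  moreover have "Zfun (\<lambda>x. (g x - g a - g' x (x - a)) /\<^sub>R norm (x - a)) (at a within X)"
    using f unfolding newton_diff_def
    by (elim conjE, erule_tac Zfun_imp_Zfun[where K=1]) (use ev in \<open>auto elim!: eventually_mono\<close>)
  ultimately show ?thesis by (simp add: newton_diff_def)
qed

lemma newton_diff_remainder:
  assumes "newton_diff f f' a X" "0 < e"
  shows "\<forall>\<^sub>F x in at a within X. norm (f x - f a - f' x (x - a)) \<le> e * norm (x - a)"
proof -
  have "\<forall>\<^sub>F x in at a within X. x \<noteq> a" by (simp add: eventually_at_filter)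
  moreover have "\<forall>\<^sub>F x in at a within X. norm ((f x - f a - f' x (x - a)) /\<^sub>R norm (x - a)) < e"
    using assms by (auto simp: newton_diff_def dest: ZfunD)
  ultimately show ?thesis by eventually_elim (subst (asm) norm_quotient_less_iff, auto)
qed

lemma newton_diffI:
  assumes bd: "\<forall>\<^sub>F x in at a within X. norm (f' x (x - a)) \<le> L * norm (x - a)"
    and rem: "\<And>e. 0 < e \<Longrightarrow> \<forall>\<^sub>F x in at a within X. norm (f x - f a - f' x (x - a)) \<le> e * norm (x - a)"
  shows "newton_diff f f' a X"
proof -
  have ne: "\<forall>\<^sub>F x in at a within X. x \<noteq> a" by (simp add: eventually_at_filter)
  have "\<forall>\<^sub>F x in at a within X. norm (f' x (x - a) /\<^sub>R norm (x - a)) \<le> L"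
    using bd ne by eventually_elim (subst norm_quotient_le_iff, auto)
  moreover have "Zfun (\<lambda>x. (f x - f a - f' x (x - a)) /\<^sub>R norm (x - a)) (at a within X)"
  proof (rule ZfunI)
    fix e :: real assume e: "0 < e"
    show "\<forall>\<^sub>F x in at a within X. norm ((f x - f a - f' x (x - a)) /\<^sub>R norm (x - a)) < e"
      using rem[OF half_gt_zero[OF e]] ne
    proof eventually_elim
      case (elim x)
      then have "e / 2 * norm (x - a) < e * norm (x - a)" using e by simp
      with elim(1) have "norm (f x - f a - f' x (x - a)) < e * norm (x - a)" by (rule order.strict_trans1)
      then show ?case using elim(2) by (subst norm_quotient_less_iff) auto
    qed
  qed
  ultimately show ?thesis by (auto simp: newton_diff_def intro: BfunI)
qed

lemma vec_eq_sum_axis: "(x :: real^'n::finite) = (\<Sum>i\<in>UNIV. (x $ i) *\<^sub>R axis i 1)"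
  using basis_expansion[of x] by (simp add: scalar_mult_eq_scaleR)

lemma newton_diff_linear: "bounded_linear f \<Longrightarrow> newton_diff f (\<lambda>x. f) a X"
  by (rule newton_diff_bounded_linear_on[where S=UNIV])
    (auto intro: bounded_linear_imp_bounded_linear_on)

lemma newton_diff_diff:
  assumes "newton_diff f f' a X" "newton_diff g g' a X"
  shows "newton_diff (\<lambda>x. f x - g x) (\<lambda>x d. f' x d - g' x d) a X"
  using newton_diff_add[OF assms(1) newton_diff_compose_linear[OF bounded_linear_minus[OF bounded_linear_ident] assms(2)]]
  by simp

lemma newton_diff_vec:
  fixes f :: "'a::real_normed_vector \<Rightarrow> real^'n::finite"
  assumes "\<And>i. newton_diff (\<lambda>x. f x $ i) (\<lambda>x d. f' x d $ i) a X"
  shows "newton_diff f f' a X"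
proof -
  have "newton_diff (\<lambda>x. \<Sum>i\<in>UNIV. (f x $ i) *\<^sub>R axis i (1::real)) (\<lambda>x d. \<Sum>i\<in>UNIV. (f' x d $ i) *\<^sub>R axis i 1) a X"
    by (intro newton_diff_sum newton_diff_compose_linear[OF bounded_linear_scaleR_left] assms)
  then show ?thesis by (simp flip: vec_eq_sum_axis)
qed

text \<open>Near \<open>a\<close> the larger function at \<open>x\<close> is also a largest one at \<open>a\<close>, so the remainder of the maximum is that of
  the selected function.\<close>

lemma newton_diff_max:
  fixes f g :: "'a::real_normed_vector \<Rightarrow> real"
  assumes f: "newton_diff f f' a X" and g: "newton_diff g g' a X"
  shows "newton_diff (\<lambda>x. max (f x) (g x)) (\<lambda>x d. if g x \<le> f x then f' x d else g' x d) a X"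
proof -
  obtain L1 L2 where "\<forall>\<^sub>F x in at a within X. norm (f' x (x - a) /\<^sub>R norm (x - a)) \<le> L1"
    "\<forall>\<^sub>F x in at a within X. norm (g' x (x - a) /\<^sub>R norm (x - a)) \<le> L2"
    using f g by (auto simp: newton_diff_def elim!: BfunE)
  moreover have ne: "\<forall>\<^sub>F x in at a within X. 0 < norm (x - a)" by (simp add: eventually_at_filter)
  ultimately have bd: "\<forall>\<^sub>F x in at a within X. norm (if g x \<le> f x then f' x (x - a) else g' x (x - a)) \<le> max L1 L2 * norm (x - a)"
  proof eventually_elim
    case (elim x)
    then have "norm (f' x (x - a)) \<le> L1 * norm (x - a)" "norm (g' x (x - a)) \<le> L2 * norm (x - a)"
      by (simp_all only: norm_quotient_le_iff)
    moreover have "L1 * norm (x - a) \<le> max L1 L2 * norm (x - a)" "L2 * norm (x - a) \<le> max L1 L2 * norm (x - a)"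
      by (intro mult_right_mono; simp)+
    ultimately show ?case by (auto intro: order_trans)
  qed
  have sel: "\<forall>\<^sub>F x in at a within X. (g x \<le> f x \<longrightarrow> max (f a) (g a) = f a) \<and> (\<not> g x \<le> f x \<longrightarrow> max (f a) (g a) = g a)"
  proof (cases "f a" "g a" rule: linorder_cases)
    case less
    have "\<forall>\<^sub>F x in at a within X. f x < g x"
      using order_tendstoD(1)[OF tendsto_diff[OF newton_diff_tendsto[OF g] newton_diff_tendsto[OF f]], of 0] less
      by simp
    then show ?thesis by eventually_elim (use less in auto)
  next
    case greater
    have "\<forall>\<^sub>F x in at a within X. g x < f x"
      using order_tendstoD(1)[OF tendsto_diff[OF newton_diff_tendsto[OF f] newton_diff_tendsto[OF g]], of 0] greater
      by simp
    then show ?thesis by eventually_elim (use greater in auto)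
  qed simp
  show ?thesis
  proof (rule newton_diffI[where f'="\<lambda>x d. if g x \<le> f x then f' x d else g' x d", OF bd])
    fix e :: real assume e: "0 < e"
    from newton_diff_remainder[OF f e] newton_diff_remainder[OF g e] sel
    show "\<forall>\<^sub>F x in at a within X. norm (max (f x) (g x) - max (f a) (g a) - (if g x \<le> f x then f' x (x - a) else g' x (x - a))) \<le> e * norm (x - a)"
    proof eventually_elim
      case (elim x)
      then show ?case by (cases "g x \<le> f x") (simp_all add: max_def)
    qed
  qed
qed

section \<open>Local superlinear convergence\<close>

definition newton_iteration :: "'a set \<Rightarrow> 'a set \<Rightarrow> ('a::real_normed_vector \<Rightarrow> 'b::real_normed_vector) \<Rightarrow>
    ('a \<Rightarrow> 'a \<Rightarrow> 'b) \<Rightarrow> (nat \<Rightarrow> 'a) \<Rightarrow> bool" where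
  "newton_iteration X S W W' x \<longleftrightarrow> (\<forall>i. x i \<in> X \<and>
     (if W (x i) = 0 then x (Suc i) = x i
      else (\<exists>!s. s \<in> S \<and> W' (x i) s = - W (x i)) \<and>
           (\<exists>s\<in>S. W' (x i) s = - W (x i) \<and> x (Suc i) = x i + s)))"

text \<open>For a solution \<open>s\<close> of the Newton equation, \<open>W' x (s + (x - a)) = - rem x\<close>.  The regularity bound \<open>M\<close> turns
  this into \<open>norm (x + s - a) \<le> M * norm (rem x)\<close>, which is at most half of \<open>norm (x - a)\<close> near \<open>a\<close>, so
  that the iterates stay near \<open>a\<close>, and of smaller order as they approach \<open>a\<close>.  The same bound shows that
  \<open>a\<close> is the only zero of \<open>W\<close> nearby.\<close>

theorem local_superlinear_newton:
  fixes W :: "'a::real_normed_vector \<Rightarrow> 'b::real_normed_vector"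
  assumes S: "subspace S" and X: "X \<subseteq> S" "a \<in> X" and root: "W a = 0"
    and nbhd: "0 < r" "\<And>x. x \<in> S \<Longrightarrow> dist x a < r \<Longrightarrow> x \<in> X"
    and diff: "newton_diff W W' a X"
    and lin: "\<And>x s t. x \<in> X \<Longrightarrow> s \<in> S \<Longrightarrow> t \<in> S \<Longrightarrow> W' x (s - t) = W' x s - W' x t"
    and M: "0 < M"
    and reg: "\<forall>\<^sub>F x in at a within X. (\<forall>s\<in>S. norm s \<le> M * norm (W' x s)) \<and> (\<exists>s\<in>S. W' x s = - W x)"
  shows "\<exists>V. open V \<and> a \<in> V \<and> (\<forall>x0\<in>V \<inter> X. \<exists>x. x 0 = x0 \<and> newton_iteration X S W W' x \<and>
     ((\<exists>i. (\<forall>j<i. W (x j) \<noteq> 0) \<and> W (x i) = 0 \<and> x i = a) \<or>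
      ((\<forall>i. W (x i) \<noteq> 0) \<and> q_superlinear x a)))"
proof -
  define rem where "rem x = W x - W a - W' x (x - a)" for x
  have "\<forall>\<^sub>F x in at a within X. (\<forall>s\<in>S. norm s \<le> M * norm (W' x s)) \<and> (\<exists>s\<in>S. W' x s = - W x) \<and>
      norm (rem x) \<le> 1 / (2 * M) * norm (x - a)"
    using reg newton_diff_remainder[OF diff, of "1 / (2 * M)"] M
    unfolding rem_def[symmetric] by (auto elim: eventually_elim2)
  then obtain d0 where d0: "0 < d0" "\<And>x. x \<in> X \<Longrightarrow> x \<noteq> a \<Longrightarrow> dist x a < d0 \<Longrightarrow>
      (\<forall>s\<in>S. norm s \<le> M * norm (W' x s)) \<and> (\<exists>s\<in>S. W' x s = - W x) \<and> norm (rem x) \<le> 1 / (2 * M) * norm (x - a)"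
    by (auto simp: eventually_at)
  define d where "d = min d0 r"
  have d: "0 < d" using d0 nbhd by (simp add: d_def)
  have W'0: "W' x 0 = 0" if "x \<in> X" for x
    using lin[OF that subspace_0[OF S] subspace_0[OF S]] by simp
  have W'add: "W' x (s + t) = W' x s + W' x t" if "x \<in> X" "s \<in> S" "t \<in> S" for x s t
    using lin[OF that(1) that(2) subspace_neg[OF S that(3)]] lin[OF that(1) subspace_0[OF S] that(3)]
      W'0[OF that(1)] by simp
  have M_rem: "M * norm (rem x) \<le> 1 / 2 * norm (x - a)" if "x \<in> X" "x \<noteq> a" "dist x a < d" for x
  proof -
    have "M * norm (rem x) \<le> M * (1 / (2 * M) * norm (x - a))"
      using d0(2)[OF that(1,2)] that(3) M by (intro mult_left_mono) (auto simp: d_def)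
    then show ?thesis using M by simp
  qed
  have zero: "x = a" if "x \<in> X" "dist x a < d" "W x = 0" for x
  proof (rule ccontr)
    assume ne: "x \<noteq> a"
    have "x - a \<in> S" using that(1) X S by (auto intro: subspace_diff)
    then have "norm (x - a) \<le> M * norm (W' x (x - a))"
      using d0(2)[OF that(1) ne] that(2) by (auto simp: d_def)
    also have "norm (W' x (x - a)) = norm (rem x)" by (simp add: rem_def that(3) root)
    also have "M * norm (rem x) \<le> 1 / 2 * norm (x - a)" using M_rem[OF that(1) ne that(2)] .
    finally show False using ne by simp
  qed
  define step where "step x = (if W x = 0 then x else x + (SOME s. s \<in> S \<and> W' x s = - W x))" for x
  have step: "(\<exists>!s. s \<in> S \<and> W' x s = - W x) \<and> (\<exists>s\<in>S. W' x s = - W x \<and> step x = x + s) \<and> step x \<in> X \<and>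
      norm (step x - a) \<le> M * norm (rem x) \<and> norm (step x - a) \<le> 1 / 2 * norm (x - a)"
    if x: "x \<in> X" "dist x a < d" "W x \<noteq> 0" for x
  proof -
    have ne: "x \<noteq> a" using x(3) root by auto
    have bd: "\<And>s. s \<in> S \<Longrightarrow> norm s \<le> M * norm (W' x s)" and ex: "\<exists>s\<in>S. W' x s = - W x"
      using d0(2)[OF x(1) ne] x(2) by (auto simp: d_def)
    define s where "s = (SOME s. s \<in> S \<and> W' x s = - W x)"
    have s: "s \<in> S" "W' x s = - W x" using someI_ex[of "\<lambda>s. s \<in> S \<and> W' x s = - W x"] ex by (auto simp: s_def)
    have uniq: "t = s" if "t \<in> S" "W' x t = - W x" for t
    proof -
      have "norm (t - s) \<le> M * norm (W' x (t - s))" by (rule bd) (use that s S in \<open>auto intro: subspace_diff\<close>)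
      then show ?thesis using lin[OF x(1) that(1) s(1)] that s by simp
    qed
    have step_eq: "step x = x + s" using x(3) by (simp add: step_def s_def)
    have xa: "x - a \<in> S" using x(1) X S by (auto intro: subspace_diff)
    have "norm (s + (x - a)) \<le> M * norm (W' x (s + (x - a)))" by (rule bd) (use s xa S in \<open>auto intro: subspace_add\<close>)
    also have "W' x (s + (x - a)) = - rem x" using W'add[OF x(1) s(1) xa] s(2) by (simp add: rem_def root)
    finally have le: "norm (step x - a) \<le> M * norm (rem x)" by (simp add: step_eq algebra_simps)
    then have half: "norm (step x - a) \<le> 1 / 2 * norm (x - a)" using M_rem[OF x(1) ne x(2)] by linarith
    moreover have "norm (x - a) < r" using x(2) by (simp add: dist_norm d_def)
    ultimately have "dist (step x) a < r"
      using norm_ge_zero[of "x - a"] unfolding dist_norm by linarith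
    moreover have "step x \<in> S" unfolding step_eq using x(1) X s S by (auto intro: subspace_add)
    ultimately have "step x \<in> X" by (rule nbhd(2)[rotated])
    moreover have "\<exists>!s. s \<in> S \<and> W' x s = - W x"
      using s uniq by (intro ex1I[of _ s]) blast+
    moreover have "\<exists>s\<in>S. W' x s = - W x \<and> step x = x + s" using s step_eq by blast
    ultimately show ?thesis using le half by blast
  qed
  have "\<exists>x. x 0 = x0 \<and> newton_iteration X S W W' x \<and>
     ((\<exists>i. (\<forall>j<i. W (x j) \<noteq> 0) \<and> W (x i) = 0 \<and> x i = a) \<or>
      ((\<forall>i. W (x i) \<noteq> 0) \<and> q_superlinear x a))" if x0: "x0 \<in> ball a d \<inter> X" for x0
  proof -
    define x where "x i = (step ^^ i) x0" for i
    have x_0: "x 0 = x0" by (simp add: x_def)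
    have xS: "x (Suc i) = step (x i)" for i by (simp add: x_def)
    have stepX: "step y \<in> X \<and> norm (step y - a) \<le> norm (y - a)" if "y \<in> X" "dist y a < d" for y
    proof (cases "W y = 0")
      case False
      from step[OF that False] norm_ge_zero[of "y - a"] show ?thesis by linarith
    qed (use that in \<open>simp add: step_def\<close>)
    have x: "x i \<in> X \<and> dist (x i) a < d" for i
    proof (induction i)
      case 0
      then show ?case using x0 by (simp add: x_def dist_commute)
    next
      case (Suc i)
      then show ?case using stepX[of "x i"] by (auto simp: xS dist_norm)
    qed
    have run: "newton_iteration X S W W' x"
      unfolding newton_iteration_def
    proof
      fix i
      have "if W (x i) = 0 then x (Suc i) = x i
         else (\<exists>!s. s \<in> S \<and> W' (x i) s = - W (x i)) \<and>
              (\<exists>s\<in>S. W' (x i) s = - W (x i) \<and> x (Suc i) = x i + s)"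
      proof (cases "W (x i) = 0")
        case False
        from step[OF _ _ False] x[of i] show ?thesis using False unfolding xS by simp
      qed (simp add: xS step_def)
      with x[of i] show "x i \<in> X \<and> (if W (x i) = 0 then x (Suc i) = x i
         else (\<exists>!s. s \<in> S \<and> W' (x i) s = - W (x i)) \<and>
              (\<exists>s\<in>S. W' (x i) s = - W (x i) \<and> x (Suc i) = x i + s))" by blast
    qed
    have outcome: "(\<exists>i. (\<forall>j<i. W (x j) \<noteq> 0) \<and> W (x i) = 0 \<and> x i = a) \<or>
      ((\<forall>i. W (x i) \<noteq> 0) \<and> q_superlinear x a)"
    proof (cases "\<exists>i. W (x i) = 0")
      case True
      define i where "i = (LEAST i. W (x i) = 0)"
      have i: "W (x i) = 0" unfolding i_def by (rule LeastI_ex[OF True])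
      moreover have "\<forall>j<i. W (x j) \<noteq> 0" unfolding i_def using not_less_Least by blast
      moreover have "x i = a" using zero[of "x i"] x[of i] i by blast
      ultimately show ?thesis by blast
    next
      case False
      then have ne: "W (x i) \<noteq> 0" for i by blast
      then have xa: "x i \<noteq> a" for i using root by metis
      have "norm (x i - a) \<le> (1 / 2) ^ i * norm (x 0 - a)" for i
      proof (induction i)
        case (Suc i)
        have "norm (x (Suc i) - a) \<le> 1 / 2 * norm (x i - a)" using step[OF _ _ ne[of i]] x[of i] by (simp add: xS)
        with Suc show ?case by simp
      qed simp
      moreover have "(\<lambda>i. (1 / 2) ^ i * norm (x 0 - a)) \<longlonglongrightarrow> 0"
        by (intro tendsto_mult_left_zero LIMSEQ_power_zero) simp
      ultimately have "(\<lambda>i. x i - a) \<longlonglongrightarrow> 0"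
        by (metis (no_types, lifting) Lim_null_comparison always_eventually)
      then have lim: "x \<longlonglongrightarrow> a" by (rule LIM_zero_cancel)
      have flim: "filterlim x (at a within X) sequentially"
        using lim x xa by (simp add: filterlim_at)
      have "\<forall>\<^sub>F i in sequentially. norm (x (Suc i) - a) \<le> e * norm (x i - a)" if e: "0 < e" for e
      proof -
        have "\<forall>\<^sub>F y in at a within X. norm (rem y) \<le> e / M * norm (y - a)"
          using newton_diff_remainder[OF diff, of "e / M"] e M unfolding rem_def by simp
        then have "\<forall>\<^sub>F i in sequentially. norm (rem (x i)) \<le> e / M * norm (x i - a)"
          using flim by (auto simp: filterlim_iff)
        then show ?thesis
        proof eventually_elim
          case (elim i)
          have "norm (x (Suc i) - a) \<le> M * norm (rem (x i))" using step[OF _ _ ne[of i]] x[of i] by (simp add: xS)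
          also have "\<dots> \<le> M * (e / M * norm (x i - a))" using elim M by (intro mult_left_mono) auto
          also have "\<dots> = e * norm (x i - a)" using M by simp
          finally show ?case .
        qed
      qed
      with lim ne show ?thesis by (auto simp: q_superlinear_def)
    qed
    from x_0 run outcome show ?thesis by (intro exI[of _ x] conjI)
  qed
  then show ?thesis using d by (intro exI[of _ "ball a d"]) auto
qed

section \<open>The norm gap of the pointwise projection\<close>

definition L2_clip :: "'l L2 \<Rightarrow> 'l L2 \<Rightarrow> 'l L2 \<Rightarrow> 'l::finite L2" where
  "L2_clip l h w = L2_of (\<lambda>t. min (max (L2_fun w t) (L2_fun l t)) (L2_fun h t))"

lemma AE_L2_fun_clip:
  "AE t in lebesgue. L2_fun (L2_clip l h w) t = min (max (L2_fun w t) (L2_fun l t)) (L2_fun h t)"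
  unfolding L2_clip_def
proof (rule AE_L2_fun_L2_of, rule square_integrable_bound)
  let ?g = "\<lambda>t. \<bar>L2_fun w t\<bar> + (\<bar>L2_fun l t\<bar> + \<bar>L2_fun h t\<bar>)"
  have "square_integrable (\<lambda>t. \<bar>L2_fun u t\<bar>)" for u :: "'a L2"
    by (rule square_integrable_bound[OF square_integrable_L2_fun[of u]]) auto
  then show "square_integrable ?g" by (intro square_integrable_add)
  show "AE t in lebesgue. \<bar>min (max (L2_fun w t) (L2_fun l t)) (L2_fun h t)\<bar> \<le> \<bar>?g t\<bar>"
    by (rule AE_I2) (auto simp: min_def max_def abs_if)
qed measurable

text \<open>If no bound other than \<open>w0\<close> itself lies between \<open>w0\<close> and \<open>w\<close>, \<open>w\<close> included, the projection is affine from \<open>w0\<close> to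
  \<open>w\<close> with the selected slope, and the remainder vanishes.  In any case the difference quotient of the projection and the
  selected slope both lie in \<open>[0, 1]\<close>.\<close>

lemma abs_clip_remainder_le:
  fixes lo hi w w0 :: real
  assumes "lo \<le> hi"
  shows "\<bar>min (max w lo) hi - min (max w0 lo) hi - (if lo \<le> w \<and> w \<le> hi then w - w0 else 0)\<bar>
    \<le> (if 0 < \<bar>w0 - lo\<bar> \<and> \<bar>w0 - lo\<bar> \<le> \<bar>w - w0\<bar> \<or> 0 < \<bar>w0 - hi\<bar> \<and> \<bar>w0 - hi\<bar> \<le> \<bar>w - w0\<bar>
       then \<bar>w - w0\<bar> else 0)"
  using assms by (auto simp: min_def max_def abs_if)

lemma L2_norm_ge_measure:
  fixes w :: "'l::finite L2"
  assumes \<Omega>: "\<Omega> \<in> lmeasurable" and \<delta>: "0 < \<delta>"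
  shows "\<delta>\<^sup>2 * measure lebesgue {t \<in> \<Omega>. \<delta> \<le> \<bar>L2_fun w t\<bar>} \<le> (norm w)\<^sup>2"
proof -
  let ?E = "{t \<in> \<Omega>. \<delta> \<le> \<bar>L2_fun w t\<bar>}"
  have [measurable]: "\<Omega> \<in> sets lebesgue" using \<Omega> by (rule fmeasurableD)
  have "?E = \<Omega> \<inter> {t \<in> space lebesgue. \<delta> \<le> \<bar>L2_fun w t\<bar>}" by auto
  also have "\<dots> \<in> lmeasurable" by (rule fmeasurable_Int_fmeasurable[OF \<Omega>]) measurable
  finally have E: "?E \<in> lmeasurable" .
  have "\<delta>\<^sup>2 * measure lebesgue ?E = (LINT t|lebesgue. \<delta>\<^sup>2 * indicator ?E t)"
    using E by (simp add: fmeasurable_def)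
  also have "\<dots> \<le> (LINT t|lebesgue. (L2_fun w t)\<^sup>2)"
  proof (rule integral_mono)
    show "integrable lebesgue (\<lambda>t. \<delta>\<^sup>2 * indicator ?E t)" using E by (simp add: fmeasurable_def)
    show "integrable lebesgue (\<lambda>t. (L2_fun w t)\<^sup>2)"
      using square_integrable_L2_fun[of w] by (simp add: square_integrable_def)
    show "\<delta>\<^sup>2 * indicator ?E t \<le> (L2_fun w t)\<^sup>2" for t
    proof (cases "t \<in> ?E")
      case True
      then have "\<bar>\<delta>\<bar> \<le> \<bar>L2_fun w t\<bar>" using \<delta> by simp
      then show ?thesis using True by (simp add: abs_le_square_iff)
    qed simp
  qed
  finally show ?thesis by (simp add: norm_L2_sq)
qed

text \<open>The sets decrease to the empty set.  Excluding the zeros of \<open>g\<close> is essential: the set where a bound is attained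
  may have positive measure.\<close>

lemma measure_near_zero_set:
  fixes g :: "real^'l::finite \<Rightarrow> real"
  assumes \<Omega>: "\<Omega> \<in> lmeasurable" and [measurable]: "g \<in> borel_measurable lebesgue" and \<eta>: "0 < \<eta>"
  shows "\<exists>\<delta>>0. measure lebesgue {t \<in> \<Omega>. 0 < \<bar>g t\<bar> \<and> \<bar>g t\<bar> \<le> \<delta>} < \<eta>"
proof -
  let ?E = "\<lambda>n. {t \<in> \<Omega>. 0 < \<bar>g t\<bar> \<and> \<bar>g t\<bar> \<le> inverse (real (Suc n))}"
  have [measurable]: "\<Omega> \<in> sets lebesgue" using \<Omega> by (rule fmeasurableD)
  have E: "?E n \<in> lmeasurable" for n
  proof -
    have "?E n = \<Omega> \<inter> {t \<in> space lebesgue. 0 < \<bar>g t\<bar> \<and> \<bar>g t\<bar> \<le> inverse (real (Suc n))}" by auto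
    also have "\<dots> \<in> lmeasurable" by (rule fmeasurable_Int_fmeasurable[OF \<Omega>]) measurable
    finally show ?thesis .
  qed
  have "(\<lambda>n. measure lebesgue (?E n)) \<longlonglongrightarrow> measure lebesgue (\<Inter>n. ?E n)"
  proof (rule Lim_measure_decseq)
    show "range ?E \<subseteq> sets lebesgue" using E by (auto dest: fmeasurableD)
    show "emeasure lebesgue (?E i) \<noteq> \<infinity>" for i using E[of i] by (auto simp: fmeasurable_def)
    show "decseq ?E"
    proof (rule decseq_SucI)
      fix n
      have "inverse (real (Suc (Suc n))) \<le> inverse (real (Suc n))" by (simp add: field_simps)
      then show "?E (Suc n) \<subseteq> ?E n" by (intro Collect_mono) (use order_trans in blast)
    qed
  qed
  moreover have "(\<Inter>n. ?E n) = {}"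
  proof -
    have False if "\<And>n. 0 < \<bar>x\<bar> \<and> \<bar>x\<bar> \<le> inverse (real (Suc n))" for x :: real
      using reals_Archimedean[of "\<bar>x\<bar>"] that by (metis linorder_not_le)
    then show ?thesis by blast
  qed
  ultimately have "(\<lambda>n. measure lebesgue (?E n)) \<longlonglongrightarrow> 0" by simp
  then have "\<forall>\<^sub>F n in sequentially. measure lebesgue (?E n) < \<eta>" using \<eta> by (rule order_tendstoD)
  then obtain n where "measure lebesgue (?E n) < \<eta>" by (auto simp: eventually_sequentially)
  then show ?thesis by (intro exI[of _ "inverse (real (Suc n))"]) auto
qed

text \<open>As a map from \<open>L^2\<close> to itself the pointwise projection fails, in general, to have this Newton derivative.  The assumption \<open>gap\<close>
  supplies what is missing: the increments of \<open>w\<close> are small on small sets \<open>E\<close>, uniformly relative to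
  \<open>norm (x - a)\<close>.\<close>

lemma newton_diff_clip:
  fixes \<Omega> :: "(real^'l::finite) set" and lo hi :: "'l L2" and w \<Lambda> :: "'a::real_normed_vector \<Rightarrow> 'l L2"
  defines "\<Phi> \<equiv> \<lambda>x. L2_clip lo hi (w x)"
    and "\<A> \<equiv> \<lambda>x. {t \<in> \<Omega>. L2_fun lo t \<le> L2_fun (w x) t \<and> L2_fun (w x) t \<le> L2_fun hi t}"
  assumes \<Omega>: "\<Omega> \<in> lmeasurable" and lohi: "AE t in lebesgue. L2_fun lo t \<le> L2_fun hi t"
    and on: "lo \<in> L2_on \<Omega>" "hi \<in> L2_on \<Omega>" "\<And>x. w x \<in> L2_on \<Omega>"
    and \<Lambda>: "\<And>x. x \<in> X \<Longrightarrow> w x - w a = \<Lambda> (x - a)"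
    and K: "0 \<le> K" and \<alpha>: "0 < \<alpha>"
    and gap: "\<And>x E. x \<in> X \<Longrightarrow> E \<in> sets lebesgue \<Longrightarrow> E \<subseteq> \<Omega> \<Longrightarrow>
      norm (mult_ind E (w x - w a)) \<le> K * norm (x - a) * measure lebesgue E powr \<alpha>"
  shows "newton_diff \<Phi> (\<lambda>x d. mult_ind (\<A> x) (\<Lambda> d)) a X"
proof -
  have \<Omega>s [measurable]: "\<Omega> \<in> sets lebesgue" using \<Omega> by (rule fmeasurableD)
  have \<A> [measurable]: "\<A> x \<in> sets lebesgue" for x
  proof -
    have "\<A> x = \<Omega> \<inter> {t \<in> space lebesgue. L2_fun lo t \<le> L2_fun (w x) t \<and> L2_fun (w x) t \<le> L2_fun hi t}"
      by (auto simp: \<A>_def)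
    also have "\<dots> \<in> sets lebesgue" by measurable
    finally show ?thesis .
  qed
  have inX: "\<forall>\<^sub>F x in at a within X. x \<in> X" by (simp add: eventually_at_filter)
  have norm_diff: "norm (w x - w a) \<le> K * measure lebesgue \<Omega> powr \<alpha> * norm (x - a)" if "x \<in> X" for x
  proof -
    have "mult_ind \<Omega> (w x - w a) = w x - w a"
      using L2_on_iff_mult_ind[OF \<Omega>s] subspace_diff[OF subspace_L2_on[OF \<Omega>s] on(3) on(3)] by blast
    with gap[OF that \<Omega>s order_refl] show ?thesis by (simp add: ac_simps)
  qed
  define E where "E x = {t \<in> \<Omega>.
      0 < \<bar>L2_fun (w a) t - L2_fun lo t\<bar> \<and> \<bar>L2_fun (w a) t - L2_fun lo t\<bar> \<le> \<bar>L2_fun (w x - w a) t\<bar> \<or>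
      0 < \<bar>L2_fun (w a) t - L2_fun hi t\<bar> \<and> \<bar>L2_fun (w a) t - L2_fun hi t\<bar> \<le> \<bar>L2_fun (w x - w a) t\<bar>}" for x
  have lmeas: "{t \<in> \<Omega>. P t} \<in> lmeasurable" if "{t \<in> space lebesgue. P t} \<in> sets lebesgue" for P
  proof -
    have "{t \<in> \<Omega>. P t} = \<Omega> \<inter> {t \<in> space lebesgue. P t}" by auto
    also have "\<dots> \<in> lmeasurable" by (rule fmeasurable_Int_fmeasurable[OF \<Omega> that])
    finally show ?thesis .
  qed
  have E: "E x \<in> lmeasurable" for x unfolding E_def by (rule lmeas) measurable
  have rem: "norm (\<Phi> x - \<Phi> a - mult_ind (\<A> x) (\<Lambda> (x - a))) \<le> norm (mult_ind (E x) (w x - w a))"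
    if x: "x \<in> X" for x
  proof (rule norm_L2_mono)
    have clip: "AE t in lebesgue. L2_fun (\<Phi> x) t = min (max (L2_fun (w x) t) (L2_fun lo t)) (L2_fun hi t)" for x
      unfolding \<Phi>_def by (rule AE_L2_fun_clip)
    have out: "AE t in lebesgue. t \<notin> \<Omega> \<longrightarrow> L2_fun u t = 0" if "u \<in> L2_on \<Omega>" for u
      using that by (simp add: L2_on_def)
    show "AE t in lebesgue. \<bar>L2_fun (\<Phi> x - \<Phi> a - mult_ind (\<A> x) (\<Lambda> (x - a))) t\<bar> \<le> \<bar>L2_fun (mult_ind (E x) (w x - w a)) t\<bar>"
      using AE_L2_fun_diff[of "\<Phi> x - \<Phi> a" "mult_ind (\<A> x) (\<Lambda> (x - a))"] AE_L2_fun_diff[of "\<Phi> x" "\<Phi> a"]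
        AE_L2_fun_mult_ind[OF \<A>[of x], of "\<Lambda> (x - a)"] clip[of x] clip[of a]
        AE_L2_fun_mult_ind[OF fmeasurableD[OF E[of x]], of "w x - w a"] AE_L2_fun_diff[of "w x" "w a"]
        lohi out[OF on(1)] out[OF on(2)] out[OF on(3)[of x]] out[OF on(3)[of a]]
    proof eventually_elim
      case (elim t)
      show ?case
      proof (cases "t \<in> \<Omega>")
        case True
        have eq: "L2_fun (\<Phi> x - \<Phi> a - mult_ind (\<A> x) (\<Lambda> (x - a))) t
            = min (max (L2_fun (w x) t) (L2_fun lo t)) (L2_fun hi t) - min (max (L2_fun (w a) t) (L2_fun lo t)) (L2_fun hi t)
              - (if L2_fun lo t \<le> L2_fun (w x) t \<and> L2_fun (w x) t \<le> L2_fun hi t then L2_fun (w x) t - L2_fun (w a) t else 0)"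
          using elim True \<Lambda>[OF x] by (simp add: \<A>_def)
        have inside: "(t \<in> \<Omega> \<and> Q) = Q" for Q using True by simp
        have "\<bar>L2_fun (\<Phi> x - \<Phi> a - mult_ind (\<A> x) (\<Lambda> (x - a))) t\<bar>
            \<le> (if t \<in> E x then \<bar>L2_fun (w x) t - L2_fun (w a) t\<bar> else 0)"
          unfolding eq E_def mem_Collect_eq elim(7) inside
          by (rule abs_clip_remainder_le[OF elim(8)])
        also have "\<dots> = \<bar>L2_fun (mult_ind (E x) (w x - w a)) t\<bar>" using elim(6,7) by simp
        finally show ?thesis .
      next
        case False
        then have "L2_fun (\<Phi> x - \<Phi> a - mult_ind (\<A> x) (\<Lambda> (x - a))) t = 0"
          using elim by (simp add: \<A>_def)
        then show ?thesis by simp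
      qed
    qed
  qed
  have small: "\<forall>\<^sub>F x in at a within X. measure lebesgue (E x) < \<eta>" if \<eta>: "0 < \<eta>" for \<eta>
  proof -
    have meas: "(\<lambda>t. L2_fun (w a) t - L2_fun lo t) \<in> borel_measurable lebesgue"
      "(\<lambda>t. L2_fun (w a) t - L2_fun hi t) \<in> borel_measurable lebesgue" by measurable
    obtain \<delta>1 where \<delta>1: "0 < \<delta>1" "measure lebesgue {t \<in> \<Omega>. 0 < \<bar>L2_fun (w a) t - L2_fun lo t\<bar> \<and> \<bar>L2_fun (w a) t - L2_fun lo t\<bar> \<le> \<delta>1} < \<eta> / 3"
      using measure_near_zero_set[OF \<Omega> meas(1), of "\<eta> / 3"] \<eta> by auto
    obtain \<delta>2 where \<delta>2: "0 < \<delta>2" "measure lebesgue {t \<in> \<Omega>. 0 < \<bar>L2_fun (w a) t - L2_fun hi t\<bar> \<and> \<bar>L2_fun (w a) t - L2_fun hi t\<bar> \<le> \<delta>2} < \<eta> / 3"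
      using measure_near_zero_set[OF \<Omega> meas(2), of "\<eta> / 3"] \<eta> by auto
    \<comment> \<open>Either \<open>w a\<close> is within \<open>\<delta>\<close> of a bound without attaining it, or \<open>w x\<close> is at least \<open>\<delta>\<close> away from \<open>w a\<close>.\<close>
    define \<delta> where "\<delta> = min \<delta>1 \<delta>2"
    have \<delta>: "0 < \<delta>" using \<delta>1 \<delta>2 by (simp add: \<delta>_def)
    define k where "k = K * measure lebesgue \<Omega> powr \<alpha>"
    have k: "0 \<le> k" using K by (simp add: k_def)
    have "((\<lambda>x. (k * norm (x - a))\<^sup>2) \<longlongrightarrow> (k * norm (a - a))\<^sup>2) (at a within X)" by (intro tendsto_intros)
    moreover have "(k * norm (a - a))\<^sup>2 < \<delta>\<^sup>2 * (\<eta> / 3)" using \<delta> \<eta> by simp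
    ultimately have "\<forall>\<^sub>F x in at a within X. (k * norm (x - a))\<^sup>2 < \<delta>\<^sup>2 * (\<eta> / 3)"
      by (rule order_tendstoD(2))
    with inX show ?thesis
    proof eventually_elim
      case (elim x)
      let ?E1 = "{t \<in> \<Omega>. 0 < \<bar>L2_fun (w a) t - L2_fun lo t\<bar> \<and> \<bar>L2_fun (w a) t - L2_fun lo t\<bar> \<le> \<delta>1}"
      let ?E2 = "{t \<in> \<Omega>. 0 < \<bar>L2_fun (w a) t - L2_fun hi t\<bar> \<and> \<bar>L2_fun (w a) t - L2_fun hi t\<bar> \<le> \<delta>2}"
      let ?E3 = "{t \<in> \<Omega>. \<delta> \<le> \<bar>L2_fun (w x - w a) t\<bar>}"
      have Es: "?E1 \<in> lmeasurable" "?E2 \<in> lmeasurable" "?E3 \<in> lmeasurable" by (rule lmeas, measurable)+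
      have "\<delta>\<^sup>2 * measure lebesgue ?E3 \<le> (norm (w x - w a))\<^sup>2"
        by (rule L2_norm_ge_measure[OF \<Omega> \<delta>])
      also have "\<dots> \<le> (k * norm (x - a))\<^sup>2"
        using norm_diff[OF elim(1)] by (intro power_mono) (auto simp: k_def)
      also have "\<dots> < \<delta>\<^sup>2 * (\<eta> / 3)" by (rule elim(2))
      finally have E3: "measure lebesgue ?E3 < \<eta> / 3" using \<delta> by simp
      have "E x \<subseteq> ?E1 \<union> ?E2 \<union> ?E3" by (auto simp: E_def \<delta>_def)
      then have "measure lebesgue (E x) \<le> measure lebesgue (?E1 \<union> ?E2 \<union> ?E3)"
        using E Es by (intro measure_mono_fmeasurable fmeasurable.Un) (auto dest: fmeasurableD)
      also have "\<dots> \<le> measure lebesgue (?E1 \<union> ?E2) + measure lebesgue ?E3"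
        using Es by (intro measure_Un_le) (auto dest: fmeasurableD)
      also have "measure lebesgue (?E1 \<union> ?E2) \<le> measure lebesgue ?E1 + measure lebesgue ?E2"
        using Es by (intro measure_Un_le) (auto dest: fmeasurableD)
      finally show ?case using \<delta>1(2) \<delta>2(2) E3 by linarith
    qed
  qed
  show ?thesis
  proof (rule newton_diffI)
    show "\<forall>\<^sub>F x in at a within X. norm (mult_ind (\<A> x) (\<Lambda> (x - a))) \<le> (K * measure lebesgue \<Omega> powr \<alpha>) * norm (x - a)"
      using inX
    proof eventually_elim
      case (elim x)
      have "norm (mult_ind (\<A> x) (\<Lambda> (x - a))) \<le> norm (w x - w a)"
        using norm_mult_ind_le[OF \<A>, of x "\<Lambda> (x - a)"] \<Lambda>[OF elim] by simp
      also note norm_diff[OF elim]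
      finally show ?case .
    qed
  next
    fix e :: real assume e: "0 < e"
    define \<eta> where "\<eta> = (e / (K + 1)) powr (1 / \<alpha>)"
    have \<eta>: "0 < \<eta>" using e K by (simp add: \<eta>_def)
    show "\<forall>\<^sub>F x in at a within X. norm (\<Phi> x - \<Phi> a - mult_ind (\<A> x) (\<Lambda> (x - a))) \<le> e * norm (x - a)"
      using small[OF \<eta>] inX
    proof eventually_elim
      case (elim x)
      have "norm (\<Phi> x - \<Phi> a - mult_ind (\<A> x) (\<Lambda> (x - a))) \<le> norm (mult_ind (E x) (w x - w a))"
        by (rule rem[OF elim(2)])
      also have "\<dots> \<le> K * norm (x - a) * measure lebesgue (E x) powr \<alpha>"
        by (rule gap[OF elim(2)]) (use E in \<open>auto simp: E_def dest: fmeasurableD\<close>)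
      also have "\<dots> \<le> K * norm (x - a) * \<eta> powr \<alpha>"
        using elim(1) K \<alpha> by (intro mult_left_mono powr_mono2) auto
      also have "\<eta> powr \<alpha> = e / (K + 1)" using e K \<alpha> by (simp add: \<eta>_def powr_powr)
      also have "K * norm (x - a) * (e / (K + 1)) = (K / (K + 1)) * (e * norm (x - a))" by simp
      also have "\<dots> \<le> 1 * (e * norm (x - a))" using K e by (intro mult_right_mono) auto
      finally show ?case by simp
    qed
  qed
qed

text \<open>Hoelder's inequality for functions supported in \<open>E\<close>, up to a constant.  Splitting at a level \<open>s\<close> gives
  \<open>|v|^q \<le> s^(q - 2) v^2 + s^q\<close>, and \<open>s = norm v * |E|^(-1/2)\<close> makes both integrals equal.\<close>

lemma Lp_norm_le_L2_norm:
  fixes v :: "'l::finite L2"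
  assumes \<Omega>: "\<Omega> \<in> lmeasurable" and E [measurable]: "E \<in> sets lebesgue" and sub: "E \<subseteq> \<Omega>"
    and v: "mult_ind E v = v" and q: "0 < q" "q < 2"
  shows "L2_fun v \<in> Lp_fun q \<Omega>"
    and "Lp_norm q \<Omega> (L2_fun v) \<le> 2 powr (1 / q) * norm v * measure lebesgue E powr (1 / q - 1 / 2)"
proof -
  have \<Omega>s [measurable]: "\<Omega> \<in> sets lebesgue" using \<Omega> by (rule fmeasurableD)
  have Em: "E \<in> lmeasurable" using \<Omega> sub E by (rule fmeasurableI2)
  define N m where "N = norm v" and "m = measure lebesgue E"
  have off: "AE t in lebesgue. L2_fun v t = indicator E t * L2_fun v t"
    using AE_L2_fun_mult_ind[OF E, of v] by (simp add: v)
  have bound: "AE t in lebesgue. indicator \<Omega> t * \<bar>L2_fun v t\<bar> powr q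
      \<le> s powr (q - 2) * (L2_fun v t)\<^sup>2 + s powr q * indicator E t" if s: "0 < s" for s
    using off
  proof eventually_elim
    case (elim t)
    show ?case
    proof (cases "L2_fun v t = 0")
      case False
      then have tE: "t \<in> E" using elim by (auto simp: indicator_def split: if_splits)
      let ?c = "\<bar>L2_fun v t\<bar>"
      have "?c powr q \<le> s powr (q - 2) * (L2_fun v t)\<^sup>2 + s powr q"
      proof (cases "?c \<le> s")
        case True
        then have "?c powr q \<le> s powr q" using q by (intro powr_mono2) auto
        then show ?thesis using s by (simp add: add_increasing)
      next
        case False2: False
        have "?c powr q = ?c powr (q - 2) * ?c powr 2" by (subst powr_add[symmetric]) simp
        also have "\<dots> \<le> s powr (q - 2) * ?c powr 2"
          using False2 s q by (intro mult_right_mono powr_mono2') auto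
        also have "?c powr 2 = (L2_fun v t)\<^sup>2" using False by simp
        finally show ?thesis using s by (simp add: add_increasing2)
      qed
      then show ?thesis using tE sub by (auto simp: indicator_def)
    qed (use s in simp)
  qed
  have int_rhs: "integrable lebesgue (\<lambda>t. s powr (q - 2) * (L2_fun v t)\<^sup>2 + s powr q * indicator E t)" for s
    using square_integrable_L2_fun[of v] Em by (simp add: square_integrable_def fmeasurable_def)
  have int: "integrable lebesgue (\<lambda>t. indicator \<Omega> t * \<bar>L2_fun v t\<bar> powr q)"
  proof (rule Bochner_Integration.integrable_bound[OF int_rhs[of 1]])
    show "AE t in lebesgue. norm (indicator \<Omega> t * \<bar>L2_fun v t\<bar> powr q)
      \<le> norm (1 powr (q - 2) * (L2_fun v t)\<^sup>2 + 1 powr q * indicator E t)"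
      using bound[OF zero_less_one] by eventually_elim (simp add: indicator_def)
  qed measurable
  show "L2_fun v \<in> Lp_fun q \<Omega>"
    unfolding Lp_fun_def
    using int \<Omega>s by (auto simp: integrable_restrict_space measurable_restrict_space1)
  have LINT: "(LINT t|lebesgue_on \<Omega>. \<bar>L2_fun v t\<bar> powr q) = (LINT t|lebesgue. indicator \<Omega> t * \<bar>L2_fun v t\<bar> powr q)"
    using \<Omega>s by (simp add: integral_restrict_space)
  show "Lp_norm q \<Omega> (L2_fun v) \<le> 2 powr (1 / q) * norm v * measure lebesgue E powr (1 / q - 1 / 2)"
  proof (cases "N = 0 \<or> m = 0")
    case True
    have "AE t in lebesgue. L2_fun v t = 0"
    proof (cases "m = 0")
      case True
      with Em have "negligible E" by (simp add: m_def negligible_iff_measure)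
      then have "E \<in> null_sets lebesgue" by (simp add: negligible_iff_null_sets)
      then have "AE t in lebesgue. t \<notin> E" by (rule AE_not_in)
      with off show ?thesis by eventually_elim (simp add: indicator_def)
    next
      case False
      with \<open>N = 0 \<or> m = 0\<close> have "v = 0" by (simp add: N_def)
      then show ?thesis using AE_L2_fun_0 by simp
    qed
    then have "AE t in lebesgue. indicator \<Omega> t * \<bar>L2_fun v t\<bar> powr q = 0" by eventually_elim simp
    then have "(LINT t|lebesgue. indicator \<Omega> t * \<bar>L2_fun v t\<bar> powr q) = 0" by (rule integral_eq_zero_AE)
    then show ?thesis by (simp add: Lp_norm_def LINT)
  next
    case False
    then have Nm: "0 < N" "0 < m" by (auto simp: N_def m_def less_le)
    define s where "s = N * m powr (- 1 / 2)"
    have s: "0 < s" using Nm by (simp add: s_def)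
    have "(LINT t|lebesgue. indicator \<Omega> t * \<bar>L2_fun v t\<bar> powr q)
        \<le> (LINT t|lebesgue. s powr (q - 2) * (L2_fun v t)\<^sup>2 + s powr q * indicator E t)"
      by (rule integral_mono_AE[OF int int_rhs bound[OF s]])
    also have "\<dots> = s powr (q - 2) * N\<^sup>2 + s powr q * m"
      using square_integrable_L2_fun[of v] Em
      by (simp add: square_integrable_def fmeasurable_def N_def m_def norm_L2_sq)
    also have "s powr (q - 2) * N\<^sup>2 = N powr q * m powr (1 - q / 2)"
    proof -
      have "s powr (q - 2) * N\<^sup>2 = N powr (q - 2) * N powr 2 * (m powr (- 1 / 2)) powr (q - 2)"
        using Nm by (simp add: s_def powr_mult powr_numeral)
      also have "N powr (q - 2) * N powr 2 = N powr q" by (subst powr_add[symmetric]) simp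
      also have "(m powr (- 1 / 2)) powr (q - 2) = m powr (1 - q / 2)"
        unfolding powr_powr by (rule arg_cong[of _ _ "(powr) m"]) (simp add: field_simps)
      finally show ?thesis .
    qed
    also have "s powr q * m = N powr q * m powr (1 - q / 2)"
    proof -
      have "s powr q * m = N powr q * (m powr (- q / 2) * m powr 1)"
        using Nm by (simp add: s_def powr_mult powr_powr)
      also have "m powr (- q / 2) * m powr 1 = m powr (1 - q / 2)" by (subst powr_add[symmetric]) simp
      finally show ?thesis .
    qed
    finally have "(LINT t|lebesgue_on \<Omega>. \<bar>L2_fun v t\<bar> powr q) \<le> 2 * N powr q * m powr (1 - q / 2)"
      by (simp add: LINT)
    then have "Lp_norm q \<Omega> (L2_fun v) \<le> (2 * N powr q * m powr (1 - q / 2)) powr (1 / q)"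
      unfolding Lp_norm_def using q by (intro powr_mono2) auto
    also have "\<dots> = 2 powr (1 / q) * N * m powr (1 / q - 1 / 2)"
      using q Nm by (simp add: powr_mult powr_powr diff_divide_distrib)
    finally show ?thesis by (simp add: N_def m_def)
  qed
qed

section \<open>Derivatives along subspaces\<close>

text \<open>Every direction of \<open>S\<close> is tangent to a line within \<open>S\<close>, so a derivative within \<open>S\<close> is determined on \<open>S\<close>,
  and only there.\<close>

lemma has_derivative_within_subspace_unique:
  fixes f :: "'a::real_normed_vector \<Rightarrow> 'b::real_normed_vector"
  assumes S: "subspace S" "x \<in> S" and f': "(f has_derivative f') (at x within S)"
    and f'': "(f has_derivative f'') (at x within S)" and v: "v \<in> S"
  shows "f' v = f'' v"
proof -
  have "((\<lambda>y. f y - f y) has_derivative (\<lambda>h. f' h - f'' h)) (at x within S)"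
    by (rule has_derivative_diff[OF f' f''])
  then have "((\<lambda>y. 0) has_derivative (\<lambda>h. f' h - f'' h)) (at x within S)" by simp
  then have "((\<lambda>y. 0) has_derivative (\<lambda>h. f' h - f'' h)) (at x within (\<lambda>t. x + t *\<^sub>R v) ` UNIV)"
    by (rule has_derivative_subset) (use S v in \<open>auto intro: subspace_add subspace_scale\<close>)
  then have *: "((\<lambda>y. 0) has_derivative (\<lambda>h. f' h - f'' h)) (at (x + 0 *\<^sub>R v) within (\<lambda>t. x + t *\<^sub>R v) ` UNIV)"
    by simp
  have line: "((\<lambda>t::real. x + t *\<^sub>R v) has_derivative (\<lambda>t. t *\<^sub>R v)) (at 0)"
    by (auto intro!: derivative_eq_intros)
  have "((\<lambda>t::real. 0) has_derivative (\<lambda>t. f' (t *\<^sub>R v) - f'' (t *\<^sub>R v))) (at 0)"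
    using diff_chain_within[OF line *] by (simp add: o_def)
  then have "(\<lambda>t. f' (t *\<^sub>R v) - f'' (t *\<^sub>R v)) = (\<lambda>t. 0)"
    by (rule has_derivative_unique[OF _ has_derivative_const])
  from fun_cong[OF this, of 1] show ?thesis by simp
qed

lemma frechet_derivative_within_subspace:
  assumes S: "subspace S" "x \<in> S" and f': "(f has_derivative f') (at x within S)" and v: "v \<in> S"
  shows "frechet_derivative f (at x within S) v = f' v"
proof -
  have "(f has_derivative frechet_derivative f (at x within S)) (at x within S)"
    unfolding frechet_derivative_def by (rule someI[where P="\<lambda>g. (f has_derivative g) (at x within S)", OF f'])
  from has_derivative_within_subspace_unique[OF S this f' v] show ?thesis .
qed

lemma dual_derivative_eq:
  fixes S :: "'a::{real_inner,banach} set"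
  assumes S: "subspace S" "closed S" and x: "x \<in> S" and g: "g \<in> dual_of S"
    and f: "(f has_derivative blinfun_apply g) (at x within S)"
  shows "dual_derivative S f x = g"
  unfolding dual_derivative_def
proof (rule the_equality)
  fix g' assume g': "g' \<in> dual_of S \<and> (f has_derivative blinfun_apply g') (at x within S)"
  show "g' = g"
    by (rule dual_of_eqI[OF S]) (use g' g f has_derivative_within_subspace_unique[OF S(1) x] in blast)+
qed (use g f in blast)

lemma gradient_on_eq:
  assumes S: "subspace S" and x: "x \<in> S" and g: "g \<in> S"
    and f: "(f has_derivative (\<lambda>v. inner v g)) (at x within S)"
  shows "gradient_on S f x = g"
  unfolding gradient_on_def
proof (rule the_equality)
  fix g' assume g': "g' \<in> S \<and> (f has_derivative (\<lambda>v. inner v g')) (at x within S)"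
  show "g' = g"
  proof (rule inner_eq_imp_eq_on[OF S])
    show "inner g' v = inner g v" if "v \<in> S" for v
      using has_derivative_within_subspace_unique[OF S x conjunct2[OF g'] f that] by (simp add: inner_commute)
  qed (use g g' in auto)
qed (use g f in blast)

lemma has_derivative_vec:
  fixes f :: "'a::real_normed_vector \<Rightarrow> real^'n::finite"
  assumes "\<And>i. ((\<lambda>x. f x $ i) has_derivative (\<lambda>h. f' h $ i)) F"
  shows "(f has_derivative f') F"
proof -
  have "((\<lambda>x. \<Sum>i\<in>UNIV. (f x $ i) *\<^sub>R axis i 1) has_derivative (\<lambda>h. \<Sum>i\<in>UNIV. (f' h $ i) *\<^sub>R axis i (1::real))) F"
    by (intro has_derivative_sum has_derivative_scaleR_left assms)
  then show ?thesis by (simp flip: vec_eq_sum_axis)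
qed

lemma has_derivative_vec_nth_compose:
  "(f has_real_derivative d) (at (x $ i)) \<Longrightarrow> ((\<lambda>y :: real^'n::finite. f (y $ i)) has_derivative (\<lambda>v. v $ i * d)) (at x)"
  by (rule DERIV_compose_FDERIV[OF _ bounded_linear_imp_has_derivative[OF bounded_linear_vec_nth]])

lemma has_derivative_separable_sum:
  assumes "\<And>i. (f i has_real_derivative d i) (at (x $ i))"
  shows "((\<lambda>y :: real^'n::finite. \<Sum>i\<in>UNIV. f i (y $ i)) has_derivative (\<lambda>v. inner v (\<chi> i. d i))) (at x)"
  unfolding inner_vec_def inner_real_def vec_lambda_beta
  by (intro has_derivative_sum has_derivative_vec_nth_compose assms)

lemma open_positive_vec: "open {x :: real^'n::finite. \<forall>i. 0 < x $ i}"
proof -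
  have "{x :: real^'n. \<forall>i. 0 < x $ i} = (\<Inter>i. {x. 0 < x $ i})" by auto
  also have "open \<dots>" by (intro open_INT ballI open_Collect_less continuous_intros) auto
  finally show ?thesis .
qed

abbreviation pull :: "('a::real_normed_vector \<Rightarrow>\<^sub>L 'b::real_inner) \<Rightarrow> 'b \<Rightarrow> ('a \<Rightarrow>\<^sub>L real)" where
  "pull T c \<equiv> blinfun_inner_left c o\<^sub>L T"

lemma pull_apply: "blinfun_apply (pull T c) v = inner c (blinfun_apply T v)"
  by (simp add: inner_commute)

lemma bounded_linear_pull: "bounded_linear (pull T)"
  by (rule bounded_linear_compose[OF bounded_bilinear.bounded_linear_left[OF bounded_bilinear_blinfun_compose]
        bounded_linear_blinfun_inner_left])

lemma norm_pull_le: "norm (pull T c) \<le> norm T * norm c"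
proof (rule norm_blinfun_bound)
  show "norm (blinfun_apply (pull T c) v) \<le> norm T * norm c * norm v" for v
    using Cauchy_Schwarz_ineq2[of c "blinfun_apply T v"]
      mult_left_mono[OF norm_blinfun[of T v], of "norm c"]
    unfolding pull_apply real_norm_def by (simp add: ac_simps)
qed simp

lemma half_norm_sq_deriv:
  fixes T :: "'a::real_normed_vector \<Rightarrow>\<^sub>L 'b::real_inner"
  shows "((\<lambda>y. 1 / 2 * (norm (blinfun_apply T y - d))\<^sup>2) has_derivative blinfun_apply (pull T (blinfun_apply T y - d))) (at y within S)"
proof -
  have "((\<lambda>y. blinfun_apply T y - d) has_derivative blinfun_apply T) (at y within S)"
    by (auto intro!: derivative_eq_intros bounded_linear_imp_has_derivative blinfun.bounded_linear_right)
  from has_derivative_inner[OF this this]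
  have "((\<lambda>y. 1 / 2 * inner (blinfun_apply T y - d) (blinfun_apply T y - d)) has_derivative
      (\<lambda>v. 1 / 2 * (inner (blinfun_apply T y - d) (blinfun_apply T v) + inner (blinfun_apply T v) (blinfun_apply T y - d)))) (at y within S)"
    by (rule has_derivative_mult_right)
  moreover have "(\<lambda>v. 1 / 2 * (inner (blinfun_apply T y - d) (blinfun_apply T v) + inner (blinfun_apply T v) (blinfun_apply T y - d)))
      = blinfun_apply (pull T (blinfun_apply T y - d))"
    by (rule ext) (simp add: inner_commute)
  ultimately show ?thesis by (simp add: power2_norm_eq_inner)
qed

section \<open>The optimal control problem\<close>

locale control_problem =
  fixes D :: "('l::finite, 'n::finite, 'm::finite) prob_data"
  assumes open_Dom: "open (Dom D)" and bounded_Dom: "bounded (Dom D)"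
    and sig_u: "0 < sig_u D" and sig_l: "0 < sig_l D" and sig_b: "0 < sig_b D" and gam: "0 < gam D"
    and op_A: "bounded_linear_on (H01 (Dom D)) (op_A D)"
    and bij_op_A: "bij_betw (op_A D) (H01 (Dom D)) (Hm1 (Dom D))"
    and op_B: "bounded_linear_on (L2_on (Dom D)) (op_B D)" and op_B_in: "op_B D ` L2_on (Dom D) \<subseteq> Hm1 (Dom D)"
    and op_C: "\<And>i. bounded_linear_on (H01 (Dom D)) (op_C D i)"
    and u_m: "u_m D \<in> L2_on (Dom D)" and u_a: "u_a D \<in> L2_on (Dom D)" and u_b: "u_b D \<in> L2_on (Dom D)"
begin

abbreviation "H \<equiv> H01 (Dom D)"
abbreviation "U \<equiv> L2_on (Dom D)"

lemma Dom_lmeasurable: "Dom D \<in> lmeasurable"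
  by (rule lmeasurable_open[OF bounded_Dom open_Dom])

lemma Dom_sets: "Dom D \<in> sets lebesgue"
  by (rule fmeasurableD[OF Dom_lmeasurable])

lemmas H = subspace_H01[of "Dom D"] closed_H01[of "Dom D"]
lemmas U = subspace_L2_on[OF Dom_sets] closed_L2_on[OF Dom_sets]

sublocale state_equation H U "op_A D" "op_B D"
  by unfold_locales (use H U op_A bij_op_A op_B op_B_in in \<open>auto simp: Hm1_def\<close>)

lemma sig_hat: "0 < sig_hat D"
  using sig_u sig_l gam by (simp add: sig_hat_def add_pos_pos)

lemma A_adj_eq: "A_adj D p = A' p"
  unfolding A_adj_def Hm1_def
  by (rule the_equality) (auto simp: A'_in A'_apply intro!: dual_of_eqI[OF H])

lemma B_adj_eq: "B_adj D p = B' p"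
  unfolding B_adj_def
  by (rule the_equality) (auto simp: B'_in inner_B' intro!: inner_eq_imp_eq_on[OF U(1)])

text \<open>\<open>op_C\<close> and the embedding of \<open>H\<close> into \<open>L^2\<close>, both extended to the whole space by the orthogonal projection
  onto \<open>H\<close>.  Functionals built from them automatically belong to the dual of \<open>H\<close>.\<close>

definition CP :: "'n \<Rightarrow> 'l H1 \<Rightarrow>\<^sub>L 'l L2" where
  "CP i = Blinfun (\<lambda>v. op_C D i (proj H v))"

definition Emb :: "'l H1 \<Rightarrow>\<^sub>L 'l L2" where
  "Emb = Blinfun (\<lambda>v. fst (proj H v))"

definition res :: "'n \<Rightarrow> 'l H1 \<Rightarrow> 'l L2" where
  "res i y = blinfun_apply (CP i) y - y_d D i"

lemma CP_apply: "blinfun_apply (CP i) v = op_C D i (proj H v)"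
  unfolding CP_def by (rule bounded_linear_Blinfun_apply[OF bounded_linear_on_comp_proj[OF H op_C], THEN fun_cong])

lemma Emb_apply: "blinfun_apply Emb v = fst (proj H v)"
  unfolding Emb_def
  by (rule bounded_linear_Blinfun_apply[OF bounded_linear_compose[OF bounded_linear_fst bounded_linear_proj[OF H]], THEN fun_cong])

lemma CP_on: "v \<in> H \<Longrightarrow> blinfun_apply (CP i) v = op_C D i v"
  and Emb_on: "v \<in> H \<Longrightarrow> blinfun_apply Emb v = fst v"
  by (simp_all add: CP_apply Emb_apply proj_ident[OF H])

lemma res_on: "y \<in> H \<Longrightarrow> res i y = op_C D i y - y_d D i"
  by (simp add: res_def CP_on)

lemma pull_CP_in: "pull (CP i) c \<in> dual_of H" and pull_Emb_in: "pull Emb c \<in> dual_of H"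
  by (simp_all add: dual_of_iff[OF H] CP_apply Emb_apply proj_ident[OF H] proj_in[OF H])

section \<open>First derivatives of the objective\<close>

definition grad_F :: "real^'n \<Rightarrow> real^'n" where
  "grad_F \<beta> = (\<chi> i. - sig_b D * inverse (\<beta> $ i) ^ 3)"

definition grad_f :: "real^'n \<Rightarrow> 'l H1 \<Rightarrow> real^'n" where
  "grad_f \<beta> y = (\<chi> i. - (1 / 2) * inverse (\<beta> $ i) ^ 2 * (norm (res i y))\<^sup>2)"

definition der_F :: "'l H1 \<Rightarrow> ('l H1 \<Rightarrow>\<^sub>L real)" where
  "der_F y = pull Emb (blinfun_apply Emb y - y_m D)"

definition der_f :: "real^'n \<Rightarrow> 'l H1 \<Rightarrow> ('l H1 \<Rightarrow>\<^sub>L real)" where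
  "der_f \<beta> y = (\<Sum>i\<in>UNIV. inverse (\<beta> $ i) *\<^sub>R pull (CP i) (res i y))"

lemma der_F_in: "der_F y \<in> dual_of H" and der_f_in: "der_f \<beta> y \<in> dual_of H"
  unfolding der_F_def der_f_def
  by (auto intro!: pull_Emb_in subspace_sum subspace_scale pull_CP_in subspace_dual_of[OF H])

lemma obj_F_deriv_beta:
  assumes "\<And>i. \<beta> $ i \<noteq> 0"
  shows "((\<lambda>\<beta>'. obj_F D \<beta>' y u) has_derivative (\<lambda>v. inner v (grad_F \<beta>))) (at \<beta>)"
proof -
  have "((\<lambda>\<beta>'. \<Sum>i\<in>UNIV. sig_b D / 2 * inverse ((\<beta>' $ i)\<^sup>2)) has_derivative (\<lambda>v. inner v (grad_F \<beta>))) (at \<beta>)"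
    unfolding grad_F_def
  proof (rule has_derivative_separable_sum)
    show "((\<lambda>r. sig_b D / 2 * inverse (r\<^sup>2)) has_real_derivative - sig_b D * inverse (\<beta> $ i) ^ 3) (at (\<beta> $ i))" for i
      using assms[of i] by (auto intro!: derivative_eq_intros simp: field_simps power2_eq_square power3_eq_cube)
  qed
  from has_derivative_add[OF has_derivative_const this]
  show ?thesis by (simp add: obj_F_def sum_distrib_left)
qed

lemma obj_f_deriv_beta:
  assumes "\<And>i. \<beta> $ i \<noteq> 0" "y \<in> H"
  shows "((\<lambda>\<beta>'. obj_f D \<beta>' y u) has_derivative (\<lambda>v. inner v (grad_f \<beta> y))) (at \<beta>)"
proof -
  have "((\<lambda>\<beta>'. \<Sum>i\<in>UNIV. 1 / (2 * \<beta>' $ i) * (norm (op_C D i y - y_d D i))\<^sup>2) has_derivative (\<lambda>v. inner v (grad_f \<beta> y))) (at \<beta>)"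
    unfolding grad_f_def
  proof (rule has_derivative_separable_sum)
    show "((\<lambda>r. 1 / (2 * r) * (norm (op_C D i y - y_d D i))\<^sup>2) has_real_derivative
        - (1 / 2) * inverse (\<beta> $ i) ^ 2 * (norm (res i y))\<^sup>2) (at (\<beta> $ i))" for i
      using assms(1)[of i] by (auto intro!: derivative_eq_intros simp: field_simps power2_eq_square res_on[OF assms(2)])
  qed
  from has_derivative_add[OF this has_derivative_const]
  show ?thesis by (simp add: obj_f_def)
qed

lemma obj_F_deriv_y:
  assumes y: "y \<in> H"
  shows "((\<lambda>y'. obj_F D \<beta> y' u) has_derivative blinfun_apply (der_F y)) (at y within H)"
proof (rule has_derivative_transform[OF y])
  have "((\<lambda>y'. 1 / 2 * (norm (blinfun_apply Emb y' - y_m D))\<^sup>2 + (sig_u D / 2 * (norm (u - u_m D))\<^sup>2 +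
      sig_b D / 2 * (\<Sum>i\<in>UNIV. inverse ((\<beta> $ i)\<^sup>2)))) has_derivative (\<lambda>v. blinfun_apply (der_F y) v + 0)) (at y within H)"
    unfolding der_F_def by (intro has_derivative_add half_norm_sq_deriv has_derivative_const)
  then show "((\<lambda>y'. 1 / 2 * (norm (blinfun_apply Emb y' - y_m D))\<^sup>2 + (sig_u D / 2 * (norm (u - u_m D))\<^sup>2 +
      sig_b D / 2 * (\<Sum>i\<in>UNIV. inverse ((\<beta> $ i)\<^sup>2)))) has_derivative blinfun_apply (der_F y)) (at y within H)"
    by simp
qed (simp add: obj_F_def Emb_on)

lemma obj_f_deriv_y:
  assumes y: "y \<in> H"
  shows "((\<lambda>y'. obj_f D \<beta> y' u) has_derivative blinfun_apply (der_f \<beta> y)) (at y within H)"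
proof (rule has_derivative_transform[OF y])
  have "((\<lambda>y'. (\<Sum>i\<in>UNIV. inverse (\<beta> $ i) * (1 / 2 * (norm (blinfun_apply (CP i) y' - y_d D i))\<^sup>2)) + sig_l D / 2 * (norm u)\<^sup>2)
      has_derivative (\<lambda>v. (\<Sum>i\<in>UNIV. inverse (\<beta> $ i) * blinfun_apply (pull (CP i) (res i y)) v) + 0)) (at y within H)"
    unfolding res_def
    by (intro has_derivative_add has_derivative_sum has_derivative_mult_right half_norm_sq_deriv has_derivative_const)
  moreover have "(\<lambda>v. (\<Sum>i\<in>UNIV. inverse (\<beta> $ i) * blinfun_apply (pull (CP i) (res i y)) v) + 0) = blinfun_apply (der_f \<beta> y)"
    by (rule ext) (simp add: der_f_def blinfun.sum_left blinfun.scaleR_left)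
  ultimately show "((\<lambda>y'. (\<Sum>i\<in>UNIV. inverse (\<beta> $ i) * (1 / 2 * (norm (blinfun_apply (CP i) y' - y_d D i))\<^sup>2)) + sig_l D / 2 * (norm u)\<^sup>2)
      has_derivative blinfun_apply (der_f \<beta> y)) (at y within H)"
    by simp
qed (simp add: obj_f_def CP_on field_simps)

text \<open>The function \<open>h\<close> is the objective of the penalised problem without its terms in \<open>u\<close>, so its derivatives need
  no separate computation.\<close>

lemma h_fun_eq: "h_fun D \<beta> y = obj_F D \<beta> y 0 + gam D * (obj_f D \<beta> y 0 - xi_T D \<beta>) - sig_u D / 2 * (norm (u_m D))\<^sup>2"
  by (simp add: h_fun_def obj_F_def obj_f_def)

lemma h_b_eq:
  assumes \<beta>: "\<And>i. \<beta> $ i \<noteq> 0" and y: "y \<in> H"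
  shows "h_b D \<beta> y = grad_F \<beta> + gam D *\<^sub>R (grad_f \<beta> y - a_T D)"
  unfolding h_b_def
proof (rule gradient_on_eq)
  have "((\<lambda>\<beta>'. xi_T D \<beta>') has_derivative (\<lambda>v. inner v (a_T D))) (at \<beta>)"
    unfolding xi_T_def by (auto intro!: derivative_eq_intros simp: inner_commute)
  from has_derivative_diff[OF has_derivative_add[OF obj_F_deriv_beta[OF \<beta>] has_derivative_mult_right[OF
        has_derivative_diff[OF obj_f_deriv_beta[OF \<beta> y] this], of "gam D"]] has_derivative_const]
  show "((\<lambda>\<beta>'. h_fun D \<beta>' y) has_derivative (\<lambda>v. inner v (grad_F \<beta> + gam D *\<^sub>R (grad_f \<beta> y - a_T D)))) (at \<beta>)"
    unfolding h_fun_eq by (simp add: inner_add_right inner_diff_right)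
qed auto

lemma h_y_eq:
  assumes y: "y \<in> H"
  shows "h_y D \<beta> y = der_F y + gam D *\<^sub>R der_f \<beta> y"
  unfolding h_y_def
proof (rule dual_derivative_eq[OF H y])
  show "der_F y + gam D *\<^sub>R der_f \<beta> y \<in> dual_of H"
    by (intro subspace_add subspace_scale der_F_in der_f_in subspace_dual_of[OF H])
  from has_derivative_diff[OF has_derivative_add[OF obj_F_deriv_y[OF y] has_derivative_mult_right[OF
        has_derivative_diff[OF obj_f_deriv_y[OF y] has_derivative_const], of "gam D"]] has_derivative_const]
  show "((\<lambda>y'. h_fun D \<beta> y') has_derivative blinfun_apply (der_F y + gam D *\<^sub>R der_f \<beta> y)) (at y within H)"
    unfolding h_fun_eq by (simp add: blinfun.add_left blinfun.scaleR_left plus_blinfun.rep_eq scaleR_blinfun.rep_eq)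
qed

section \<open>Second derivatives of the objective\<close>

lemma h_bb_eq:
  assumes \<beta>: "\<And>i. 0 < \<beta> $ i" and y: "y \<in> H"
  shows "h_bb D \<beta> y d = (\<chi> i. (3 * sig_b D * inverse (\<beta> $ i) ^ 4 + gam D * inverse (\<beta> $ i) ^ 3 * (norm (res i y))\<^sup>2) * d $ i)"
proof -
  have "((\<lambda>\<beta>'. grad_F \<beta>' + gam D *\<^sub>R (grad_f \<beta>' y - a_T D)) has_derivative
      (\<lambda>d. \<chi> i. (3 * sig_b D * inverse (\<beta> $ i) ^ 4 + gam D * inverse (\<beta> $ i) ^ 3 * (norm (res i y))\<^sup>2) * d $ i)) (at \<beta>)"
  proof (rule has_derivative_vec)
    fix i
    let ?d = "3 * sig_b D * inverse (\<beta> $ i) ^ 4 + gam D * inverse (\<beta> $ i) ^ 3 * (norm (res i y))\<^sup>2"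
    have "((\<lambda>r. - sig_b D * inverse r ^ 3 + gam D * (- (1 / 2) * inverse r ^ 2 * (norm (res i y))\<^sup>2 - a_T D $ i))
        has_real_derivative ?d) (at (\<beta> $ i))"
      using \<beta>[of i]
      by (auto intro!: derivative_eq_intros simp: field_simps power2_eq_square power3_eq_cube power4_eq_xxxx)
    from has_derivative_vec_nth_compose[OF this]
    show "((\<lambda>\<beta>'. (grad_F \<beta>' + gam D *\<^sub>R (grad_f \<beta>' y - a_T D)) $ i) has_derivative (\<lambda>d. (\<chi> i. (3 * sig_b D * inverse (\<beta> $ i) ^ 4 + gam D * inverse (\<beta> $ i) ^ 3 * (norm (res i y))\<^sup>2) * d $ i) $ i)) (at \<beta>)"
      by (simp add: grad_F_def grad_f_def mult.commute)
  qed
  then have "((\<lambda>\<beta>'. h_b D \<beta>' y) has_derivative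
      (\<lambda>d. \<chi> i. (3 * sig_b D * inverse (\<beta> $ i) ^ 4 + gam D * inverse (\<beta> $ i) ^ 3 * (norm (res i y))\<^sup>2) * d $ i)) (at \<beta>)"
  proof (rule has_derivative_transform_within_open[OF _ open_positive_vec])
    show "grad_F \<beta>' + gam D *\<^sub>R (grad_f \<beta>' y - a_T D) = h_b D \<beta>' y" if "\<beta>' \<in> {x. \<forall>i. 0 < x $ i}" for \<beta>'
    proof (rule h_b_eq[OF _ y, symmetric])
      show "\<beta>' $ i \<noteq> 0" for i using that by (metis less_irrefl mem_Collect_eq)
    qed
  qed (use \<beta> in auto)
  from frechet_derivative_at[OF this, symmetric] show ?thesis unfolding h_bb_def by (rule fun_cong)
qed

lemma res_deriv: "((\<lambda>y'. res i y') has_derivative blinfun_apply (CP i)) (at y within S)"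
  unfolding res_def by (auto intro!: derivative_eq_intros bounded_linear_imp_has_derivative blinfun.bounded_linear_right)

lemma h_by_eq:
  assumes \<beta>: "\<And>i. \<beta> $ i \<noteq> 0" and y: "y \<in> H" and v: "v \<in> H"
  shows "h_by D \<beta> y v = (\<chi> i. - (gam D * inverse (\<beta> $ i) ^ 2 * inner (res i y) (blinfun_apply (CP i) v)))"
proof -
  have "((\<lambda>y'. grad_F \<beta> + gam D *\<^sub>R (grad_f \<beta> y' - a_T D)) has_derivative
      (\<lambda>v. \<chi> i. - (gam D * inverse (\<beta> $ i) ^ 2 * inner (res i y) (blinfun_apply (CP i) v)))) (at y within H)"
  proof (rule has_derivative_vec)
    fix i
    have "((\<lambda>y'. - sig_b D * inverse (\<beta> $ i) ^ 3 + gam D * (- (1 / 2) * inverse (\<beta> $ i) ^ 2 * inner (res i y') (res i y') - a_T D $ i))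
        has_derivative (\<lambda>v. - (gam D * inverse (\<beta> $ i) ^ 2 * inner (res i y) (blinfun_apply (CP i) v)))) (at y within H)"
      by (rule derivative_eq_intros res_deriv refl | simp add: inner_commute mult.assoc)+
    then show "((\<lambda>y'. (grad_F \<beta> + gam D *\<^sub>R (grad_f \<beta> y' - a_T D)) $ i) has_derivative
       (\<lambda>v. (\<chi> i. - (gam D * inverse (\<beta> $ i) ^ 2 * inner (res i y) (blinfun_apply (CP i) v))) $ i)) (at y within H)"
      by (simp add: grad_F_def grad_f_def power2_norm_eq_inner)
  qed
  then have "((\<lambda>y'. h_b D \<beta> y') has_derivative
      (\<lambda>v. \<chi> i. - (gam D * inverse (\<beta> $ i) ^ 2 * inner (res i y) (blinfun_apply (CP i) v)))) (at y within H)"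
    by (rule has_derivative_transform[OF y, rotated]) (simp add: h_b_eq[OF \<beta>])
  from frechet_derivative_within_subspace[OF H(1) y this v] show ?thesis by (simp add: h_by_def)
qed

lemma h_yb_eq:
  assumes \<beta>: "\<And>i. \<beta> $ i \<noteq> 0" and y: "y \<in> H"
  shows "h_yb D \<beta> y d = gam D *\<^sub>R (\<Sum>i\<in>UNIV. (- (d $ i * inverse (\<beta> $ i) ^ 2)) *\<^sub>R pull (CP i) (res i y))"
proof -
  have inv: "((\<lambda>\<beta>'. inverse (\<beta>' $ i)) has_derivative (\<lambda>d. - (d $ i * inverse (\<beta> $ i) ^ 2))) (at \<beta>)" for i
  proof -
    have "(inverse has_real_derivative - (inverse (\<beta> $ i) ^ 2)) (at (\<beta> $ i))"
      using DERIV_inverse[OF \<beta>[of i]] by (simp add: numeral_2_eq_2)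
    from has_derivative_vec_nth_compose[OF this] show ?thesis by simp
  qed
  have "((\<lambda>\<beta>'. der_F y + gam D *\<^sub>R (\<Sum>i\<in>UNIV. inverse (\<beta>' $ i) *\<^sub>R pull (CP i) (res i y))) has_derivative
     (\<lambda>d. 0 + gam D *\<^sub>R (\<Sum>i\<in>UNIV. (- (d $ i * inverse (\<beta> $ i) ^ 2)) *\<^sub>R pull (CP i) (res i y)))) (at \<beta>)"
    by (intro has_derivative_add has_derivative_const has_derivative_scaleR_right has_derivative_sum
        has_derivative_scaleR_left inv)
  then have "((\<lambda>\<beta>'. h_y D \<beta>' y) has_derivative
     (\<lambda>d. gam D *\<^sub>R (\<Sum>i\<in>UNIV. (- (d $ i * inverse (\<beta> $ i) ^ 2)) *\<^sub>R pull (CP i) (res i y)))) (at \<beta>)"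
    by (simp add: h_y_eq[OF y] der_f_def)
  from frechet_derivative_at[OF this, symmetric] show ?thesis unfolding h_yb_def by (rule fun_cong)
qed

lemma h_yy_eq:
  assumes y: "y \<in> H" and v: "v \<in> H"
  shows "h_yy D \<beta> y v = pull Emb (blinfun_apply Emb v) + gam D *\<^sub>R (\<Sum>i\<in>UNIV. inverse (\<beta> $ i) *\<^sub>R pull (CP i) (blinfun_apply (CP i) v))"
proof -
  have Emb: "((\<lambda>y'. blinfun_apply Emb y' - y_m D) has_derivative blinfun_apply Emb) (at y within H)"
    by (auto intro!: derivative_eq_intros bounded_linear_imp_has_derivative blinfun.bounded_linear_right)
  have "((\<lambda>y'. der_F y' + gam D *\<^sub>R der_f \<beta> y') has_derivative
      (\<lambda>v. pull Emb (blinfun_apply Emb v) + gam D *\<^sub>R (\<Sum>i\<in>UNIV. inverse (\<beta> $ i) *\<^sub>R pull (CP i) (blinfun_apply (CP i) v)))) (at y within H)"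
    unfolding der_F_def der_f_def
    by (intro has_derivative_add has_derivative_scaleR_right has_derivative_sum
        bounded_linear.has_derivative[OF bounded_linear_pull] Emb res_deriv)
  then have "((\<lambda>y'. h_y D \<beta> y') has_derivative
      (\<lambda>v. pull Emb (blinfun_apply Emb v) + gam D *\<^sub>R (\<Sum>i\<in>UNIV. inverse (\<beta> $ i) *\<^sub>R pull (CP i) (blinfun_apply (CP i) v)))) (at y within H)"
    by (rule has_derivative_transform[OF y, rotated]) (simp add: h_y_eq)
  from frechet_derivative_within_subspace[OF H(1) y this v] show ?thesis by (simp add: h_yy_def)
qed

text \<open>The rows of \<open>h''\<close>, on pairs of directions in \<open>\<beta>\<close> and \<open>y\<close>.\<close>

definition hess_b :: "real^'n \<Rightarrow> 'l H1 \<Rightarrow> (real^'n) \<times> 'l H1 \<Rightarrow> real^'n" where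
  "hess_b \<beta> y w = (\<chi> i. (3 * sig_b D * inverse (\<beta> $ i) ^ 4 + gam D * inverse (\<beta> $ i) ^ 3 * (norm (res i y))\<^sup>2) * fst w $ i
     - gam D * inverse (\<beta> $ i) ^ 2 * inner (res i y) (blinfun_apply (CP i) (snd w)))"

definition hess_y :: "real^'n \<Rightarrow> 'l H1 \<Rightarrow> (real^'n) \<times> 'l H1 \<Rightarrow> ('l H1 \<Rightarrow>\<^sub>L real)" where
  "hess_y \<beta> y w = pull Emb (blinfun_apply Emb (snd w)) + gam D *\<^sub>R
     (\<Sum>i\<in>UNIV. inverse (\<beta> $ i) *\<^sub>R pull (CP i) (blinfun_apply (CP i) (snd w))
        - (fst w $ i * inverse (\<beta> $ i) ^ 2) *\<^sub>R pull (CP i) (res i y))"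

lemma newton_W'_eq:
  assumes x: "(\<beta>, y, u, z, p) \<in> W_dom D" and s: "s \<in> W_dirs D"
  shows "newton_W' D (\<beta>, y, u, z, p) s
    = newton_op (K_T D) (sig_hat D) (act1 D \<beta> z) (mult_ind (act3 D p)) (hess_b \<beta> y) (hess_y \<beta> y) s"
proof -
  obtain d\<beta> dy du dz dp where s_eq: "s = (d\<beta>, dy, du, dz, dp)" by (metis prod_cases5)
  have \<beta>: "\<And>i. 0 < \<beta> $ i" and y: "y \<in> H" and dy: "dy \<in> H" using x s by (auto simp: W_dom_def W_dirs_def s_eq)
  then have nz: "\<And>i. \<beta> $ i \<noteq> 0" by (metis less_irrefl)
  have act2: "act2 D \<beta> z = - act1 D \<beta> z" by (auto simp: act1_def act2_def)
  have "h_bb D \<beta> y d\<beta> + h_by D \<beta> y dy = hess_b \<beta> y (d\<beta>, dy)"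
    unfolding h_bb_eq[OF \<beta> y] h_by_eq[OF nz y dy] by (simp add: hess_b_def vec_eq_iff)
  moreover have "h_yb D \<beta> y d\<beta> + h_yy D \<beta> y dy = hess_y \<beta> y (d\<beta>, dy)"
    unfolding h_yb_eq[OF nz y] h_yy_eq[OF y dy] hess_y_def fst_conv snd_conv sum_subtractf scaleR_minus_left sum_negf
    by (simp add: scaleR_diff_right)
  ultimately show ?thesis
    by (simp add: newton_W'_def newton_op_def s_eq A_adj_eq B_adj_eq act2)
qed

lemma act3_sets: "act3 D p \<in> sets lebesgue"
proof -
  have [measurable]: "Dom D \<in> sets lebesgue" by (rule Dom_sets)
  have "act3 D p = Dom D \<inter> {x \<in> space lebesgue. L2_fun (u_a D) x \<le> L2_fun (ctrl D p) x \<and> L2_fun (ctrl D p) x \<le> L2_fun (u_b D) x}"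
    by (auto simp: act3_def)
  also have "\<dots> \<in> sets lebesgue" by measurable
  finally show ?thesis .
qed

lemma mult_ind_in_U: "S \<in> sets lebesgue \<Longrightarrow> w \<in> U \<Longrightarrow> mult_ind S w \<in> U"
  by (simp add: L2_on_iff_mult_ind[OF Dom_sets] mult_ind_commute[OF Dom_sets])

lemma cutoff_mult_ind: "S \<in> sets lebesgue \<Longrightarrow> cutoff (mult_ind S)"
  by (auto simp: cutoff_def bounded_linear_mult_ind mult_ind_in_U mult_ind_idem inner_mult_ind)

lemma hess_form:
  "inner (hess_b \<beta> y w) (fst w') + blinfun_apply (hess_y \<beta> y w) (snd w')
   = inner (blinfun_apply Emb (snd w)) (blinfun_apply Emb (snd w'))
     + (\<Sum>i\<in>UNIV. (3 * sig_b D * inverse (\<beta> $ i) ^ 4 + gam D * inverse (\<beta> $ i) ^ 3 * (norm (res i y))\<^sup>2) * (fst w $ i * fst w' $ i)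
        + gam D * (inverse (\<beta> $ i) * inner (blinfun_apply (CP i) (snd w)) (blinfun_apply (CP i) (snd w'))
          - inverse (\<beta> $ i) ^ 2 * (fst w' $ i * inner (res i y) (blinfun_apply (CP i) (snd w))
            + fst w $ i * inner (res i y) (blinfun_apply (CP i) (snd w')))))"
  unfolding hess_b_def hess_y_def inner_vec_def
  by (simp add: pull_apply blinfun.add_left blinfun.scaleR_left blinfun.sum_left blinfun.diff_left
      sum_distrib_left sum.distrib[symmetric] inner_commute algebra_simps)

definition hess_bound :: "real \<Rightarrow> real \<Rightarrow> real" where
  "hess_bound S R = (\<Sum>i\<in>UNIV. 3 * sig_b D * S ^ 4 + gam D * S ^ 3 * R\<^sup>2 + gam D * S\<^sup>2 * (R * norm (CP i)))
     + (norm Emb * norm Emb + gam D * (\<Sum>i\<in>UNIV. S * (norm (CP i) * norm (CP i)) + S\<^sup>2 * (norm (CP i) * R)))"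

lemma hess_linear:
  shows "hess_b \<beta> y (w + w') = hess_b \<beta> y w + hess_b \<beta> y w'" "hess_y \<beta> y (w + w') = hess_y \<beta> y w + hess_y \<beta> y w'"
    and "hess_b \<beta> y (t *\<^sub>R w) = t *\<^sub>R hess_b \<beta> y w" "hess_y \<beta> y (t *\<^sub>R w) = t *\<^sub>R hess_y \<beta> y w"
proof -
  show "hess_b \<beta> y (w + w') = hess_b \<beta> y w + hess_b \<beta> y w'" "hess_y \<beta> y (w + w') = hess_y \<beta> y w + hess_y \<beta> y w'"
    by (simp_all add: hess_b_def hess_y_def vec_eq_iff inner_add_right blinfun.add_right algebra_simps
        linear_add[OF bounded_linear.linear[OF bounded_linear_pull]] scaleR_sum_right sum.distrib[symmetric] sum_subtractf)
  show "hess_b \<beta> y (t *\<^sub>R w) = t *\<^sub>R hess_b \<beta> y w" "hess_y \<beta> y (t *\<^sub>R w) = t *\<^sub>R hess_y \<beta> y w"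
    by (simp_all add: hess_b_def hess_y_def vec_eq_iff blinfun.scaleR_right algebra_simps
        linear_scale[OF bounded_linear.linear[OF bounded_linear_pull]] scaleR_sum_right)
qed

lemma norm_hess_le:
  assumes pos: "0 \<le> S" "0 \<le> R" and \<beta>: "\<And>i. 0 < \<beta> $ i" "\<And>i. inverse (\<beta> $ i) \<le> S"
    and R: "\<And>i. norm (res i y) \<le> R"
  shows "norm (hess_b \<beta> y w) \<le> hess_bound S R * norm w" and "norm (hess_y \<beta> y w) \<le> hess_bound S R * norm w"
proof -
  note sg = sig_b gam
  define k1 where "k1 = (\<Sum>i\<in>UNIV. 3 * sig_b D * S ^ 4 + gam D * S ^ 3 * R\<^sup>2 + gam D * S\<^sup>2 * (R * norm (CP i)))"
  define k2 where "k2 = norm Emb * norm Emb + gam D * (\<Sum>i\<in>UNIV. S * (norm (CP i) * norm (CP i)) + S\<^sup>2 * (norm (CP i) * R))"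
  have k: "hess_bound S R = k1 + k2" "0 \<le> k1" "0 \<le> k2"
    using pos sg by (auto simp: hess_bound_def k1_def k2_def intro!: sum_nonneg add_nonneg_nonneg mult_nonneg_nonneg)
  have spos: "0 \<le> inverse (\<beta> $ i)" for i using \<beta>(1)[of i] by simp
  have sp: "inverse (\<beta> $ i) ^ n \<le> S ^ n" for i n using \<beta>(2) spos by (rule power_mono)
  have e: "norm (blinfun_apply (CP i) (snd w)) \<le> norm (CP i) * norm w" for i w
    using norm_blinfun[of "CP i" "snd w"] mult_left_mono[OF norm_snd_le[of "snd w" "fst w"], of "norm (CP i)"] by simp
  have d: "\<bar>fst w $ i\<bar> \<le> norm w" for i and w :: "(real^'n) \<times> 'l H1"
    using component_le_norm_cart[of "fst w" i] norm_fst_le[of "fst w" "snd w"] by simp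
  have b1: "norm (hess_b \<beta> y w) \<le> k1 * norm w"
  proof -
    have "norm (hess_b \<beta> y w) \<le> (\<Sum>i\<in>UNIV. \<bar>hess_b \<beta> y w $ i\<bar>)" by (rule norm_le_l1_cart)
    also have "\<dots> \<le> (\<Sum>i\<in>UNIV. (3 * sig_b D * S ^ 4 + gam D * S ^ 3 * R\<^sup>2) * norm w + gam D * S\<^sup>2 * (R * (norm (CP i) * norm w)))"
    proof (rule sum_mono)
      fix i
      have "\<bar>hess_b \<beta> y w $ i\<bar> \<le> \<bar>(3 * sig_b D * inverse (\<beta> $ i) ^ 4 + gam D * inverse (\<beta> $ i) ^ 3 * (norm (res i y))\<^sup>2) * fst w $ i\<bar>
          + \<bar>gam D * inverse (\<beta> $ i) ^ 2 * inner (res i y) (blinfun_apply (CP i) (snd w))\<bar>"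
        unfolding hess_b_def vec_lambda_beta by (rule abs_triangle_ineq4)
      also have "\<dots> \<le> (3 * sig_b D * S ^ 4 + gam D * S ^ 3 * R\<^sup>2) * norm w + gam D * S\<^sup>2 * (R * (norm (CP i) * norm w))"
      proof (rule add_mono)
        have "3 * sig_b D * inverse (\<beta> $ i) ^ 4 + gam D * inverse (\<beta> $ i) ^ 3 * (norm (res i y))\<^sup>2
            \<le> 3 * sig_b D * S ^ 4 + gam D * S ^ 3 * R\<^sup>2"
          using sg spos R[of i] pos \<beta>(2) by (intro add_mono mult_mono power_mono) auto
        moreover have "0 \<le> 3 * sig_b D * inverse (\<beta> $ i) ^ 4 + gam D * inverse (\<beta> $ i) ^ 3 * (norm (res i y))\<^sup>2"
          using sg spos by simp
        ultimately show "\<bar>(3 * sig_b D * inverse (\<beta> $ i) ^ 4 + gam D * inverse (\<beta> $ i) ^ 3 * (norm (res i y))\<^sup>2) * fst w $ i\<bar>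
            \<le> (3 * sig_b D * S ^ 4 + gam D * S ^ 3 * R\<^sup>2) * norm w"
          unfolding abs_mult using d[of w i] by (intro mult_mono) auto
        have "\<bar>inner (res i y) (blinfun_apply (CP i) (snd w))\<bar> \<le> R * (norm (CP i) * norm w)"
          using Cauchy_Schwarz_ineq2[of "res i y" "blinfun_apply (CP i) (snd w)"]
            mult_mono[OF R[of i] e[of i w] pos(2)] by simp
        then show "\<bar>gam D * inverse (\<beta> $ i) ^ 2 * inner (res i y) (blinfun_apply (CP i) (snd w))\<bar> \<le> gam D * S\<^sup>2 * (R * (norm (CP i) * norm w))"
          unfolding abs_mult using sg sp[of i 2] spos[of i] pos by (intro mult_mono) auto
      qed
      finally show "\<bar>hess_b \<beta> y w $ i\<bar> \<le> (3 * sig_b D * S ^ 4 + gam D * S ^ 3 * R\<^sup>2) * norm w + gam D * S\<^sup>2 * (R * (norm (CP i) * norm w))" .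
    qed
    also have "\<dots> = k1 * norm w" unfolding k1_def sum_distrib_right by (rule sum.cong) (auto simp: algebra_simps)
    finally show ?thesis .
  qed
  have b2: "norm (hess_y \<beta> y w) \<le> k2 * norm w"
  proof -
    have Emb_w: "norm (blinfun_apply Emb (snd w)) \<le> norm Emb * norm w"
      using norm_blinfun[of Emb "snd w"] mult_left_mono[OF norm_snd_le[of "snd w" "fst w"], of "norm Emb"] by simp
    have Emb: "norm (pull Emb (blinfun_apply Emb (snd w))) \<le> norm Emb * (norm Emb * norm w)"
      using norm_pull_le[where T=Emb and c="blinfun_apply Emb (snd w)"]
        mult_left_mono[OF Emb_w, of "norm Emb"] by simp
    have "norm (\<Sum>i\<in>UNIV. inverse (\<beta> $ i) *\<^sub>R pull (CP i) (blinfun_apply (CP i) (snd w))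
        - (fst w $ i * inverse (\<beta> $ i) ^ 2) *\<^sub>R pull (CP i) (res i y))
      \<le> (\<Sum>i\<in>UNIV. S * (norm (CP i) * (norm (CP i) * norm w)) + norm w * S\<^sup>2 * (norm (CP i) * R))"
    proof (rule sum_norm_le)
      fix i
      have "norm (inverse (\<beta> $ i) *\<^sub>R pull (CP i) (blinfun_apply (CP i) (snd w)) - (fst w $ i * inverse (\<beta> $ i) ^ 2) *\<^sub>R pull (CP i) (res i y))
          \<le> norm (inverse (\<beta> $ i) *\<^sub>R pull (CP i) (blinfun_apply (CP i) (snd w))) + norm ((fst w $ i * inverse (\<beta> $ i) ^ 2) *\<^sub>R pull (CP i) (res i y))"
        by (rule norm_triangle_ineq4)
      also have "\<dots> \<le> S * (norm (CP i) * (norm (CP i) * norm w)) + norm w * S\<^sup>2 * (norm (CP i) * R)"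
      proof (rule add_mono)
        have "norm (pull (CP i) (blinfun_apply (CP i) (snd w))) \<le> norm (CP i) * (norm (CP i) * norm w)"
          using norm_pull_le[where T="CP i" and c="blinfun_apply (CP i) (snd w)"] mult_left_mono[OF e[of i w], of "norm (CP i)"] by simp
        then show "norm (inverse (\<beta> $ i) *\<^sub>R pull (CP i) (blinfun_apply (CP i) (snd w))) \<le> S * (norm (CP i) * (norm (CP i) * norm w))"
          unfolding norm_scaleR using spos[of i] \<beta>(2)[of i] pos by (intro mult_mono) auto
        have "norm (pull (CP i) (res i y)) \<le> norm (CP i) * R"
          using norm_pull_le[where T="CP i" and c="res i y"] mult_left_mono[OF R[of i], of "norm (CP i)"] by simp
        then show "norm ((fst w $ i * inverse (\<beta> $ i) ^ 2) *\<^sub>R pull (CP i) (res i y)) \<le> norm w * S\<^sup>2 * (norm (CP i) * R)"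
          unfolding norm_scaleR abs_mult using d[of w i] sp[of i 2] spos[of i] pos by (intro mult_mono) auto
      qed
      finally show "norm (inverse (\<beta> $ i) *\<^sub>R pull (CP i) (blinfun_apply (CP i) (snd w)) - (fst w $ i * inverse (\<beta> $ i) ^ 2) *\<^sub>R pull (CP i) (res i y))
          \<le> S * (norm (CP i) * (norm (CP i) * norm w)) + norm w * S\<^sup>2 * (norm (CP i) * R)" .
    qed
    then have "gam D * norm (\<Sum>i\<in>UNIV. inverse (\<beta> $ i) *\<^sub>R pull (CP i) (blinfun_apply (CP i) (snd w))
        - (fst w $ i * inverse (\<beta> $ i) ^ 2) *\<^sub>R pull (CP i) (res i y))
      \<le> gam D * (\<Sum>i\<in>UNIV. S * (norm (CP i) * (norm (CP i) * norm w)) + norm w * S\<^sup>2 * (norm (CP i) * R))"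
      using sg by (simp add: mult_left_mono)
    with Emb have "norm (hess_y \<beta> y w) \<le> norm Emb * (norm Emb * norm w) + gam D * (\<Sum>i\<in>UNIV. S * (norm (CP i) * (norm (CP i) * norm w)) + norm w * S\<^sup>2 * (norm (CP i) * R))"
      unfolding hess_y_def using sg
      by (intro order_trans[OF norm_triangle_ineq] add_mono) simp_all
    also have "(\<Sum>i\<in>UNIV. S * (norm (CP i) * (norm (CP i) * norm w)) + norm w * S\<^sup>2 * (norm (CP i) * R))
        = (\<Sum>i\<in>UNIV. S * (norm (CP i) * norm (CP i)) + S\<^sup>2 * (norm (CP i) * R)) * norm w"
      unfolding sum_distrib_right by (rule sum.cong) (auto simp: algebra_simps)
    finally show ?thesis by (simp add: k2_def algebra_simps)
  qed
  show "norm (hess_b \<beta> y w) \<le> hess_bound S R * norm w" "norm (hess_y \<beta> y w) \<le> hess_bound S R * norm w"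
    using b1 b2 k mult_right_mono[of k1 "k1 + k2" "norm w"] mult_right_mono[of k2 "k1 + k2" "norm w"] by auto
qed

text \<open>With \<open>s = 1 / \<beta>_i\<close>, \<open>c = C_i y - y_d,i\<close>, \<open>e = C_i dy\<close> and \<open>d = d\<beta>_i\<close>, the contribution of the i-th misfit to
  the quadratic form is the square \<open>\<gamma> s |e - s d c|^2\<close>, which reflects the joint convexity of \<open>|c|^2 / \<beta>_i\<close>.
  What remains is at least the second derivative of the term \<open>\<beta>_i^(-2)\<close>.\<close>

lemma hess_coercive:
  assumes b1: "0 < b1" and \<beta>: "\<And>i. 0 < \<beta> $ i" "\<And>i. \<beta> $ i \<le> b1"
  shows "3 * sig_b D * inverse b1 ^ 4 * (norm (fst w))\<^sup>2 \<le> inner (hess_b \<beta> y w) (fst w) + blinfun_apply (hess_y \<beta> y w) (snd w)"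
proof -
  note sg = sig_b gam
  have "3 * sig_b D * inverse b1 ^ 4 * (norm (fst w))\<^sup>2 = (\<Sum>i\<in>UNIV. 3 * sig_b D * inverse b1 ^ 4 * (fst w $ i)\<^sup>2)"
    unfolding power2_norm_eq_inner inner_vec_def sum_distrib_left by (simp add: power2_eq_square)
  also have "\<dots> \<le> (\<Sum>i\<in>UNIV. (3 * sig_b D * inverse (\<beta> $ i) ^ 4 + gam D * inverse (\<beta> $ i) ^ 3 * (norm (res i y))\<^sup>2) * (fst w $ i * fst w $ i)
      + gam D * (inverse (\<beta> $ i) * inner (blinfun_apply (CP i) (snd w)) (blinfun_apply (CP i) (snd w))
        - inverse (\<beta> $ i) ^ 2 * (fst w $ i * inner (res i y) (blinfun_apply (CP i) (snd w))
          + fst w $ i * inner (res i y) (blinfun_apply (CP i) (snd w)))))"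
  proof (rule sum_mono)
    fix i
    let ?s = "inverse (\<beta> $ i)" and ?c = "res i y" and ?e = "blinfun_apply (CP i) (snd w)" and ?d = "fst w $ i"
    have "inverse b1 \<le> ?s" using \<beta>(1,2)[of i] by (simp add: le_imp_inverse_le)
    then have "inverse b1 ^ 4 \<le> ?s ^ 4" using b1 by (intro power_mono) auto
    then have 1: "3 * sig_b D * inverse b1 ^ 4 * ?d\<^sup>2 \<le> 3 * sig_b D * ?s ^ 4 * ?d\<^sup>2"
      using sg by (intro mult_right_mono mult_left_mono) auto
    \<comment> \<open>The remaining terms form a complete square.\<close>
    have "0 \<le> gam D * ?s * inner (?e - (?s * ?d) *\<^sub>R ?c) (?e - (?s * ?d) *\<^sub>R ?c)"
      using sg \<beta>(1)[of i] by simp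
    also have "\<dots> = gam D * ?s * (inner ?e ?e - 2 * (?s * ?d) * inner ?c ?e + (?s * ?d)\<^sup>2 * inner ?c ?c)"
      by (simp add: inner_diff_left inner_diff_right inner_commute algebra_simps power2_eq_square)
    finally have "0 \<le> gam D * ?s * (inner ?e ?e - 2 * (?s * ?d) * inner ?c ?e + (?s * ?d)\<^sup>2 * (norm ?c)\<^sup>2)"
      by (simp add: power2_norm_eq_inner)
    also have "\<dots> = gam D * ?s ^ 3 * (norm ?c)\<^sup>2 * ?d\<^sup>2 + gam D * (?s * inner ?e ?e - ?s ^ 2 * (?d * inner ?c ?e + ?d * inner ?c ?e))"
      by (simp add: algebra_simps power2_eq_square power3_eq_cube)
    finally show "3 * sig_b D * inverse b1 ^ 4 * ?d\<^sup>2
      \<le> (3 * sig_b D * ?s ^ 4 + gam D * ?s ^ 3 * (norm ?c)\<^sup>2) * (?d * ?d) + gam D * (?s * inner ?e ?e - ?s ^ 2 * (?d * inner ?c ?e + ?d * inner ?c ?e))"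
      using 1 by (simp add: distrib_right power2_eq_square[of ?d])
  qed
  also have "\<dots> \<le> inner (hess_b \<beta> y w) (fst w) + blinfun_apply (hess_y \<beta> y w) (snd w)"
    unfolding hess_form by simp
  finally show ?thesis .
qed

lemma coercive_hessian_near:
  assumes pos: "0 < b1" "0 \<le> S" "0 \<le> R"
    and \<beta>: "\<And>i. 0 < \<beta> $ i" "\<And>i. \<beta> $ i \<le> b1" "\<And>i. inverse (\<beta> $ i) \<le> S"
    and R: "\<And>i. norm (res i y) \<le> R"
  shows "coercive_hessian (3 * sig_b D * inverse b1 ^ 4) (hess_bound S R) (hess_b \<beta> y) (hess_y \<beta> y)"
proof -
  note kb = norm_hess_le[OF pos(2,3) \<beta>(1,3) R]
  show ?thesis
    unfolding coercive_hessian_def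
  proof (intro conjI ballI)
    show "bounded_linear_on (UNIV \<times> H) (hess_b \<beta> y)" "bounded_linear_on (UNIV \<times> H) (hess_y \<beta> y)"
      unfolding bounded_linear_on_def using hess_linear kb by blast+
    show "hess_y \<beta> y ` (UNIV \<times> H) \<subseteq> dual_of H"
      unfolding hess_y_def
      by (intro image_subsetI subspace_add subspace_scale subspace_sum subspace_diff pull_CP_in pull_Emb_in subspace_dual_of[OF H])
    show "inner (hess_b \<beta> y w) (fst w') + blinfun_apply (hess_y \<beta> y w) (snd w')
        = inner (hess_b \<beta> y w') (fst w) + blinfun_apply (hess_y \<beta> y w') (snd w)" for w w'
      unfolding hess_form by (simp add: inner_commute algebra_simps)
  qed (use kb hess_coercive[OF pos(1) \<beta>(1,2)] in auto)
qed

section \<open>The Newton derivative of \<open>W\<close>\<close>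

lemma W_dirs_subspace: "subspace (W_dirs D)"
  unfolding W_dirs_def using H(1) U(1) by (intro subspace_Times) auto

lemma W_dom_subset: "W_dom D \<subseteq> W_dirs D"
  by (auto simp: W_dom_def W_dirs_def)

lemma ctrl_in: "ctrl D p \<in> U"
  unfolding ctrl_def B_adj_eq
  by (intro subspace_scale subspace_add U(1) B'_in u_m)

abbreviation "clipped p \<equiv> L2_clip (u_a D) (u_b D) (ctrl D p)"

lemma clipped_in: "clipped p \<in> U"
proof -
  have out: "AE t in lebesgue. t \<notin> Dom D \<longrightarrow> L2_fun u t = 0" if "u \<in> U" for u
    using that by (simp add: L2_on_def)
  show ?thesis
    unfolding L2_on_def mem_Collect_eq
    using AE_L2_fun_clip[of "u_a D" "u_b D" "ctrl D p"] out[OF u_a] out[OF u_b] out[OF ctrl_in[of p]]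
    by eventually_elim auto
qed

lemma newton_W_eq:
  assumes "(\<beta>, y, u, z, p) \<in> W_dom D"
  shows "newton_W D (\<beta>, y, u, z, p) =
     (grad_F \<beta> + gam D *\<^sub>R (grad_f \<beta> y - a_T D) + transpose (K_T D) *v z,
      der_F y + gam D *\<^sub>R der_f \<beta> y + A' p, u - clipped p,
      \<chi> i. max ((K_T D *v \<beta> - b_T D) $ i) (- (z $ i)), op_A D y - op_B D u)"
proof -
  have "\<And>i. \<beta> $ i \<noteq> 0" "y \<in> H" using assms by (auto simp: W_dom_def less_imp_neq[symmetric])
  then show ?thesis by (simp add: newton_W_def h_b_eq h_y_eq A_adj_eq L2_clip_def)
qed

lemma newton_W_range:
  assumes x: "(\<beta>, y, u, z, p) \<in> W_dom D" and W: "newton_W D (\<beta>, y, u, z, p) = (r1, r2, r3, r4, r5)"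
  shows "r2 \<in> dual_of H" "r3 \<in> U" "r5 \<in> dual_of H"
proof -
  have mem: "y \<in> H" "u \<in> U" using x by (auto simp: W_dom_def)
  note sub = subspace_dual_of[OF H]
  have r: "r2 = der_F y + gam D *\<^sub>R der_f \<beta> y + A' p" "r3 = u - clipped p" "r5 = op_A D y - op_B D u"
    using W unfolding newton_W_eq[OF x] by auto
  show "r2 \<in> dual_of H" unfolding r by (intro subspace_add subspace_scale sub der_F_in der_f_in A'_in)
  show "r3 \<in> U" unfolding r by (intro subspace_diff U(1) mem clipped_in)
  show "r5 \<in> dual_of H" unfolding r by (intro subspace_diff sub A_in B_in mem)
qed

text \<open>The derivative of each component arises from the calculus of Newton derivatives; comparison with the rows of
  \<open>newton_W'\<close> is algebra.\<close>

lemma newton_diff_newton_W: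
  assumes a: "a \<in> W_dom D" and lohi: "AE t in lebesgue. L2_fun (u_a D) t \<le> L2_fun (u_b D) t"
    and \<kappa>: "0 \<le> \<kappa>" and \<alpha>: "0 < \<alpha>"
    and gap: "\<And>E p. E \<in> sets lebesgue \<Longrightarrow> E \<subseteq> Dom D \<Longrightarrow>
      norm (mult_ind E (B' p)) \<le> \<kappa> * norm p * measure lebesgue E powr \<alpha>"
  shows "newton_diff (newton_W D) (newton_W' D) a (W_dom D)"
proof -
  let ?X = "W_dom D"
  have sub: "?X \<subseteq> W_dirs D" "a \<in> W_dirs D" using a W_dom_subset by auto
  note bl = bounded_linear_fst_comp bounded_linear_snd_comp bounded_linear_ident
  have nz: "fst a $ i \<noteq> 0" for i using a by (auto simp: W_dom_def less_imp_neq[symmetric])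
  have b: "newton_diff (\<lambda>x. fst x $ i) (\<lambda>x d. fst d $ i) a ?X" for i
    by (rule newton_diff_linear, rule bounded_linear_compose[OF bounded_linear_vec_nth bounded_linear_fst])
  note s = newton_diff_inverse[OF b nz]
  have c: "newton_diff (\<lambda>x. res i (fst (snd x))) (\<lambda>x d. blinfun_apply (CP i) (fst (snd d))) a ?X" for i
  proof -
    have "newton_diff (\<lambda>x. blinfun_apply (CP i) (fst (snd x)) - y_d D i) (\<lambda>x d. blinfun_apply (CP i) (fst (snd d)) - 0) a ?X"
      by (intro newton_diff_diff newton_diff_const newton_diff_linear bounded_linear_compose[OF blinfun.bounded_linear_right] bl)
    then show ?thesis by (simp add: res_def)
  qed
  note ss = newton_diff_bilinear[OF bounded_bilinear_mult s s]
  note sss = newton_diff_bilinear[OF bounded_bilinear_mult s ss]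
  note cc = newton_diff_bilinear[OF bounded_bilinear_inner c c]
  note sscc = newton_diff_bilinear[OF bounded_bilinear_mult ss cc]
  have comp1: "newton_diff (\<lambda>x. grad_F (fst x) + gam D *\<^sub>R (grad_f (fst x) (fst (snd x)) - a_T D))
     (\<lambda>x d. hess_b (fst x) (fst (snd x)) (fst d, fst (snd d))) a ?X"
  proof (rule newton_diff_vec)
    fix i
    note newton_diff_add[OF newton_diff_add[OF
        newton_diff_compose_linear[OF bounded_linear_mult_right[of "- sig_b D"] sss[of i i i]]
        newton_diff_compose_linear[OF bounded_linear_mult_right[of "- (gam D / 2)"] sscc[of i i i i]]]
        newton_diff_const[of "- (gam D * a_T D $ i)"]]
    then show "newton_diff (\<lambda>x. (grad_F (fst x) + gam D *\<^sub>R (grad_f (fst x) (fst (snd x)) - a_T D)) $ i)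
        (\<lambda>x d. hess_b (fst x) (fst (snd x)) (fst d, fst (snd d)) $ i) a ?X"
      unfolding grad_F_def grad_f_def hess_b_def power2_norm_eq_inner
      by (rule newton_diff_cong)
        (auto intro!: always_eventually simp: inner_commute power2_eq_square power3_eq_cube power4_eq_xxxx algebra_simps)
  qed
  have z1: "newton_diff (\<lambda>x. transpose (K_T D) *v fst (snd (snd (snd x)))) (\<lambda>x d. transpose (K_T D) *v fst (snd (snd (snd d)))) a ?X"
    by (intro newton_diff_linear bounded_linear_compose[OF matrix_vector_mul_bounded_linear] bl)
  have comp2: "newton_diff (\<lambda>x. der_F (fst (snd x)) + gam D *\<^sub>R der_f (fst x) (fst (snd x)))
     (\<lambda>x d. hess_y (fst x) (fst (snd x)) (fst d, fst (snd d))) a ?X"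
  proof -
    have E: "newton_diff (\<lambda>x. der_F (fst (snd x))) (\<lambda>x d. pull Emb (blinfun_apply Emb (fst (snd d)) - 0)) a ?X"
      unfolding der_F_def
      by (intro newton_diff_compose_linear[OF bounded_linear_pull] newton_diff_diff newton_diff_const newton_diff_linear
          bounded_linear_compose[OF blinfun.bounded_linear_right] bl)
    have F: "newton_diff (\<lambda>x. gam D *\<^sub>R der_f (fst x) (fst (snd x)))
      (\<lambda>x d. gam D *\<^sub>R (\<Sum>i\<in>UNIV. inverse (fst x $ i) *\<^sub>R pull (CP i) (blinfun_apply (CP i) (fst (snd d)))
        + (- (inverse (fst x $ i) * inverse (fst x $ i)) * fst d $ i) *\<^sub>R pull (CP i) (res i (fst (snd x))))) a ?X"
      unfolding der_f_def
      by (intro newton_diff_compose_linear[OF bounded_linear_scaleR_right] newton_diff_sum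
          newton_diff_bilinear[OF bounded_bilinear_scaleR s] newton_diff_compose_linear[OF bounded_linear_pull] c)
    show ?thesis
      by (rule newton_diff_cong[OF newton_diff_add[OF E F]])
        (auto intro!: always_eventually sum.cong arg_cong[of _ _ "\<lambda>v. _ + gam D *\<^sub>R v"]
          simp: hess_y_def power2_eq_square mult_ac)
  qed
  have p1: "newton_diff (\<lambda>x. A' (snd (snd (snd (snd x))))) (\<lambda>x d. A' (snd (snd (snd (snd d))))) a ?X"
    by (intro newton_diff_linear bounded_linear_compose[OF bounded_linear_A'] bl)
  have u1: "newton_diff (\<lambda>x. fst (snd (snd x))) (\<lambda>x d. fst (snd (snd d))) a ?X"
    by (intro newton_diff_linear bl)
  have comp3: "newton_diff (\<lambda>x. clipped (snd (snd (snd (snd x)))))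
      (\<lambda>x d. mult_ind (act3 D (snd (snd (snd (snd x))))) (B' (snd (snd (snd (snd d)))) /\<^sub>R sig_hat D)) a ?X"
    unfolding act3_def
  proof (rule newton_diff_clip[OF Dom_lmeasurable lohi u_a u_b ctrl_in, where K="\<kappa> / sig_hat D" and \<alpha>=\<alpha>])
    let ?p = "\<lambda>x. snd (snd (snd (snd x)))"
    have diff: "ctrl D (?p x) - ctrl D (?p a) = B' (?p (x - a)) /\<^sub>R sig_hat D" for x
      by (simp add: ctrl_def B_adj_eq linear_diff[OF bounded_linear.linear[OF bounded_linear_B']] flip: scaleR_diff_right)
    then show "ctrl D (?p x) - ctrl D (?p a) = B' (?p (x - a)) /\<^sub>R sig_hat D" for x .
    fix x E assume E: "E \<in> sets lebesgue" "E \<subseteq> Dom D"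
    have "norm (mult_ind E (ctrl D (?p x) - ctrl D (?p a))) = norm (mult_ind E (B' (?p (x - a)))) / sig_hat D"
      unfolding diff mult_ind_scaleR[OF E(1)] using sig_hat by (simp add: field_simps)
    also have "\<dots> \<le> \<kappa> * norm (?p (x - a)) * measure lebesgue E powr \<alpha> / sig_hat D"
      using gap[OF E] sig_hat by (simp add: divide_right_mono)
    also have "\<dots> \<le> \<kappa> * norm (x - a) * measure lebesgue E powr \<alpha> / sig_hat D"
    proof -
      have pv: "norm (?p v) \<le> norm v" for v :: "('l, 'n, 'm) iterate"
        using norm_Pair5_ge(5)[where a="fst v" and b="fst (snd v)" and c="fst (snd (snd v))" and d="fst (snd (snd (snd v)))" and e="?p v"]
        by simp
      show ?thesis
        by (intro divide_right_mono mult_right_mono mult_left_mono pv \<kappa> powr_ge_zero less_imp_le[OF sig_hat])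
    qed
    finally show "norm (mult_ind E (ctrl D (?p x) - ctrl D (?p a))) \<le> \<kappa> / sig_hat D * norm (x - a) * measure lebesgue E powr \<alpha>"
      by simp
  qed (use \<kappa> \<alpha> sig_hat in auto)
  have comp4: "newton_diff (\<lambda>x. \<chi> i. max ((K_T D *v fst x - b_T D) $ i) (- (fst (snd (snd (snd x))) $ i)))
     (\<lambda>x d. \<chi> i. if - (fst (snd (snd (snd x))) $ i) \<le> (K_T D *v fst x - b_T D) $ i then (K_T D *v fst d) $ i - 0
        else - (fst (snd (snd (snd d))) $ i)) a ?X"
  proof (rule newton_diff_vec, unfold vec_lambda_beta vector_minus_component, rule newton_diff_max)
    fix i
    show "newton_diff (\<lambda>x. (K_T D *v fst x) $ i - b_T D $ i) (\<lambda>x d. (K_T D *v fst d) $ i - 0) a ?X"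
      by (intro newton_diff_diff newton_diff_const newton_diff_linear bl bounded_linear_compose[OF bounded_linear_vec_nth]
          bounded_linear_compose[OF matrix_vector_mul_bounded_linear])
    show "newton_diff (\<lambda>x. - (fst (snd (snd (snd x))) $ i)) (\<lambda>x d. - (fst (snd (snd (snd d))) $ i)) a ?X"
      by (intro newton_diff_linear bl bounded_linear_minus bounded_linear_compose[OF bounded_linear_vec_nth])
  qed
  have comp5: "newton_diff (\<lambda>x. op_A D (fst (snd x)) - op_B D (fst (snd (snd x))))
      (\<lambda>x d. op_A D (fst (snd d)) - op_B D (fst (snd (snd d)))) a ?X"
  proof (rule newton_diff_diff)
    have "bounded_linear_on (W_dirs D) (\<lambda>x. op_A D (fst (snd x)))"
      by (rule bounded_linear_on_compose[OF _ _ op_A]) (auto intro!: bl simp: W_dirs_def)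
    then show "newton_diff (\<lambda>x. op_A D (fst (snd x))) (\<lambda>x d. op_A D (fst (snd d))) a ?X"
      using newton_diff_bounded_linear_on[OF _ W_dirs_subspace sub] by blast
    have "bounded_linear_on (W_dirs D) (\<lambda>x. op_B D (fst (snd (snd x))))"
      by (rule bounded_linear_on_compose[OF _ _ op_B]) (auto intro!: bl simp: W_dirs_def)
    then show "newton_diff (\<lambda>x. op_B D (fst (snd (snd x)))) (\<lambda>x d. op_B D (fst (snd (snd d)))) a ?X"
      using newton_diff_bounded_linear_on[OF _ W_dirs_subspace sub] by blast
  qed
  note all = newton_diff_Pair[OF newton_diff_add[OF comp1 z1] newton_diff_Pair[OF newton_diff_add[OF comp2 p1]
        newton_diff_Pair[OF newton_diff_diff[OF u1 comp3] newton_diff_Pair[OF comp4 comp5]]]]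
  have W: "(grad_F (fst x) + gam D *\<^sub>R (grad_f (fst x) (fst (snd x)) - a_T D) + transpose (K_T D) *v fst (snd (snd (snd x))),
     der_F (fst (snd x)) + gam D *\<^sub>R der_f (fst x) (fst (snd x)) + A' (snd (snd (snd (snd x)))),
     fst (snd (snd x)) - clipped (snd (snd (snd (snd x)))),
     \<chi> i. max ((K_T D *v fst x - b_T D) $ i) (- (fst (snd (snd (snd x))) $ i)),
     op_A D (fst (snd x)) - op_B D (fst (snd (snd x)))) = newton_W D x" if "x \<in> ?X" for x
  proof -
    obtain \<beta> y u z p where x_eq: "x = (\<beta>, y, u, z, p)" by (metis prod_cases5)
    show ?thesis unfolding x_eq fst_conv snd_conv by (rule newton_W_eq[symmetric]) (use that in \<open>simp add: x_eq\<close>)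
  qed
  have W': "(hess_b (fst x) (fst (snd x)) (fst d, fst (snd d)) + transpose (K_T D) *v fst (snd (snd (snd d))),
     hess_y (fst x) (fst (snd x)) (fst d, fst (snd d)) + A' (snd (snd (snd (snd d)))),
     fst (snd (snd d)) - mult_ind (act3 D (snd (snd (snd (snd x))))) (B' (snd (snd (snd (snd d)))) /\<^sub>R sig_hat D),
     \<chi> i. if - (fst (snd (snd (snd x))) $ i) \<le> (K_T D *v fst x - b_T D) $ i then (K_T D *v fst d) $ i - 0
        else - (fst (snd (snd (snd d))) $ i),
     op_A D (fst (snd d)) - op_B D (fst (snd (snd d)))) = newton_W' D x d"
    if x: "x \<in> ?X" and d: "d \<in> W_dirs D" for x d
  proof -
    obtain \<beta> y u z p where x_eq: "x = (\<beta>, y, u, z, p)" by (metis prod_cases5)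
    obtain d\<beta> dy du dz dp where d_eq: "d = (d\<beta>, dy, du, dz, dp)" by (metis prod_cases5)
    show ?thesis
      using newton_W'_eq[of \<beta> y u z p d] x d
      by (simp add: x_eq d_eq newton_op_def mult_ind_scaleR[OF act3_sets] vec_eq_iff diag_ind_nth act1_def)
  qed
  show ?thesis
  proof (rule newton_diff_cong[OF all], goal_cases)
    case 1
    show ?case by (rule W[OF a])
  next
    case 2
    have "\<forall>\<^sub>F x in at a within ?X. x \<in> ?X" by (simp add: eventually_at_filter)
    then show ?case
    proof eventually_elim
      case (elim x)
      have "x - a \<in> W_dirs D" using elim sub by (intro subspace_diff[OF W_dirs_subspace]) auto
      with elim show ?case by (intro conjI W W')
    qed
  qed
qed

section \<open>The KKT point as a regular root\<close>

text \<open>For \<open>v = \<chi>_E B* p\<close>, \<open>(norm v)^2 = \<langle>v, B* p\<rangle> = (B v) p\<close>, and \<open>B v\<close> is bounded by the \<open>L^q\<close> norm of \<open>v\<close>.  Since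
  \<open>v\<close> lives on \<open>E\<close>, this norm is at most a multiple of \<open>norm v * |E|^(1/q - 1/2)\<close>.\<close>

lemma norm_gap:
  assumes q: "1 < q" "q < 2"
    and B_ext: "bounded_linear_on_Lp q (Dom D) B_ext" "\<And>v. v \<in> U \<Longrightarrow> B_ext (L2_fun v) = op_B D v"
  obtains \<kappa> where "0 \<le> \<kappa>" "\<And>E p. E \<in> sets lebesgue \<Longrightarrow> E \<subseteq> Dom D \<Longrightarrow>
      norm (mult_ind E (B' p)) \<le> \<kappa> * norm p * measure lebesgue E powr (1 / q - 1 / 2)"
proof -
  obtain k where k: "\<And>f. f \<in> Lp_fun q (Dom D) \<Longrightarrow> norm (B_ext f) \<le> k * Lp_norm q (Dom D) f"
    using B_ext(1) unfolding bounded_linear_on_Lp_def by blast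
  have "norm (mult_ind E (B' p)) \<le> (\<bar>k\<bar> * 2 powr (1 / q)) * norm p * measure lebesgue E powr (1 / q - 1 / 2)"
    if E: "E \<in> sets lebesgue" "E \<subseteq> Dom D" for E p
  proof (rule norm_le_of_inner_self)
    define v where "v = mult_ind E (B' p)"
    have v: "v \<in> U" "mult_ind E v = v"
      by (auto simp: v_def mult_ind_in_U[OF E(1) B'_in] mult_ind_idem[OF E(1)])
    note Lp = Lp_norm_le_L2_norm[OF Dom_lmeasurable E v(2), of q]
    have "inner v v = inner (B' p) v"
      using inner_mult_ind[OF E(1), of "B' p" v] v(2) by (simp add: v_def)
    also have "\<dots> = blinfun_apply (op_B D v) p" using v(1) by (rule inner_B')
    also have "\<dots> \<le> norm (op_B D v) * norm p" using norm_blinfun[of "op_B D v" p] by simp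
    also have "\<dots> \<le> (\<bar>k\<bar> * Lp_norm q (Dom D) (L2_fun v)) * norm p"
    proof (rule mult_right_mono)
      have "norm (op_B D v) \<le> k * Lp_norm q (Dom D) (L2_fun v)"
        using k[of "L2_fun v"] Lp(1) q B_ext(2)[OF v(1)] by simp
      also have "\<dots> \<le> \<bar>k\<bar> * Lp_norm q (Dom D) (L2_fun v)"
        by (intro mult_right_mono) (auto simp: Lp_norm_def)
      finally show "norm (op_B D v) \<le> \<bar>k\<bar> * Lp_norm q (Dom D) (L2_fun v)" .
    qed simp
    also have "\<dots> \<le> (\<bar>k\<bar> * (2 powr (1 / q) * norm v * measure lebesgue E powr (1 / q - 1 / 2))) * norm p"
      using Lp(2) q by (intro mult_right_mono mult_left_mono) auto
    finally show "inner (mult_ind E (B' p)) (mult_ind E (B' p))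
        \<le> (\<bar>k\<bar> * 2 powr (1 / q)) * norm p * measure lebesgue E powr (1 / q - 1 / 2) * norm (mult_ind E (B' p))"
      by (simp add: v_def mult_ac)
  qed simp
  then show ?thesis by (intro that[of "\<bar>k\<bar> * 2 powr (1 / q)"]) auto
qed

lemma U_ad_iff: "v \<in> U_ad D \<longleftrightarrow> v \<in> U \<and> (AE t in lebesgue. t \<in> Dom D \<longrightarrow> L2_fun (u_a D) t \<le> L2_fun v t \<and> L2_fun v t \<le> L2_fun (u_b D) t)"
proof -
  have "Dom D \<inter> space lebesgue \<in> sets lebesgue" using Dom_sets by simp
  then show ?thesis unfolding U_ad_def mem_Collect_eq by (simp only: AE_restrict_space_iff)
qed

lemma AE_bounds_ordered:
  assumes "U_ad D \<noteq> {}"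
  shows "AE t in lebesgue. L2_fun (u_a D) t \<le> L2_fun (u_b D) t"
proof -
  obtain v where "v \<in> U_ad D" using assms by blast
  then have "AE t in lebesgue. t \<in> Dom D \<longrightarrow> L2_fun (u_a D) t \<le> L2_fun v t \<and> L2_fun v t \<le> L2_fun (u_b D) t"
    by (simp add: U_ad_iff)
  moreover have "AE t in lebesgue. t \<notin> Dom D \<longrightarrow> L2_fun (u_a D) t = 0" "AE t in lebesgue. t \<notin> Dom D \<longrightarrow> L2_fun (u_b D) t = 0"
    using u_a u_b by (simp_all add: L2_on_def)
  ultimately show ?thesis
    by eventually_elim force
qed

lemma clipped_in_U_ad:
  assumes "AE t in lebesgue. L2_fun (u_a D) t \<le> L2_fun (u_b D) t"
  shows "clipped p \<in> U_ad D"
  unfolding U_ad_iff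
proof
  show "AE t in lebesgue. t \<in> Dom D \<longrightarrow> L2_fun (u_a D) t \<le> L2_fun (clipped p) t \<and> L2_fun (clipped p) t \<le> L2_fun (u_b D) t"
    using AE_L2_fun_clip[of "u_a D" "u_b D" "ctrl D p"] assms by eventually_elim simp
qed (rule clipped_in)

lemma clipped_variational:
  assumes v: "v \<in> U_ad D"
  shows "inner (ctrl D p - clipped p) (v - clipped p) \<le> 0"
proof -
  have out: "AE t in lebesgue. t \<notin> Dom D \<longrightarrow> L2_fun u t = 0" if "u \<in> U" for u
    using that by (simp add: L2_on_def)
  have vv: "v \<in> U" "AE t in lebesgue. t \<in> Dom D \<longrightarrow> L2_fun (u_a D) t \<le> L2_fun v t \<and> L2_fun v t \<le> L2_fun (u_b D) t"
    using v by (auto simp: U_ad_iff)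
  have "AE t in lebesgue. 0 \<le> - (L2_fun (ctrl D p - clipped p) t * L2_fun (v - clipped p) t)"
    using AE_L2_fun_diff[of "ctrl D p" "clipped p"] AE_L2_fun_diff[of v "clipped p"]
      AE_L2_fun_clip[of "u_a D" "u_b D" "ctrl D p"] vv(2) out[OF vv(1)] out[OF clipped_in[of p]]
  proof eventually_elim
    case (elim t)
    have clip: "(w - min (max w l) h) * (x - min (max w l) h) \<le> 0" if "l \<le> x" "x \<le> h" for w l h x :: real
      using that by (auto simp: min_def max_def mult_le_0_iff)
    show ?case
    proof (cases "t \<in> Dom D")
      case True
      then show ?thesis using clip elim by simp
    next
      case False
      then show ?thesis using elim(2,5,6) by simp
    qed
  qed
  then have "0 \<le> (LINT t|lebesgue. - (L2_fun (ctrl D p - clipped p) t * L2_fun (v - clipped p) t))"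
    by (rule integral_nonneg_AE)
  then show ?thesis by (simp add: inner_L2)
qed

text \<open>The gradient equation says \<open>\<nu> = \<sigma> (ctrl - u)\<close> with \<open>\<sigma> = sig_hat D\<close>, so the normal cone condition is the
  variational inequality of the projection of \<open>ctrl\<close> onto \<open>U_ad\<close>.  The clipped control satisfies the same inequality
  (\<open>clipped_variational\<close>), and its solution is unique.\<close>

lemma KKT_control:
  assumes \<nu>: "\<nu> \<in> normal_cone U (U_ad D) u"
    and eq: "sig_u D *\<^sub>R (u - u_m D) + gam D *\<^sub>R sig_l D *\<^sub>R u - B' p + \<nu> = 0"
  shows "u = clipped p"
proof -
  have u: "u \<in> U_ad D" and cone: "\<And>v. v \<in> U_ad D \<Longrightarrow> inner \<nu> (v - u) \<le> 0" using \<nu> by (auto simp: normal_cone_def)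
  have "AE t in lebesgue. L2_fun (u_a D) t \<le> L2_fun (u_b D) t" using u by (intro AE_bounds_ordered) auto
  then have cl: "clipped p \<in> U_ad D" by (rule clipped_in_U_ad)
  have "sig_hat D *\<^sub>R ctrl D p = B' p + sig_u D *\<^sub>R u_m D"
    using sig_hat by (simp add: ctrl_def B_adj_eq)
  moreover have "\<nu> = B' p + sig_u D *\<^sub>R u_m D - sig_hat D *\<^sub>R u"
    using eq by (simp add: sig_hat_def algebra_simps eq_neg_iff_add_eq_0)
  ultimately have "\<nu> = sig_hat D *\<^sub>R (ctrl D p - u)" by (simp add: scaleR_diff_right)
  with cone[OF cl] have 1: "inner (ctrl D p - u) (clipped p - u) \<le> 0" using sig_hat by (simp add: mult_le_0_iff)
  have 2: "inner (ctrl D p - clipped p) (u - clipped p) \<le> 0" by (rule clipped_variational[OF u])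
  have "inner (u - clipped p) (u - clipped p) = inner (ctrl D p - u) (clipped p - u) + inner (ctrl D p - clipped p) (u - clipped p)"
    by (simp add: inner_diff_left inner_diff_right inner_commute)
  with 1 2 have "inner (u - clipped p) (u - clipped p) \<le> 0" by linarith
  then show ?thesis by (metis inner_ge_zero inner_eq_zero_iff order_antisym eq_iff_diff_eq_0)
qed

lemma KKT_complementary:
  assumes "KKT D \<beta> y u z p \<nu>"
  shows "z $ i * (K_T D *v \<beta> - b_T D) $ i = 0"
proof -
  have zg: "\<And>i. 0 \<le> z $ i" "\<And>i. (K_T D *v \<beta> - b_T D) $ i \<le> 0" "inner z (K_T D *v \<beta> - b_T D) = 0"
    using assms unfolding KKT_def by blast+
  have "(\<Sum>i\<in>UNIV. - (z $ i * (K_T D *v \<beta> - b_T D) $ i)) = 0"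
    using zg(3) unfolding inner_vec_def inner_real_def sum_negf by simp
  moreover have "\<forall>i\<in>UNIV. 0 \<le> - (z $ i * (K_T D *v \<beta> - b_T D) $ i)"
    using zg by (simp add: mult_nonneg_nonpos)
  ultimately have "- (z $ i * (K_T D *v \<beta> - b_T D) $ i) = 0"
    by (subst (asm) sum_nonneg_eq_0_iff) auto
  then show ?thesis by simp
qed

lemma KKT_imp_root:
  assumes KKT: "KKT D \<beta> y u z p \<nu>" and \<beta>: "\<And>i. 0 < \<beta> $ i"
  shows "(\<beta>, y, u, z, p) \<in> W_dom D" and "newton_W D (\<beta>, y, u, z, p) = 0"
proof -
  have y: "y \<in> H" and p: "p \<in> H" and u_ad: "u \<in> U_ad D"
    and state: "op_A D y = op_B D u"
    and e1: "gradient (\<lambda>\<beta>'. obj_F D \<beta>' y u) \<beta> + gam D *\<^sub>R (gradient (\<lambda>\<beta>'. obj_f D \<beta>' y u) \<beta> - a_T D) + transpose (K_T D) *v z = 0"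
    and e2: "dual_derivative H (\<lambda>y'. obj_F D \<beta> y' u) y + gam D *\<^sub>R dual_derivative H (\<lambda>y'. obj_f D \<beta> y' u) y + A_adj D p = 0"
    and e3: "gradient_on U (\<lambda>u'. obj_F D \<beta> y u') u + gam D *\<^sub>R gradient_on U (\<lambda>u'. obj_f D \<beta> y u') u - B_adj D p + \<nu> = 0"
    and z: "\<And>i. 0 \<le> z $ i" and g: "\<And>i. (K_T D *v \<beta> - b_T D) $ i \<le> 0"
    and \<nu>: "\<nu> \<in> normal_cone U (U_ad D) u"
    using KKT unfolding KKT_def by blast+
  have u: "u \<in> U" using u_ad by (simp add: U_ad_iff)
  show dom: "(\<beta>, y, u, z, p) \<in> W_dom D" using \<beta> y u p by (simp add: W_dom_def)
  have nz: "\<And>i. \<beta> $ i \<noteq> 0" using \<beta> by (metis less_irrefl)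
  have "gradient (\<lambda>\<beta>'. obj_F D \<beta>' y u) \<beta> = grad_F \<beta>"
    by (rule gradient_on_eq[OF _ _ _ obj_F_deriv_beta[OF nz]]) auto
  moreover have "gradient (\<lambda>\<beta>'. obj_f D \<beta>' y u) \<beta> = grad_f \<beta> y"
    by (rule gradient_on_eq[OF _ _ _ obj_f_deriv_beta[OF nz y]]) auto
  ultimately have 1: "grad_F \<beta> + gam D *\<^sub>R (grad_f \<beta> y - a_T D) + transpose (K_T D) *v z = 0" using e1 by metis
  have "dual_derivative H (\<lambda>y'. obj_F D \<beta> y' u) y = der_F y"
    by (rule dual_derivative_eq[OF H y der_F_in obj_F_deriv_y[OF y]])
  moreover have "dual_derivative H (\<lambda>y'. obj_f D \<beta> y' u) y = der_f \<beta> y"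
    by (rule dual_derivative_eq[OF H y der_f_in obj_f_deriv_y[OF y]])
  ultimately have 2: "der_F y + gam D *\<^sub>R der_f \<beta> y + A' p = 0" using e2 by (simp add: A_adj_eq)
  have half: "((\<lambda>u'. 1 / 2 * (norm (u' - d))\<^sup>2) has_derivative (\<lambda>v. inner v (u - d))) (at u within U)" for d
  proof -
    have "blinfun_apply (pull id_blinfun (u - d)) = (\<lambda>v. inner v (u - d))" by (rule ext) simp
    then show ?thesis using half_norm_sq_deriv[of id_blinfun d u U] by simp
  qed
  have gF: "gradient_on U (\<lambda>u'. obj_F D \<beta> y u') u = sig_u D *\<^sub>R (u - u_m D)"
  proof (rule gradient_on_eq[OF U(1) u])
    show "sig_u D *\<^sub>R (u - u_m D) \<in> U" by (intro subspace_scale subspace_diff U(1) u u_m)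
    from has_derivative_add[OF has_derivative_add[OF has_derivative_const has_derivative_mult_right[OF half]] has_derivative_const]
    show "((\<lambda>u'. obj_F D \<beta> y u') has_derivative (\<lambda>v. inner v (sig_u D *\<^sub>R (u - u_m D)))) (at u within U)"
      by (simp add: obj_F_def)
  qed
  have gf: "gradient_on U (\<lambda>u'. obj_f D \<beta> y u') u = sig_l D *\<^sub>R u"
  proof (rule gradient_on_eq[OF U(1) u])
    show "sig_l D *\<^sub>R u \<in> U" by (intro subspace_scale U(1) u)
    from has_derivative_add[OF has_derivative_const has_derivative_mult_right[OF half[of 0]]]
    show "((\<lambda>u'. obj_f D \<beta> y u') has_derivative (\<lambda>v. inner v (sig_l D *\<^sub>R u))) (at u within U)"
      by (simp add: obj_f_def)
  qed
  have 3: "u = clipped p" using e3 by (intro KKT_control[OF \<nu>]) (simp add: gF gf B_adj_eq)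
  have 4: "max ((K_T D *v \<beta> - b_T D) $ i) (- (z $ i)) = 0" for i
    using KKT_complementary[OF KKT, of i] z[of i] g[of i] by (auto simp: max_def)
  show "newton_W D (\<beta>, y, u, z, p) = 0"
    unfolding newton_W_eq[OF dom] 1 2 4 state 3[symmetric] by (simp add: zero_prod_def vec_eq_iff)
qed

lemma coercive_hessian_eventually:
  assumes a: "(\<beta>0, y0, u0, z0, p0) \<in> W_dom D"
  shows "\<exists>c>0. \<exists>k\<ge>0. \<forall>\<^sub>F x in at (\<beta>0, y0, u0, z0, p0) within W_dom D.
    coercive_hessian c k (hess_b (fst x) (fst (snd x))) (hess_y (fst x) (fst (snd x)))"
proof -
  let ?a = "(\<beta>0, y0, u0, z0, p0)"
  define b1 where "b1 = norm \<beta>0 + 1"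
  define S where "S = (\<Sum>i\<in>UNIV. inverse (\<beta>0 $ i)) + 1"
  define R where "R = (\<Sum>i\<in>UNIV. norm (res i y0)) + 1"
  have \<beta>0: "0 < \<beta>0 $ i" for i using a by (simp add: W_dom_def)
  have "0 \<le> (\<Sum>i\<in>UNIV. inverse (\<beta>0 $ i))" "0 \<le> (\<Sum>i\<in>UNIV. norm (res i y0))"
    by (rule sum_nonneg, simp add: less_imp_le[OF \<beta>0])+
  then have pos: "0 < b1" "0 \<le> S" "0 \<le> R"
    using norm_ge_zero[of \<beta>0] unfolding b1_def S_def R_def by linarith+
  have k: "0 \<le> hess_bound S R"
    using pos sig_b gam by (auto simp: hess_bound_def intro!: sum_nonneg add_nonneg_nonneg mult_nonneg_nonneg)
  have t1: "((\<lambda>x. fst x) \<longlongrightarrow> \<beta>0) (at ?a within W_dom D)"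
    using tendsto_fst[OF tendsto_ident_at, of ?a "W_dom D"] by simp
  have t2: "((\<lambda>x. fst (snd x)) \<longlongrightarrow> y0) (at ?a within W_dom D)"
    using tendsto_fst[OF tendsto_snd[OF tendsto_ident_at], of ?a "W_dom D"] by simp
  have "\<forall>\<^sub>F x in at ?a within W_dom D. norm (fst x) < b1"
    by (rule order_tendstoD(2)[OF tendsto_norm[OF t1]]) (simp add: b1_def)
  moreover have "\<forall>\<^sub>F x in at ?a within W_dom D. \<forall>i. inverse (fst x $ i) < S"
  proof (rule eventually_all_finite)
    fix i
    have "inverse (\<beta>0 $ i) \<le> (\<Sum>i\<in>UNIV. inverse (\<beta>0 $ i))"
      by (rule member_le_sum) (use \<beta>0 in \<open>auto intro: less_imp_le\<close>)
    moreover have "((\<lambda>x. inverse (fst x $ i)) \<longlongrightarrow> inverse (\<beta>0 $ i)) (at ?a within W_dom D)"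
      by (intro tendsto_inverse tendsto_vec_nth t1) (use \<beta>0[of i] in simp)
    ultimately show "\<forall>\<^sub>F x in at ?a within W_dom D. inverse (fst x $ i) < S"
      by (intro order_tendstoD(2)) (auto simp: S_def)
  qed
  moreover have "\<forall>\<^sub>F x in at ?a within W_dom D. \<forall>i. norm (res i (fst (snd x))) < R"
  proof (rule eventually_all_finite)
    fix i
    have "norm (res i y0) \<le> (\<Sum>i\<in>UNIV. norm (res i y0))" by (rule member_le_sum) auto
    moreover have "((\<lambda>x. norm (res i (fst (snd x)))) \<longlongrightarrow> norm (res i y0)) (at ?a within W_dom D)"
      unfolding res_def
      by (intro tendsto_norm tendsto_diff tendsto_const bounded_linear.tendsto[OF blinfun.bounded_linear_right] t2)
    ultimately show "\<forall>\<^sub>F x in at ?a within W_dom D. norm (res i (fst (snd x))) < R"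
      by (intro order_tendstoD(2)) (auto simp: R_def)
  qed
  moreover have "\<forall>\<^sub>F x in at ?a within W_dom D. x \<in> W_dom D" by (simp add: eventually_at_filter)
  ultimately have "\<forall>\<^sub>F x in at ?a within W_dom D.
      coercive_hessian (3 * sig_b D * inverse b1 ^ 4) (hess_bound S R) (hess_b (fst x) (fst (snd x))) (hess_y (fst x) (fst (snd x)))"
  proof eventually_elim
    case (elim x)
    have mem: "\<And>i. 0 < fst x $ i" using elim(4) by (auto simp: W_dom_def)
    have up: "fst x $ i \<le> b1" for i using component_le_norm_cart[of "fst x" i] elim(1) by linarith
    show ?case
      by (rule coercive_hessian_near[OF pos mem up]) (use elim in \<open>auto intro: less_imp_le\<close>)
  qed
  moreover have "0 < 3 * sig_b D * inverse b1 ^ 4" using sig_b pos by simp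
  ultimately show ?thesis using k by blast
qed

lemma newton_W'_diff:
  assumes x: "x \<in> W_dom D" and st: "s \<in> W_dirs D" "t \<in> W_dirs D"
  shows "newton_W' D x (s - t) = newton_W' D x s - newton_W' D x t"
proof -
  obtain \<beta> y u z p where x_eq: "x = (\<beta>, y, u, z, p)" by (metis prod_cases5)
  have x': "(\<beta>, y, u, z, p) \<in> W_dom D" using x by (simp add: x_eq)
  have hess: "hess_b \<beta> y (w - w') = hess_b \<beta> y w - hess_b \<beta> y w'" "hess_y \<beta> y (w - w') = hess_y \<beta> y w - hess_y \<beta> y w'" for w w'
    using hess_linear(1,2)[of \<beta> y w "- w'"] hess_linear(3,4)[of \<beta> y "- 1" w'] by simp_all
  have "s - t \<in> W_dirs D" using st by (intro subspace_diff[OF W_dirs_subspace])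
  then show ?thesis
    unfolding x_eq newton_W'_eq[OF x' st(1)] newton_W'_eq[OF x' st(2)] newton_W'_eq[OF x' \<open>s - t \<in> W_dirs D\<close>]
    by (intro newton_op_diff[OF hess cutoff_mult_ind[OF act3_sets]]) (use st in \<open>auto simp: W_dirs_def\<close>)
qed

text \<open>Near the root the constraint \<open>j\<close> stays out of the active set \<open>act1\<close>, whatever happens to the other
  constraints, so the bound and the solvability of the abstract Newton system apply.\<close>

lemma newton_W'_regular:
  assumes a: "(\<beta>0, y0, u0, z0, p0) \<in> W_dom D"
    and G: "bounded_linear G" "\<And>z i. i \<noteq> j \<Longrightarrow> (K_T D *v G z) $ i = z $ i"
    and j: "(K_T D *v \<beta>0 - b_T D) $ j < - (z0 $ j)"
  shows "\<exists>M>0. \<forall>\<^sub>F x in at (\<beta>0, y0, u0, z0, p0) within W_dom D.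
    (\<forall>s\<in>W_dirs D. norm s \<le> M * norm (newton_W' D x s)) \<and> (\<exists>s\<in>W_dirs D. newton_W' D x s = - newton_W D x)"
proof -
  let ?a = "(\<beta>0, y0, u0, z0, p0)"
  obtain c k where ck: "0 < c" "0 \<le> k" and hess: "\<forall>\<^sub>F x in at ?a within W_dom D.
      coercive_hessian c k (hess_b (fst x) (fst (snd x))) (hess_y (fst x) (fst (snd x)))"
    using coercive_hessian_eventually[OF a] by blast
  obtain M where M: "0 < M" "\<And>I \<pi> g1 g2 s. j \<notin> I \<Longrightarrow> cutoff \<pi> \<Longrightarrow> coercive_hessian c k g1 g2 \<Longrightarrow>
      s \<in> UNIV \<times> H \<times> U \<times> UNIV \<times> H \<Longrightarrow> norm s \<le> M * norm (newton_op (K_T D) (sig_hat D) I \<pi> g1 g2 s)"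
    using newton_op_bound[OF sig_hat ck G] by metis
  have "((\<lambda>x. (K_T D *v fst x - b_T D) $ j + fst (snd (snd (snd x))) $ j) \<longlongrightarrow>
      (K_T D *v fst ?a - b_T D) $ j + fst (snd (snd (snd ?a))) $ j) (at ?a within W_dom D)"
    by (intro tendsto_add tendsto_vec_nth tendsto_diff tendsto_const tendsto_fst tendsto_snd tendsto_ident_at
        bounded_linear.tendsto[OF matrix_vector_mul_bounded_linear])
  moreover have "(K_T D *v fst ?a - b_T D) $ j + fst (snd (snd (snd ?a))) $ j < 0" using j by simp
  ultimately have act: "\<forall>\<^sub>F x in at ?a within W_dom D. (K_T D *v fst x - b_T D) $ j + fst (snd (snd (snd x))) $ j < 0"
    by (rule order_tendstoD(2))
  have "\<forall>\<^sub>F x in at ?a within W_dom D. x \<in> W_dom D" by (simp add: eventually_at_filter)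
  with hess act have "\<forall>\<^sub>F x in at ?a within W_dom D.
    (\<forall>s\<in>W_dirs D. norm s \<le> M * norm (newton_W' D x s)) \<and> (\<exists>s\<in>W_dirs D. newton_W' D x s = - newton_W D x)"
  proof eventually_elim
    case (elim x)
    obtain \<beta> y u z p where x_eq: "x = (\<beta>, y, u, z, p)" by (metis prod_cases5)
    have x: "(\<beta>, y, u, z, p) \<in> W_dom D" using elim by (simp add: x_eq)
    have ch: "coercive_hessian c k (hess_b \<beta> y) (hess_y \<beta> y)" using elim(1) by (simp add: x_eq)
    have I: "j \<notin> act1 D \<beta> z" using elim(2) by (simp add: x_eq act1_def)
    note cut = cutoff_mult_ind[OF act3_sets[of p]]
    obtain r1 r2 r3 r4 r5 where r: "newton_W D (\<beta>, y, u, z, p) = (r1, r2, r3, r4, r5)" by (metis prod_cases5)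
    note rr = newton_W_range[OF x r]
    obtain s where s: "s \<in> UNIV \<times> H \<times> U \<times> UNIV \<times> H"
      "newton_op (K_T D) (sig_hat D) (act1 D \<beta> z) (mult_ind (act3 D p)) (hess_b \<beta> y) (hess_y \<beta> y) s = (- r1, - r2, - r3, - r4, - r5)"
      using newton_op_surj[OF sig_hat ck(1) G I cut ch subspace_neg[OF subspace_dual_of[OF H] rr(1)]
          subspace_neg[OF U(1) rr(2)] subspace_neg[OF subspace_dual_of[OF H] rr(3)]] by blast
    have "newton_W' D x s = - newton_W D x" "s \<in> W_dirs D"
      using s newton_W'_eq[OF x, of s] by (auto simp: x_eq r W_dirs_def)
    moreover have "norm s \<le> M * norm (newton_W' D x s)" if "s \<in> W_dirs D" for s
      unfolding x_eq newton_W'_eq[OF x that] by (rule M(2)[OF I cut ch]) (use that in \<open>simp add: W_dirs_def\<close>)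
    ultimately show ?case by blast
  qed
  with M(1) show ?thesis by blast
qed

lemma W_dom_neighbourhood:
  assumes a: "a \<in> W_dom D"
  shows "\<exists>r>0. \<forall>x\<in>W_dirs D. dist x a < r \<longrightarrow> x \<in> W_dom D"
proof -
  have "fst a \<in> {\<beta>. \<forall>i. 0 < \<beta> $ i}" using a by (auto simp: W_dom_def)
  then obtain r where r: "0 < r" "\<And>\<beta>. dist \<beta> (fst a) < r \<Longrightarrow> \<forall>i. 0 < \<beta> $ i"
    using open_positive_vec[unfolded open_dist, rule_format, of "fst a"] by auto
  have "x \<in> W_dom D" if "x \<in> W_dirs D" "dist x a < r" for x
  proof -
    have "dist (fst x) (fst a) < r" using dist_fst_le[of x a] that(2) by linarith
    then show ?thesis using r(2) that(1) by (auto simp: W_dom_def W_dirs_def)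
  qed
  with r(1) show ?thesis by blast
qed

end

section \<open>Convergence of the Newton method\<close>

theorem theorem5p8:
  fixes D :: "('l::finite, 'n::finite, 'm::finite) prob_data"
    and T :: "(real^'n) set"
    and q q' :: real
    and B_ext :: "(real^'l \<Rightarrow> real) \<Rightarrow> ('l H1 \<Rightarrow>\<^sub>L real)"
    and \<beta>T :: "real^'n" and yT pT :: "'l H1" and uT \<nu>T :: "'l L2" and zT :: "real^'m"
  assumes "open (Dom D)" and "bounded (Dom D)"
    and "0 < sig_u D" and "0 < sig_l D" and "0 < sig_b D"
    and "y_m D \<in> L2_on (Dom D)" and "\<And>i. y_d D i \<in> L2_on (Dom D)"
    and "\<And>i. 0 < lo D $ i" and "\<And>i. lo D $ i < up D $ i"
    and "bounded_linear_on (H01 (Dom D)) (op_A D)" and "bij_betw (op_A D) (H01 (Dom D)) (Hm1 (Dom D))"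
    and "bounded_linear_on (L2_on (Dom D)) (op_B D)" and "op_B D ` L2_on (Dom D) \<subseteq> Hm1 (Dom D)"
    and "\<And>i. bounded_linear_on (H01 (Dom D)) (op_C D i)"
    and "\<And>i. op_C D i ` H01 (Dom D) \<subseteq> L2_on (Dom D)"
    and "1 < q" and "q < 2" and "1 / q + 1 / q' = 1"
    and "bounded_linear_on_Lp q (Dom D) B_ext" and "B_ext ` Lp_fun q (Dom D) \<subseteq> Hm1 (Dom D)"
    and "\<And>v. v \<in> L2_on (Dom D) \<Longrightarrow> B_ext (L2_fun v) = op_B D v"
    and "u_m D \<in> L2_on (Dom D)" and "u_a D \<in> L2_on (Dom D)" and "u_b D \<in> L2_on (Dom D)"
    and "L2_fun (u_m D) \<in> Lp_fun q' (Dom D)" and "L2_fun (u_a D) \<in> Lp_fun q' (Dom D)"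
    and "L2_fun (u_b D) \<in> Lp_fun q' (Dom D)"
    and "U_ad D \<noteq> {}"
    and "int CARD('n) simplex T" and "T \<subseteq> param_box D"
    and "CARD('m) = CARD('n) + 1" and "T = {\<beta>. \<forall>i. (K_T D *v \<beta>) $ i \<le> b_T D $ i}"
    and "\<And>v. v extreme_point_of T \<Longrightarrow> xi_T D v = opt_value D v"
    and "0 < gam D"
    and "global_solution_PT D (\<beta>T, yT, uT)"
    and "KKT D \<beta>T yT uT zT pT \<nu>T"
  shows "\<exists>V. open V \<and> (\<beta>T, yT, uT, zT, pT) \<in> V \<and>
           (\<forall>x0 \<in> V \<inter> W_dom D. \<exists>x. newton_run D x0 x \<and>
              ((\<exists>i. (\<forall>j<i. newton_W D (x j) \<noteq> 0) \<and> newton_W D (x i) = 0 \<and>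
                    x i = (\<beta>T, yT, uT, zT, pT)) \<or>
               ((\<forall>i. newton_W D (x i) \<noteq> 0) \<and> q_superlinear x (\<beta>T, yT, uT, zT, pT))))"
proof -
  note asm = assms
  interpret control_problem D
    by unfold_locales (use asm in auto)
  let ?a = "(\<beta>T, yT, uT, zT, pT)"
  have KKT: "KKT D \<beta>T yT uT zT pT \<nu>T" by fact
  then have g: "\<And>i. (K_T D *v \<beta>T - b_T D) $ i \<le> 0" by (simp add: KKT_def)
  have T: "T = {\<beta>. \<forall>i. (K_T D *v \<beta>) $ i \<le> b_T D $ i}" by fact
  have \<beta>T: "\<beta>T \<in> T" using g by (simp add: T)
  have pos: "0 < \<beta>T $ i" for i
  proof -
    have "0 < up D $ i" using asm(8,9) less_trans by blast
    moreover have "inverse (up D $ i) \<le> \<beta>T $ i" using \<beta>T \<open>T \<subseteq> param_box D\<close> by (auto simp: param_box_def)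
    ultimately show ?thesis by (meson less_le_trans positive_imp_inverse_positive)
  qed
  note simplex = simplex_bounded_nontrivial[OF \<open>int CARD('n) simplex T\<close>]
  obtain \<beta>' where \<beta>': "\<beta>' \<in> T" "\<beta>' \<noteq> \<beta>T" using simplex(2) by blast
  obtain j where j: "(K_T D *v \<beta>T - b_T D) $ j < 0"
    using simplex_inactive_constraint[of "K_T D" "b_T D" \<beta>T \<beta>'] simplex(1) \<beta>T \<beta>' unfolding T by blast
  have zj: "zT $ j = 0" using KKT_complementary[OF KKT, of j] j by auto
  obtain G where G: "bounded_linear G" "\<And>z i. i \<noteq> j \<Longrightarrow> (K_T D *v G z) $ i = z $ i"
    using simplex_constraint_rows[of "K_T D" "b_T D" \<beta>T j] \<open>CARD('m) = CARD('n) + 1\<close> simplex(1) \<beta>T unfolding T by blast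
  note root = KKT_imp_root[OF KKT pos]
  obtain \<kappa> where \<kappa>: "0 \<le> \<kappa>" "\<And>E p. E \<in> sets lebesgue \<Longrightarrow> E \<subseteq> Dom D \<Longrightarrow>
      norm (mult_ind E (B' p)) \<le> \<kappa> * norm p * measure lebesgue E powr (1 / q - 1 / 2)"
    using norm_gap[OF asm(16,17,19,21)] by blast
  have \<alpha>: "0 < 1 / q - 1 / 2" using asm(16,17) by (simp add: field_simps)
  have diff: "newton_diff (newton_W D) (newton_W' D) ?a (W_dom D)"
    by (rule newton_diff_newton_W[OF root(1) AE_bounds_ordered[OF \<open>U_ad D \<noteq> {}\<close>] \<kappa>(1) \<alpha> \<kappa>(2)])
  obtain M where M: "0 < M" and reg: "\<forall>\<^sub>F x in at ?a within W_dom D.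
    (\<forall>s\<in>W_dirs D. norm s \<le> M * norm (newton_W' D x s)) \<and> (\<exists>s\<in>W_dirs D. newton_W' D x s = - newton_W D x)"
  proof -
    have "(K_T D *v \<beta>T - b_T D) $ j < - (zT $ j)" using j zj by simp
    from newton_W'_regular[OF root(1) G this] show ?thesis using that by blast
  qed
  obtain r where r: "0 < r" "\<And>x. x \<in> W_dirs D \<Longrightarrow> dist x ?a < r \<Longrightarrow> x \<in> W_dom D"
    using W_dom_neighbourhood[OF root(1)] by blast
  show ?thesis
    unfolding newton_run_def newton_iteration_def[symmetric]
    using local_superlinear_newton[OF W_dirs_subspace W_dom_subset root(1) root(2) r diff newton_W'_diff M reg]
    by (simp only: conj_assoc)
qed

end
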